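(* Consider the linear model $Y=X\beta_0+\epsilon$ where $\epsilon\sim\mathcal N(0,I)$ in $\mathbb R^n$, and $X$ is a random $n\times p$ matrix independent of $\epsilon$ with independent rows $X^{(i)}\sim\mathcal N(0,\Sigma_0)$, where $\Theta_0:=\Sigma_0^{-1}$ exists, $1/\Lambda_{\min}(\Sigma_0)=\mathcal O(1)$, $\|\Sigma_0\|_\infty=\mathcal O(1)$ and $\Lambda_{\max}(\Sigma_0)=\mathcal O(1)$. Let $j\in\{1,\dots,p\}$, let $\beta_0\in\mathcal B(d_n)$ with $d_n=o(\sqrt n/\log p)$ and suppose $\|\Theta_j^0\|_0\le d_n$, where $\Theta_j^0$ is the $j$-th column of $\Theta_0$. Let $\hat b_j:=\hat\beta_j+\hat\Theta_j^TX^T(Y-X\hat\beta)/n$ be the de-sparsified Lasso with tuning parameters $\lambda\asymp\lambda_j\asymp\sqrt{\log p/n}$ with sufficiently large proportionality constants. Then for every $\tilde\beta_n\in B(\beta_0,c/\sqrt n)$, with $\tilde\beta_{n,j}$ denoting the $j$-th entry of $\tilde\beta_n$, $$\frac{\sqrt n\,(\hat b_j-\tilde\beta_{n,j})}{(\Theta^0_{jj})^{1/2}}\ \rightsquigarrow\ \mathcal N(0,1)\quad\text{under } P_{\tilde\beta_n}.$$ Moreover, let $T_n$ be an asymptotically linear estimator with an influence function $l_{\beta_0}$: $$T_n-\beta_j^0=\frac1n\sum_{i=1}^n l_{\beta_0}(X^{(i)},Y^{(i)})+o_{P_{\beta_0}}(n^{-1/2}),$$ where $\mathbb E\, l_{\beta_0}(X^{(i)},Y^{(i)})=0$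 and $\mathrm{var}(l_{\beta_0}(X^{(i)},Y^{(i)}))=:V_{\beta_0}<\infty$. Assume that for all $h\in\mathbb R^p$ and $i=1,\dots,n$ it holds that $$\mathbb E\big[l_{\beta_0}(X^{(i)},Y^{(i)})\,\epsilon_i\,h^TX^{(i)}\big]-h_j=o(1).$$ Then $$V_{\beta_0}\ \ge\ \Theta^0_{jj}+o(1).$$
   Context: Asymptotic regime: $n\to\infty$, $p=p_n$ may depend on $n$ (possibly $p\gg n$), and all parameters ($\beta_0,\Sigma_0,j,d_n,\lambda,\lambda_j,h,\dots$) are sequences that may depend on $n$, the index being suppressed; $\mathcal O(\cdot)$, $o(\cdot)$, $\asymp$ refer to $n\to\infty$. $\rightsquigarrow$ denotes convergence in distribution; $P_\beta$ is the distribution of the data $(X,Y)$ when the regression vector is $\beta$; expectations and variances involving $l_{\beta_0}$ are under $P_{\beta_0}$. $Y^{(i)}$ is the $i$-th entry of $Y$, $\beta^0_j$ the $j$-th entry of $\beta_0$, and $\Theta^0_{jj}$ the $(j,j)$ entry of $\Theta_0$. $\|A\|_\infty:=\max_{i,k}|A_{ik}|$ for a matrix $A$; $\Lambda_{\min},\Lambda_{\max}$ are extreme eigenvalues; $\|x\|_0$ is the number of non-zero entries of $x$; $\|x\|_n^2:=\|x\|_2^2/n$ for $x\in\mathbb R^n$. Parameter set: $\mathcal B\subset\mathbb R^p$ is a parameter space, $C,c>0$ are universal constants (independent of $n,p$), and $$\mathcal B(d_n):=\{\beta\in\mathcal B:\|\beta\|_0\le d_n,\ \|\beta\|_2\le C\},\qquad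 B(\beta,\varepsilon):=\{\tilde\beta\in\mathcal B(d_n):\|\tilde\beta-\beta\|_2\le\varepsilon\}.$$ Estimators: the Lasso is $\hat\beta:=\arg\min_{\beta\in\mathbb R^p}\|Y-X\beta\|_n^2+2\lambda\|\beta\|_1$. Let $X_j$ be the $j$-th column of $X$ and $X_{-j}$ the matrix $X$ without this column. Nodewise regression: $\hat\gamma_j:=\arg\min_{\gamma\in\mathbb R^{p-1}}\|X_j-X_{-j}\gamma\|_n^2+2\lambda_j\|\gamma\|_1$, $\hat\tau_j^2:=\|X_j-X_{-j}\hat\gamma_j\|_n^2+\lambda_j\|\hat\gamma_j\|_1$, and $\hat\Theta_j:=(-\hat\gamma_{j,1},\dots,-\hat\gamma_{j,j-1},1,-\hat\gamma_{j,j+1},\dots,-\hat\gamma_{j,p})^T/\hat\tau_j^2$ (entries of $\hat\gamma_j$ indexed by $\{1,\dots,p\}\setminus\{j\}$). *)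

theory Defs
  imports
    "HOL-Probability.Probability"
    "HOL-Library.Landau_Symbols"
    "Jordan_Normal_Form.Spectral_Radius"
begin

text \<open>
  The dimension \<open>p\<close> varies with \<open>n\<close>, so vectors are real functions on a finite index set
  \<open>I\<close> of naturals (extensional, i.e. \<^const>\<open>undefined\<close> off \<open>I\<close>); coordinates are counted from 0.
  A vector indexed by \<open>{1..p} \<setminus> {j}\<close> is the case \<open>I = {..<p} - {j}\<close>. The Euclidean norm is
  \<^const>\<open>L2_set\<close>. Only the deterministic matrices are of type \<^typ>\<open>real mat\<close>.
\<close>

abbreviation rvec :: "nat set \<Rightarrow> (nat \<Rightarrow> real) set" where
  "rvec I \<equiv> I \<rightarrow>\<^sub>E UNIV"

abbreviation rvec_borel :: "nat set \<Rightarrow> (nat \<Rightarrow> real) measure" where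
  "rvec_borel I \<equiv> PiM I (\<lambda>_. borel)"

definition dotp :: "nat \<Rightarrow> (nat \<Rightarrow> real) \<Rightarrow> (nat \<Rightarrow> real) \<Rightarrow> real" where
  "dotp p u v = (\<Sum>k<p. u k * v k)"

definition l0norm :: "nat \<Rightarrow> (nat \<Rightarrow> real) \<Rightarrow> nat" where
  "l0norm p v = card {k. k < p \<and> v k \<noteq> 0}"

definition lambda_min :: "real mat \<Rightarrow> real" where
  "lambda_min A = Min (spectrum A)"

definition lambda_max :: "real mat \<Rightarrow> real" where
  "lambda_max A = Max (spectrum A)"

definition max_abs_entry :: "real mat \<Rightarrow> real" where
  "max_abs_entry A = Max (abs ` elements_mat A)"

definition quad_form :: "nat \<Rightarrow> real mat \<Rightarrow> (nat \<Rightarrow> real) \<Rightarrow> real" where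
  "quad_form p A a = (\<Sum>i<p. \<Sum>k<p. a i * A $$ (i, k) * a k)"

definition centered_normal :: "real \<Rightarrow> real measure" where
  "centered_normal v =
     (if v = 0 then return borel 0 else density lborel (normal_density 0 (sqrt v)))"

text \<open>
  \<open>G\<close> is the law \<open>N(0, S)\<close> on \<open>\<real>\<^sup>p\<close>: every linear form \<open>a\<^sup>T x\<close> has the univariate law
  \<open>N(0, a\<^sup>T S a)\<close>. Symmetry and non-negativity of \<open>S\<close> must be required separately:
  the linear forms only see the symmetric part of \<open>S\<close>, and \<^const>\<open>normal_density\<close> depends on
  its scale parameter only through its square, while \<^const>\<open>sqrt\<close> is odd.
\<close>

definition mv_normal :: "nat \<Rightarrow> real mat \<Rightarrow> (nat \<Rightarrow> real) measure \<Rightarrow> bool" where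
  "mv_normal p S G \<longleftrightarrow>
     S \<in> carrier_mat p p \<and> transpose_mat S = S \<and> (\<forall>a. 0 \<le> quad_form p S a) \<and>
     prob_space G \<and> sets G = sets (rvec_borel {..<p}) \<and>
     (\<forall>a. distr G borel (dotp p a) = centered_normal (quad_form p S a))"

type_synonym design = "nat \<Rightarrow> nat \<Rightarrow> real"  \<comment> \<open>\<open>X i\<close> is the \<open>i\<close>-th row\<close>
type_synonym obs = "design \<times> (nat \<Rightarrow> real)"

definition design_space :: "nat \<Rightarrow> nat \<Rightarrow> design measure" where
  "design_space n p = PiM {..<n} (\<lambda>_. rvec_borel {..<p})"

definition obs_space :: "nat \<Rightarrow> nat \<Rightarrow> obs measure" where
  "obs_space n p = design_space n p \<Otimes>\<^sub>M rvec_borel {..<n}"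

text \<open>
  The law \<open>P\<^sub>\<beta>\<close> of \<open>(X, X \<beta> + \<epsilon>)\<close>, where the rows of \<open>X\<close> are independent with law \<open>G\<close>
  and \<open>\<epsilon> \<sim> N(0, I)\<close> is independent of \<open>X\<close>.
\<close>

definition data_law :: "nat \<Rightarrow> nat \<Rightarrow> (nat \<Rightarrow> real) measure \<Rightarrow> (nat \<Rightarrow> real) \<Rightarrow> obs measure" where
  "data_law n p G \<beta> =
     distr (PiM {..<n} (\<lambda>_. G) \<Otimes>\<^sub>M PiM {..<n} (\<lambda>_. std_normal_distribution)) (obs_space n p)
       (\<lambda>(X, e). (X, \<lambda>i\<in>{..<n}. dotp p (X i) \<beta> + e i))"

definition sparse_params ::
    "(nat \<Rightarrow> real) set \<Rightarrow> real \<Rightarrow> nat \<Rightarrow> nat \<Rightarrow> (nat \<Rightarrow> real) set" where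
  "sparse_params B C p d = {\<beta> \<in> B. l0norm p \<beta> \<le> d \<and> L2_set \<beta> {..<p} \<le> C}"

definition sparse_ball ::
    "(nat \<Rightarrow> real) set \<Rightarrow> real \<Rightarrow> nat \<Rightarrow> nat \<Rightarrow> (nat \<Rightarrow> real) \<Rightarrow> real \<Rightarrow> (nat \<Rightarrow> real) set" where
  "sparse_ball B C p d \<beta> r =
     {b \<in> sparse_params B C p d. L2_set (\<lambda>k. b k - \<beta> k) {..<p} \<le> r}"

definition lasso_obj ::
    "nat \<Rightarrow> nat set \<Rightarrow> real \<Rightarrow> design \<Rightarrow> (nat \<Rightarrow> real) \<Rightarrow> (nat \<Rightarrow> real) \<Rightarrow> real" where
  "lasso_obj n I lam X y b =
     (L2_set (\<lambda>i. y i - (\<Sum>k\<in>I. X i k * b k)) {..<n})\<^sup>2 / real n + 2 * lam * (\<Sum>k\<in>I. \<bar>b k\<bar>)"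

text \<open>
  A minimiser of the Lasso criterion need not be unique for every data set, so an estimator is any
  measurable choice of one.
\<close>

definition lasso_estimator :: "nat \<Rightarrow> nat \<Rightarrow> real \<Rightarrow> (obs \<Rightarrow> nat \<Rightarrow> real) \<Rightarrow> bool" where
  "lasso_estimator n p lam bhat \<longleftrightarrow>
     bhat \<in> obs_space n p \<rightarrow>\<^sub>M rvec_borel {..<p} \<and>
     (\<forall>(X, y) \<in> space (obs_space n p).
        is_arg_min (lasso_obj n {..<p} lam X y) (\<lambda>b. b \<in> rvec {..<p}) (bhat (X, y)))"

definition nodewise_estimator ::
    "nat \<Rightarrow> nat \<Rightarrow> nat \<Rightarrow> real \<Rightarrow> (design \<Rightarrow> nat \<Rightarrow> real) \<Rightarrow> bool" where
  "nodewise_estimator n p j lam ghat \<longleftrightarrow>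
     ghat \<in> design_space n p \<rightarrow>\<^sub>M rvec_borel ({..<p} - {j}) \<and>
     (\<forall>X \<in> space (design_space n p).
        is_arg_min (lasso_obj n ({..<p} - {j}) lam X (\<lambda>i. X i j))
          (\<lambda>g. g \<in> rvec ({..<p} - {j})) (ghat X))"

definition tau_sq :: "nat \<Rightarrow> nat \<Rightarrow> nat \<Rightarrow> real \<Rightarrow> design \<Rightarrow> (nat \<Rightarrow> real) \<Rightarrow> real" where
  "tau_sq n p j lam X g =
     (L2_set (\<lambda>i. X i j - (\<Sum>k\<in>{..<p} - {j}. X i k * g k)) {..<n})\<^sup>2 / real n
       + lam * (\<Sum>k\<in>{..<p} - {j}. \<bar>g k\<bar>)"

definition theta_hat ::
    "nat \<Rightarrow> nat \<Rightarrow> nat \<Rightarrow> real \<Rightarrow> design \<Rightarrow> (nat \<Rightarrow> real) \<Rightarrow> nat \<Rightarrow> real" where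
  "theta_hat n p j lam X g k = (if k = j then 1 else - g k) / tau_sq n p j lam X g"

definition desparsified_lasso ::
    "nat \<Rightarrow> nat \<Rightarrow> nat \<Rightarrow> real \<Rightarrow> (obs \<Rightarrow> nat \<Rightarrow> real) \<Rightarrow> (design \<Rightarrow> nat \<Rightarrow> real) \<Rightarrow> obs \<Rightarrow> real" where
  "desparsified_lasso n p j lamj bhat ghat = (\<lambda>(X, y).
     bhat (X, y) j +
     dotp p (theta_hat n p j lamj X (ghat X))
       (\<lambda>k. \<Sum>i<n. X i k * (y i - dotp p (X i) (bhat (X, y)))) / real n)"

definition small_o_prob :: "(nat \<Rightarrow> 'a measure) \<Rightarrow> (nat \<Rightarrow> 'a \<Rightarrow> real) \<Rightarrow> (nat \<Rightarrow> real) \<Rightarrow> bool" where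
  "small_o_prob M R r \<longleftrightarrow>
     (\<forall>e>0. (\<lambda>n. measure (M n) {x \<in> space (M n). \<bar>R n x\<bar> > e * r n}) \<longlonglongrightarrow> 0)"

text \<open>
  The \<open>O(1)\<close> conditions on \<open>\<Sigma>0\<close> are stated with one explicit bound \<open>L\<close>, so that constants
  depending only on that bound can be quantified before the sequences.
  The sparsity condition \<open>d\<^sub>n = o(\<surd>n / log p)\<close> is multiplied out, because \<open>log p = 0\<close>
  when \<open>p = 1\<close> and division by zero would turn it into \<open>d\<^sub>n = 0\<close>.
\<close>

locale gaussian_design_model =
  fixes C L :: real
    and p :: "nat \<Rightarrow> nat"
    and \<Sigma>0 \<Theta>0 :: "nat \<Rightarrow> real mat"
    and G :: "nat \<Rightarrow> (nat \<Rightarrow> real) measure"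
    and j d :: "nat \<Rightarrow> nat"
    and B :: "nat \<Rightarrow> (nat \<Rightarrow> real) set"
    and \<beta>0 :: "nat \<Rightarrow> nat \<Rightarrow> real"
  assumes row_law: "\<And>n. mv_normal (p n) (\<Sigma>0 n) (G n)"
    and precision: "\<And>n. \<Theta>0 n \<in> carrier_mat (p n) (p n)"
      "\<And>n. inverts_mat (\<Sigma>0 n) (\<Theta>0 n)" "\<And>n. inverts_mat (\<Theta>0 n) (\<Sigma>0 n)"
    and lambda_min_bound: "\<forall>\<^sub>F n in sequentially. 1 / lambda_min (\<Sigma>0 n) \<le> L"
    and entry_bound: "\<forall>\<^sub>F n in sequentially. max_abs_entry (\<Sigma>0 n) \<le> L"
    and lambda_max_bound: "\<forall>\<^sub>F n in sequentially. lambda_max (\<Sigma>0 n) \<le> L"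
    and j_less: "\<And>n. j n < p n"
    and param_space: "\<And>n. B n \<subseteq> rvec {..<p n}"
    and beta0: "\<And>n. \<beta>0 n \<in> sparse_params (B n) C (p n) (d n)"
    and sparsity: "(\<lambda>n. real (d n) * ln (real (p n))) \<in> o(\<lambda>n. sqrt (real n))"
    and theta_sparse: "\<And>n. l0norm (p n) (\<lambda>k. \<Theta>0 n $$ (k, j n)) \<le> d n"

text \<open>
  \<open>lam\<close> is of order \<open>\<surd>(log p / n)\<close>, with lower proportionality constant at least \<open>K\<close>.
\<close>

definition tuning :: "real \<Rightarrow> (nat \<Rightarrow> nat) \<Rightarrow> (nat \<Rightarrow> real) \<Rightarrow> bool" where
  "tuning K p lam \<longleftrightarrow>
     lam \<in> \<Theta>(\<lambda>n. sqrt (ln (real (p n)) / real n)) \<and>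
     (\<forall>\<^sub>F n in sequentially. lam n \<ge> K * sqrt (ln (real (p n)) / real n))"

text \<open>
  \<open>T\<close> is asymptotically linear at \<open>\<beta>0\<close> for the \<open>j\<close>-th coordinate, with influence functions \<open>l\<close>
  of variance \<open>V\<close>. As \<open>l\<close> has mean zero, its variance is its second moment.
\<close>

definition asymptotically_linear ::
    "(nat \<Rightarrow> nat) \<Rightarrow> (nat \<Rightarrow> (nat \<Rightarrow> real) measure) \<Rightarrow> (nat \<Rightarrow> nat) \<Rightarrow> (nat \<Rightarrow> nat \<Rightarrow> real) \<Rightarrow>
     (nat \<Rightarrow> obs \<Rightarrow> real) \<Rightarrow> (nat \<Rightarrow> (nat \<Rightarrow> real) \<times> real \<Rightarrow> real) \<Rightarrow> (nat \<Rightarrow> real) \<Rightarrow> bool" where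
  "asymptotically_linear p G j \<beta>0 T l V \<longleftrightarrow>
     (\<forall>n. T n \<in> borel_measurable (obs_space n (p n))) \<and>
     (\<forall>n. l n \<in> borel_measurable (rvec_borel {..<p n} \<Otimes>\<^sub>M borel)) \<and>
     small_o_prob (\<lambda>n. data_law n (p n) (G n) (\<beta>0 n))
       (\<lambda>n (X, y). T n (X, y) - \<beta>0 n (j n) - (\<Sum>i<n. l n (X i, y i)) / real n)
       (\<lambda>n. real n powr (- 1 / 2)) \<and>
     (\<forall>n. \<forall>i<n.
        integrable (data_law n (p n) (G n) (\<beta>0 n)) (\<lambda>(X, y). (l n (X i, y i))\<^sup>2) \<and>
        (\<integral>(X, y). l n (X i, y i) \<partial>data_law n (p n) (G n) (\<beta>0 n)) = 0 \<and>
        (\<integral>(X, y). (l n (X i, y i))\<^sup>2 \<partial>data_law n (p n) (G n) (\<beta>0 n)) = V n)"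

text \<open>
  Under the law of the data for \<open>\<beta>0\<close>, the noise variable is \<open>\<epsilon>\<^sub>i = Y\<^sub>i - X\<^sub>i\<^sup>T \<beta>0\<close>.
  Both the direction \<open>h\<close> and the index \<open>i\<close> are sequences.
\<close>

definition unbiased_directions ::
    "(nat \<Rightarrow> nat) \<Rightarrow> (nat \<Rightarrow> (nat \<Rightarrow> real) measure) \<Rightarrow> (nat \<Rightarrow> nat) \<Rightarrow> (nat \<Rightarrow> nat \<Rightarrow> real) \<Rightarrow>
     (nat \<Rightarrow> (nat \<Rightarrow> real) \<times> real \<Rightarrow> real) \<Rightarrow> bool" where
  "unbiased_directions p G j \<beta>0 l \<longleftrightarrow>
     (\<forall>h i. (\<forall>n. h n \<in> rvec {..<p n}) \<longrightarrow> (\<forall>n>0. i n < n) \<longrightarrow>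
       (\<lambda>n. (\<integral>(X, y). l n (X (i n), y (i n)) * (y (i n) - dotp (p n) (X (i n)) (\<beta>0 n))
               * dotp (p n) (h n) (X (i n)) \<partial>data_law n (p n) (G n) (\<beta>0 n))
            - h n (j n)) \<longlonglongrightarrow> 0)"

end

theory Submission
  imports Defs "HOL-Real_Asymp.Real_Asymp"
begin

text \<open>
  Write \<open>v = \<Theta>\<^sub>j / \<Theta>\<^sub>j\<^sub>j\<close>, whose entries off \<open>j\<close> are minus the population nodewise coefficients. By the
  KKT conditions of the nodewise Lasso the estimation error of \<open>b\<^sub>j\<close> is
  \<open>w\<^sup>T X\<^sup>T \<epsilon> / (n \<tau>\<^sup>2)\<close> up to a term bounded by \<open>\<lambda>\<^sub>j\<close> times the \<open>\<ell>\<^sub>1\<close> error of the Lasso, where \<open>w\<close>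
  estimates \<open>v\<close>. Since \<open>d log p = o(\<surd>n)\<close>, entrywise concentration of the Gram matrix already gives
  the restricted eigenvalue condition, so both \<open>\<ell>\<^sub>1\<close> errors are \<open>O(d \<surd>(log p / n))\<close> and the estimation
  error times \<open>\<surd>n\<close> is close to \<open>n\<^sup>-\<^sup>1\<^sup>/\<^sup>2 \<Sum> (\<Theta>\<^sub>j\<^sup>T X\<^sub>i) \<epsilon>\<^sub>i\<close>. After division by \<open>\<surd>\<Theta>\<^sub>j\<^sub>j\<close> the summands are
  products of two independent standard normals for every \<open>n\<close>, so the central limit theorem for one fixed
  sequence applies. If \<open>p\<close> stays bounded the noise is not dominated by the penalty; there the
  crude bound with the full index set as support is good enough.

  For the variance bound, expand \<open>E (l - \<epsilon> \<Theta>\<^sub>j\<^sup>T X)\<^sup>2 \<ge> 0\<close>; the direction \<open>h = \<Theta>\<^sub>j\<close> turns the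
  cross term into \<open>\<Theta>\<^sub>j\<^sub>j + o(1)\<close>, and the second moment of \<open>\<epsilon> \<Theta>\<^sub>j\<^sup>T X\<close> is \<open>\<Theta>\<^sub>j\<^sub>j\<close>.
\<close>

section \<open>Quadratic forms and the smallest eigenvalue\<close>

text \<open>The case distinction on \<open>p\<close> and the tuning constant have one origin. At
  noise level \<open>s = 14 * L1 * sqrt (ln p / n)\<close> every deviation bound of the union bound
  has an exponent of more than \<open>3 * ln p\<close>, so the bad event has probability at most
  \<open>10 / p\<close>. The penalties must be at least \<open>2 * s\<close>, which gives the
  constant \<open>28 * (\<bar>L\<bar> + 1)\<close>. But \<open>10 / p\<close> does not vanish when
  \<open>p\<close> stays bounded, and wherever \<open>p = 1\<close> the penalties are eventually
  zero. As \<open>p\<close> may also oscillate between small and large values, no regime holds for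
  all large \<open>n\<close>. Hence an accuracy \<epsilon> is fixed first, a threshold
  \<open>A\<close> with \<open>10 / A \<le> \<epsilon>\<close> is taken, and each \<open>n\<close>
  is treated according to whether \<open>A \<le> p n\<close>; below the threshold the noise level is
  \<open>M / sqrt n\<close> with \<open>M\<close> depending on \<open>A\<close> and \<epsilon>. A
  second obstacle is that the eigenvalue hypothesis concerns the minimum of a spectrum, while the
  Lasso needs a lower bound for a quadratic form; the first section bridges the two.\<close>

definition bilin :: "nat \<Rightarrow> real mat \<Rightarrow> (nat \<Rightarrow> real) \<Rightarrow> (nat \<Rightarrow> real) \<Rightarrow> real" where
  "bilin p A u v = (\<Sum>i<p. \<Sum>k<p. u i * A $$ (i, k) * v k)"

lemma quad_form_bilin: "quad_form p A a = bilin p A a a"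
  by (simp add: quad_form_def bilin_def)

lemma bilin_eq_row: "bilin p A u v = (\<Sum>i<p. u i * (\<Sum>k<p. A $$ (i, k) * v k))"
  by (simp add: bilin_def sum_distrib_left mult.assoc)

lemma bilin_add_right: "bilin p A u (\<lambda>k. v k + w k) = bilin p A u v + bilin p A u w"
  by (simp add: bilin_def algebra_simps sum.distrib)

lemma bilin_scale_right: "bilin p A u (\<lambda>k. c * v k) = c * bilin p A u v"
  by (simp add: bilin_def algebra_simps sum_distrib_left)

lemma bilin_add_left: "bilin p A (\<lambda>k. v k + w k) u = bilin p A v u + bilin p A w u"
  by (simp add: bilin_def algebra_simps sum.distrib)

lemma bilin_scale_left: "bilin p A (\<lambda>k. c * v k) u = c * bilin p A v u"
  by (simp add: bilin_def algebra_simps sum_distrib_left)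

lemma bilin_diff_right: "bilin p A u (\<lambda>k. v k - w k) = bilin p A u v - bilin p A u w"
  by (simp add: bilin_def algebra_simps sum_subtractf)

lemma bilin_diff_left: "bilin p A (\<lambda>k. v k - w k) u = bilin p A v u - bilin p A w u"
  by (simp add: bilin_def algebra_simps sum_subtractf)

lemma transpose_index:
  assumes "A \<in> carrier_mat p p" "transpose_mat A = A" "i < p" "k < p"
  shows "A $$ (i, k) = A $$ (k, i)"
  by (metis assms carrier_matD index_transpose_mat(1))

lemma bilin_commute:
  assumes "A \<in> carrier_mat p p" "transpose_mat A = A"
  shows "bilin p A u v = bilin p A v u"
proof -
  have "bilin p A u v = (\<Sum>k<p. \<Sum>i<p. u i * A $$ (i, k) * v k)"
    unfolding bilin_def by (rule sum.swap)
  also have "\<dots> = bilin p A v u"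
    unfolding bilin_def using transpose_index[OF assms] by (intro sum.cong) (auto simp: mult_ac)
  finally show ?thesis .
qed

lemma bilin_Cauchy_Schwarz:
  assumes A: "A \<in> carrier_mat p p" "transpose_mat A = A" and pos: "\<And>a. 0 \<le> bilin p A a a"
  shows "(bilin p A u v)\<^sup>2 \<le> bilin p A u u * bilin p A v v"
proof -
  have quad: "0 \<le> bilin p A u u + 2 * t * bilin p A u v + t\<^sup>2 * bilin p A v v" for t
    using pos[of "\<lambda>k. u k + t * v k"] bilin_commute[OF A, of v u]
    by (simp add: bilin_add_left bilin_add_right bilin_scale_left bilin_scale_right
        power2_eq_square algebra_simps)
  show ?thesis
  proof (cases "bilin p A v v = 0")
    case True
    have "bilin p A u v = 0"
    proof (rule ccontr)
      assume n: "bilin p A u v \<noteq> 0"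
      \<comment> \<open>With \<open>bilin p A v v = 0\<close> the quadratic is affine in
        \<open>t\<close>; at this \<open>t\<close> it takes the value \<open>-1\<close>.\<close>
      show False
        using quad[of "- (bilin p A u u + 1) / (2 * bilin p A u v)"] n True
        by (simp add: field_simps)
    qed
    then show ?thesis using True by simp
  next
    case False
    then have vp: "bilin p A v v > 0" using pos[of v] by simp
    have "0 \<le> bilin p A v v * (bilin p A u u + 2 * (- bilin p A u v / bilin p A v v) * bilin p A u v
       + (- bilin p A u v / bilin p A v v)\<^sup>2 * bilin p A v v)"
      using vp by (intro mult_nonneg_nonneg quad) auto
    also have "\<dots> = bilin p A u u * bilin p A v v - (bilin p A u v)\<^sup>2"
      using vp by (simp add: field_simps power2_eq_square)
    finally show ?thesis by simp
  qed
qed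

lemma mult_mat_vec_index:
  assumes "A \<in> carrier_mat p p" "v \<in> carrier_vec p" "i < p"
  shows "(A *\<^sub>v v) $ i = (\<Sum>k<p. A $$ (i, k) * v $ k)"
  using assms by (auto simp: scalar_prod_def atLeast0LessThan intro!: sum.cong)

lemma mult_mat_entry:
  assumes "A \<in> carrier_mat p p" "B \<in> carrier_mat p p" "i < p" "k < p"
  shows "(A * B) $$ (i, k) = (\<Sum>l<p. A $$ (i, l) * B $$ (l, k))"
  using assms by (auto simp: scalar_prod_def atLeast0LessThan intro!: sum.cong)

text \<open>Any finite constant serves: \<open>1 / M\<close> becomes the gap by which the Rayleigh
  quotient would exceed its own infimum. The summand 1 in \<open>M\<close> only secures
  positivity.\<close>

lemma bilin_le_norm:
  shows "\<exists>M>0. \<forall>x. bilin p R x x \<le> M * (\<Sum>k<p. (x k)\<^sup>2)"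
proof -
  define M where "M = (\<Sum>i<p. \<Sum>k<p. \<bar>R $$ (i, k)\<bar>) + 1"
  have M: "M > 0" unfolding M_def by (intro add_nonneg_pos sum_nonneg) auto
  have "bilin p R x x \<le> M * (\<Sum>k<p. (x k)\<^sup>2)" for x
  proof -
    let ?s = "\<Sum>k<p. (x k)\<^sup>2"
    have s: "0 \<le> ?s" by (simp add: sum_nonneg)
    have le: "(x i)\<^sup>2 \<le> ?s" if "i < p" for i
      using that by (intro member_le_sum) auto
    have "x i * R $$ (i, k) * x k \<le> \<bar>R $$ (i, k)\<bar> * ?s" if "i < p" "k < p" for i k
    proof -
      have "2 * (\<bar>x i\<bar> * \<bar>x k\<bar>) \<le> (x i)\<^sup>2 + (x k)\<^sup>2"
        using sum_squares_bound[of "\<bar>x i\<bar>" "\<bar>x k\<bar>"] by (simp add: mult.assoc)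
      also have "\<dots> \<le> 2 * ?s" using le[OF that(1)] le[OF that(2)] by simp
      finally have "\<bar>R $$ (i, k)\<bar> * (\<bar>x i\<bar> * \<bar>x k\<bar>) \<le> \<bar>R $$ (i, k)\<bar> * ?s"
        by (intro mult_left_mono) auto
      moreover have "x i * R $$ (i, k) * x k \<le> \<bar>x i * R $$ (i, k) * x k\<bar>" by (rule abs_ge_self)
      ultimately show ?thesis by (simp add: abs_mult mult_ac)
    qed
    then have "bilin p R x x \<le> (\<Sum>i<p. \<Sum>k<p. \<bar>R $$ (i, k)\<bar> * ?s)"
      unfolding bilin_def by (intro sum_mono) auto
    also have "\<dots> = (M - 1) * ?s" by (simp add: M_def sum_distrib_right)
    also have "\<dots> \<le> M * ?s" using s by (simp add: algebra_simps)
    finally show ?thesis .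
  qed
  with M show ?thesis by blast
qed

text \<open>Were the infimum \<open>m\<close> of the Rayleigh quotient not an eigenvalue, \<open>S - m I\<close> would have
  an inverse \<open>R\<close>, and the Cauchy-Schwarz inequality for \<open>S - m I\<close>, applied to \<open>x\<close> and \<open>R x\<close>, would
  bound \<open>x\<^sup>T (S - m I) x\<close> away from zero on the unit sphere.\<close>

lemma lambda_min_le_quad_form:
  assumes S: "S \<in> carrier_mat p p" "transpose_mat S = S"
    and pos: "\<And>a. 0 \<le> quad_form p S a" and p: "p > 0"
  shows "lambda_min S \<in> spectrum S" "lambda_min S * (\<Sum>k<p. (a k)\<^sup>2) \<le> quad_form p S a"
proof -
  define nn :: "(nat \<Rightarrow> real) \<Rightarrow> real" where "nn x = (\<Sum>k<p. (x k)\<^sup>2)" for x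
  define E where "E = quad_form p S ` {x. nn x = 1}"
  define m where "m = Inf E"
  have ne: "E \<noteq> {}"
  proof -
    have "nn (\<lambda>k. if k = 0 then 1 else 0) = 1"
      using p by (simp add: nn_def if_distrib[of "\<lambda>x. x\<^sup>2"] sum.delta cong: if_cong)
    then show ?thesis unfolding E_def by blast
  qed
  have bdd: "bdd_below E" unfolding E_def by (rule bdd_belowI[of _ 0]) (use pos in auto)
  have ge_m: "m * nn x \<le> quad_form p S x" for x
  proof (cases "nn x = 0")
    case True
    then show ?thesis using pos by simp
  next
    case False
    then have xp: "nn x > 0" unfolding nn_def by (simp add: order_less_le sum_nonneg)
    define y where "y = (\<lambda>k. (1 / sqrt (nn x)) * x k)"
    have "nn y = 1"
      using xp by (simp add: y_def nn_def power_divide power_mult_distrib flip: sum_divide_distrib)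
    then have "m \<le> quad_form p S y" unfolding m_def E_def by (intro cInf_lower) (use bdd E_def in auto)
    also have "\<dots> = quad_form p S x / nn x"
      using xp by (simp only: y_def quad_form_bilin bilin_scale_left bilin_scale_right)
        (simp add: field_simps)
    finally show ?thesis using xp by (simp add: field_simps)
  qed
  define A where "A = char_matrix S m"
  have A: "A \<in> carrier_mat p p" using S unfolding A_def by simp
  have Ae: "A $$ (i, k) = S $$ (i, k) - (if i = k then m else 0)" if "i < p" "k < p" for i k
    using that S by (auto simp: A_def char_matrix_def)
  have At: "transpose_mat A = A"
    using A S transpose_index[OF S] Ae by (intro eq_matI) auto
  have Aq: "bilin p A x x = quad_form p S x - m * nn x" for x
  proof -
    have "bilin p A x x = (\<Sum>i<p. \<Sum>k<p. x i * S $$ (i, k) * x k - (if k = i then m * (x i)\<^sup>2 else 0))"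
      unfolding bilin_def by (intro sum.cong) (auto simp: Ae algebra_simps power2_eq_square)
    also have "\<dots> = quad_form p S x - m * nn x"
      by (simp add: sum_subtractf quad_form_def nn_def sum_distrib_left)
    finally show ?thesis .
  qed
  have Apos: "0 \<le> bilin p A x x" for x using ge_m[of x] Aq[of x] by simp
  have "eigenvalue S m"
  proof (rule ccontr)
    assume "\<not> eigenvalue S m"
    then have "det A \<noteq> 0" using eigenvalue_det[OF S(1)] by (simp add: A_def)
    from det_non_zero_imp_unit[OF A this, unfolded Units_def, of "()"]
    obtain R where R: "R \<in> carrier_mat p p" and AR: "A * R = 1\<^sub>m p"
      by (auto simp: ring_mat_def)
    obtain M where M: "M > 0" "\<And>x. bilin p R x x \<le> M * nn x"
      using bilin_le_norm[of p R] unfolding nn_def by blast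
    have lower: "1 / M \<le> bilin p A x x" if x: "nn x = 1" for x
    proof -
      define y where "y k = (\<Sum>l<p. R $$ (k, l) * x l)" for k
      have Ay: "(\<Sum>k<p. A $$ (i, k) * y k) = x i" if "i < p" for i
      proof -
        have "(\<Sum>k<p. A $$ (i, k) * y k) = (\<Sum>k<p. \<Sum>l<p. A $$ (i, k) * R $$ (k, l) * x l)"
          by (simp add: y_def sum_distrib_left mult.assoc)
        also have "\<dots> = (\<Sum>l<p. (\<Sum>k<p. A $$ (i, k) * R $$ (k, l)) * x l)"
          by (subst sum.swap) (simp add: sum_distrib_right)
        also have "\<dots> = (\<Sum>l<p. (if i = l then 1 else 0) * x l)"
          using mult_mat_entry[OF A R that] AR that by (intro sum.cong) auto
        also have "\<dots> = x i" using that by (simp add: if_distrib[of "\<lambda>y. y * _"] cong: if_cong)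
        finally show ?thesis .
      qed
      have xy: "bilin p A x y = 1"
        using x Ay by (simp add: bilin_eq_row nn_def power2_eq_square)
      have "bilin p A y y = (\<Sum>i<p. y i * x i)" using Ay by (simp add: bilin_eq_row)
      also have "\<dots> = bilin p R x x" by (simp add: bilin_eq_row y_def mult.commute)
      finally have yy: "bilin p A y y \<le> M" using M(2)[of x] x by simp
      have "1 \<le> bilin p A x x * bilin p A y y"
        using bilin_Cauchy_Schwarz[OF A At Apos, of x y] xy by simp
      also have "\<dots> \<le> bilin p A x x * M" using yy Apos by (intro mult_left_mono)
      finally show ?thesis using M(1) by (simp add: field_simps)
    qed
    have "m + 1 / M \<le> Inf E"
    proof (rule cInf_greatest[OF ne])
      fix q assume "q \<in> E"
      then obtain x where "nn x = 1" "q = quad_form p S x" unfolding E_def by blast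
      then show "m + 1 / M \<le> q" using lower[of x] Aq[of x] by simp
    qed
    then show False using M(1) by (simp add: m_def)
  qed
  then have m: "m \<in> spectrum S" by (simp add: spectrum_def)
  have fin: "finite (spectrum S)" by (rule card_finite_spectrum(1)[OF S(1)])
  show "lambda_min S \<in> spectrum S"
    unfolding lambda_min_def by (rule Min_in) (use fin m in auto)
  have "lambda_min S \<le> m" unfolding lambda_min_def by (rule Min_le[OF fin m])
  moreover have "0 \<le> nn a" by (simp add: nn_def sum_nonneg)
  ultimately have "lambda_min S * nn a \<le> m * nn a" by (rule mult_right_mono)
  also have "\<dots> \<le> quad_form p S a" by (rule ge_m)
  finally show "lambda_min S * (\<Sum>k<p. (a k)\<^sup>2) \<le> quad_form p S a" by (simp add: nn_def)
qed

text \<open>A bound on \<open>1 / lambda_min S\<close> does not by itself exclude a negative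
  eigenvalue. Semidefiniteness, tested on the eigenvector, gives \<open>0 \<le> e\<close>, and
  invertibility excludes zero.\<close>

lemma spectrum_pos:
  assumes S: "S \<in> carrier_mat p p" and pos: "\<And>a. 0 \<le> quad_form p S a"
    and T: "T \<in> carrier_mat p p" "inverts_mat T S" and e: "e \<in> spectrum S"
  shows "0 < e"
proof -
  obtain v where v: "v \<in> carrier_vec p" "v \<noteq> 0\<^sub>v p" "S *\<^sub>v v = e \<cdot>\<^sub>v v"
    using e S by (auto simp: spectrum_def eigenvalue_def eigenvector_def)
  have nn: "(\<Sum>k<p. (v $ k)\<^sup>2) > 0"
  proof (rule ccontr)
    assume "\<not> ?thesis"
    then have "(\<Sum>k<p. (v $ k)\<^sup>2) = 0" by (simp add: order_antisym sum_nonneg not_less)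
    then have "v $ k = 0" if "k < p" for k using that by (simp add: sum_nonneg_eq_0_iff)
    then have "v = 0\<^sub>v p" using v by (intro eq_vecI) auto
    with v show False by simp
  qed
  have Sv: "(\<Sum>k<p. S $$ (i, k) * v $ k) = e * v $ i" if "i < p" for i
    using mult_mat_vec_index[OF S v(1) that] v that by auto
  have "quad_form p S (($) v) = (\<Sum>i<p. v $ i * (e * v $ i))"
    using Sv by (simp add: quad_form_bilin bilin_eq_row)
  also have "\<dots> = e * (\<Sum>k<p. (v $ k)\<^sup>2)"
    by (simp add: sum_distrib_left power2_eq_square mult_ac)
  finally have "0 \<le> e" using pos[of "($) v"] nn by (simp add: zero_le_mult_iff)
  moreover have "e \<noteq> 0"
  proof
    assume "e = 0"
    then have "S *\<^sub>v v = 0\<^sub>v p" using v by (auto intro!: eq_vecI)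
    then have "T *\<^sub>v (S *\<^sub>v v) = 0\<^sub>v p" using T by (auto intro!: eq_vecI)
    moreover have "T *\<^sub>v (S *\<^sub>v v) = v"
      using T S v(1) by (simp add: inverts_mat_def del: v(3) flip: assoc_mult_mat_vec[of T p p S p v])
    ultimately show False using v by simp
  qed
  ultimately show ?thesis by simp
qed

lemma quad_form_ge_of_lambda_min:
  assumes S: "S \<in> carrier_mat p p" "transpose_mat S = S"
    and pos: "\<And>a. 0 \<le> quad_form p S a" and p: "p > 0"
    and T: "T \<in> carrier_mat p p" "inverts_mat T S"
    and L: "1 / lambda_min S \<le> L"
  shows "0 < L" "(\<Sum>k<p. (a k)\<^sup>2) / L \<le> quad_form p S a"
proof -
  have l: "lambda_min S > 0"
    by (rule spectrum_pos[OF S(1) pos T lambda_min_le_quad_form(1)[OF S pos p]])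
  have "0 < 1 / lambda_min S" using l by simp
  with L show Lp: "0 < L" by linarith
  have "1 / L \<le> lambda_min S" using l L Lp by (simp add: field_simps)
  then have "1 / L * (\<Sum>k<p. (a k)\<^sup>2) \<le> lambda_min S * (\<Sum>k<p. (a k)\<^sup>2)"
    by (intro mult_right_mono) (auto simp: sum_nonneg)
  also have "\<dots> \<le> quad_form p S a" by (rule lambda_min_le_quad_form(2)[OF S pos p])
  finally show "(\<Sum>k<p. (a k)\<^sup>2) / L \<le> quad_form p S a" by simp
qed

lemma max_abs_entry_ge:
  assumes "A \<in> carrier_mat p p" "i < p" "k < p"
  shows "\<bar>A $$ (i, k)\<bar> \<le> max_abs_entry A"
  unfolding max_abs_entry_def
proof (rule Max_ge)
  show "finite (abs ` elements_mat A)" by (simp add: elements_mat_def)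
  show "\<bar>A $$ (i, k)\<bar> \<in> abs ` elements_mat A"
    using assms by (auto simp: elements_mat_def intro!: imageI)
qed

lemma bilin_inverse_column:
  assumes S: "S \<in> carrier_mat p p" and T: "T \<in> carrier_mat p p" "inverts_mat S T" and j: "j < p"
  shows "bilin p S u (\<lambda>k. T $$ (k, j)) = u j"
proof -
  have "bilin p S u (\<lambda>k. T $$ (k, j)) = (\<Sum>i<p. u i * (if i = j then 1 else 0))"
  proof -
    have "(\<Sum>k<p. S $$ (i, k) * T $$ (k, j)) = (if i = j then 1 else 0)" if "i < p" for i
      using mult_mat_entry[OF S T(1) that j] T(2) S j that
      by (simp only: inverts_mat_def carrier_matD index_one_mat)
    then show ?thesis unfolding bilin_eq_row by (intro sum.cong) auto
  qed
  also have "\<dots> = u j" using j by (simp add: if_distrib cong: if_cong)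
  finally show ?thesis .
qed

section \<open>The Lasso\<close>

definition gram :: "nat \<Rightarrow> nat \<Rightarrow> design \<Rightarrow> real mat" where
  "gram n p X = mat p p (\<lambda>(k, l). (\<Sum>i<n. X i k * X i l) / real n)"

lemma gram_index: "k < p \<Longrightarrow> l < p \<Longrightarrow> gram n p X $$ (k, l) = (\<Sum>i<n. X i k * X i l) / real n"
  by (simp add: gram_def)

lemma bilin_gram:
  "bilin p (gram n p X) u v = (\<Sum>i<n. dotp p (X i) u * dotp p (X i) v) / real n"
proof -
  have "(\<Sum>i<n. dotp p (X i) u * dotp p (X i) v) = (\<Sum>i<n. \<Sum>k<p. \<Sum>l<p. u k * (X i k * X i l) * v l)"
    unfolding dotp_def by (simp add: sum_product mult_ac)
  also have "\<dots> = (\<Sum>k<p. \<Sum>i<n. \<Sum>l<p. u k * (X i k * X i l) * v l)" by (rule sum.swap)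
  also have "\<dots> = (\<Sum>k<p. \<Sum>l<p. \<Sum>i<n. u k * (X i k * X i l) * v l)"
    by (intro sum.cong refl sum.swap)
  also have "\<dots> = (\<Sum>k<p. \<Sum>l<p. u k * (\<Sum>i<n. X i k * X i l) * v l)"
    by (simp add: sum_distrib_left sum_distrib_right)
  finally show ?thesis
    unfolding bilin_def by (simp add: gram_index flip: sum_divide_distrib)
qed

text \<open>Hoelder duality applied on both sides. It is the reason why entrywise concentration of
  the Gram matrix is enough: on the cone the \<open>l1\<close> norm is at most a multiple of
  \<open>sqrt m\<close> times the Euclidean norm.\<close>

lemma bilin_diff_le:
  assumes "\<And>k l. k < p \<Longrightarrow> l < p \<Longrightarrow> \<bar>A $$ (k, l) - B $$ (k, l)\<bar> \<le> s"
  shows "\<bar>bilin p A u v - bilin p B u v\<bar> \<le> s * (\<Sum>k<p. \<bar>u k\<bar>) * (\<Sum>k<p. \<bar>v k\<bar>)"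
proof -
  have "\<bar>bilin p A u v - bilin p B u v\<bar>
      = \<bar>\<Sum>k<p. \<Sum>l<p. u k * (A $$ (k, l) - B $$ (k, l)) * v l\<bar>"
    by (simp add: bilin_def algebra_simps flip: sum_subtractf)
  also have "\<dots> \<le> (\<Sum>k<p. \<Sum>l<p. \<bar>u k * (A $$ (k, l) - B $$ (k, l)) * v l\<bar>)"
    by (rule order_trans[OF sum_abs]) (intro sum_mono sum_abs)
  also have "\<dots> \<le> (\<Sum>k<p. \<Sum>l<p. s * (\<bar>u k\<bar> * \<bar>v l\<bar>))"
  proof (intro sum_mono)
    fix k l assume "k \<in> {..<p}" "l \<in> {..<p}"
    then have "\<bar>A $$ (k, l) - B $$ (k, l)\<bar> * (\<bar>u k\<bar> * \<bar>v l\<bar>) \<le> s * (\<bar>u k\<bar> * \<bar>v l\<bar>)"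
      by (intro mult_right_mono assms) auto
    then show "\<bar>u k * (A $$ (k, l) - B $$ (k, l)) * v l\<bar> \<le> s * (\<bar>u k\<bar> * \<bar>v l\<bar>)"
      by (simp add: abs_mult mult_ac)
  qed
  also have "\<dots> = s * (\<Sum>k<p. \<bar>u k\<bar>) * (\<Sum>k<p. \<bar>v k\<bar>)"
    by (simp add: sum_product flip: sum_distrib_left)
  finally show ?thesis .
qed

lemma power2_L2_set: "(L2_set f A)\<^sup>2 = (\<Sum>x\<in>A. (f x)\<^sup>2)"
  by (simp add: L2_set_def sum_nonneg)

section \<open>Basic inequality and the \<open>l1\<close> error of the Lasso\<close>

lemma lasso_obj_cong:
  "(\<And>k. k \<in> I \<Longrightarrow> b k = b' k) \<Longrightarrow> lasso_obj n I lam X y b = lasso_obj n I lam X y b'"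
  by (simp add: lasso_obj_def)

text \<open>The competitors are extensional vectors, but the criterion sees only the coordinates in
  \<open>I\<close>, so the minimiser may be compared with any function.\<close>

lemma lasso_argmin_le:
  assumes "is_arg_min (lasso_obj n I lam X y) (\<lambda>b. b \<in> rvec I) bh"
  shows "lasso_obj n I lam X y bh \<le> lasso_obj n I lam X y b"
proof -
  have "lasso_obj n I lam X y b = lasso_obj n I lam X y (restrict b I)"
    by (rule lasso_obj_cong) simp
  moreover have "restrict b I \<in> rvec I" by auto
  ultimately show ?thesis using assms by (simp add: is_arg_min_def not_less)
qed

text \<open>Optimality against the target \<open>b\<close>, with the cross term bounded by duality
  of sup norm and \<open>l1\<close> norm. The term \<open>e\<close> is an arbitrary sequence: for
  the nodewise regression it will be the population residual.\<close>

lemma lasso_basic_inequality: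
  assumes min: "is_arg_min (lasso_obj n I lam X y) (\<lambda>b. b \<in> rvec I) bh"
    and y: "\<And>i. i < n \<Longrightarrow> y i = (\<Sum>k\<in>I. X i k * b k) + e i"
    and noise: "\<And>k. k \<in> I \<Longrightarrow> \<bar>(\<Sum>i<n. X i k * e i) / real n\<bar> \<le> \<nu>"
  shows "(\<Sum>i<n. (\<Sum>k\<in>I. X i k * (bh k - b k))\<^sup>2) / real n
    \<le> 2 * \<nu> * (\<Sum>k\<in>I. \<bar>bh k - b k\<bar>) + 2 * lam * ((\<Sum>k\<in>I. \<bar>b k\<bar>) - (\<Sum>k\<in>I. \<bar>bh k\<bar>))"
proof -
  define \<delta> where "\<delta> k = bh k - b k" for k
  define z where "z i = (\<Sum>k\<in>I. X i k * \<delta> k)" for i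
  have "(\<Sum>i<n. (y i - (\<Sum>k\<in>I. X i k * bh k))\<^sup>2) = (\<Sum>i<n. (e i - z i)\<^sup>2)"
    by (intro sum.cong) (auto simp: y z_def \<delta>_def algebra_simps sum_subtractf)
  moreover have "(\<Sum>i<n. (y i - (\<Sum>k\<in>I. X i k * b k))\<^sup>2) = (\<Sum>i<n. (e i)\<^sup>2)"
    by (intro sum.cong) (auto simp: y)
  ultimately have "(\<Sum>i<n. (e i - z i)\<^sup>2) / real n + 2 * lam * (\<Sum>k\<in>I. \<bar>bh k\<bar>)
      \<le> (\<Sum>i<n. (e i)\<^sup>2) / real n + 2 * lam * (\<Sum>k\<in>I. \<bar>b k\<bar>)"
    using lasso_argmin_le[OF min, of b] by (simp add: lasso_obj_def power2_L2_set)
  moreover have "(\<Sum>i<n. (e i - z i)\<^sup>2) = (\<Sum>i<n. (e i)\<^sup>2) - 2 * (\<Sum>i<n. e i * z i) + (\<Sum>i<n. (z i)\<^sup>2)"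
    by (simp add: power2_diff sum.distrib sum_subtractf sum_distrib_left mult.assoc)
  ultimately have 1: "(\<Sum>i<n. (z i)\<^sup>2) / real n
      \<le> 2 * ((\<Sum>i<n. e i * z i) / real n) + 2 * lam * ((\<Sum>k\<in>I. \<bar>b k\<bar>) - (\<Sum>k\<in>I. \<bar>bh k\<bar>))"
    by (simp add: diff_divide_distrib add_divide_distrib algebra_simps)
  have "(\<Sum>i<n. e i * z i) = (\<Sum>i<n. \<Sum>k\<in>I. \<delta> k * (X i k * e i))"
    by (simp add: z_def sum_distrib_left mult_ac)
  also have "\<dots> = (\<Sum>k\<in>I. \<delta> k * (\<Sum>i<n. X i k * e i))"
    by (subst sum.swap) (simp add: sum_distrib_left)
  finally have "(\<Sum>i<n. e i * z i) / real n = (\<Sum>k\<in>I. \<delta> k * ((\<Sum>i<n. X i k * e i) / real n))"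
    by (simp flip: sum_divide_distrib)
  also have "\<dots> \<le> (\<Sum>k\<in>I. \<bar>\<delta> k\<bar> * \<nu>)"
  proof (intro sum_mono)
    fix k assume "k \<in> I"
    have "\<delta> k * ((\<Sum>i<n. X i k * e i) / real n) \<le> \<bar>\<delta> k\<bar> * \<bar>(\<Sum>i<n. X i k * e i) / real n\<bar>"
      by (metis abs_ge_self abs_mult)
    also have "\<dots> \<le> \<bar>\<delta> k\<bar> * \<nu>" using noise[OF \<open>k \<in> I\<close>] by (intro mult_left_mono) auto
    finally show "\<delta> k * ((\<Sum>i<n. X i k * e i) / real n) \<le> \<bar>\<delta> k\<bar> * \<nu>" .
  qed
  also have "\<dots> = \<nu> * (\<Sum>k\<in>I. \<bar>\<delta> k\<bar>)" by (simp add: sum_distrib_left mult.commute)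
  finally show ?thesis using 1 by (simp add: z_def \<delta>_def)
qed

text \<open>Either the penalty dominates the noise and \<open>S\<close> is the support of the target, or the
  dimension is bounded and \<open>S\<close> is the whole index set; both give the same cone condition.\<close>

lemma lasso_cone:
  assumes min: "is_arg_min (lasso_obj n I lam X y) (\<lambda>b. b \<in> rvec I) bh"
    and y: "\<And>i. i < n \<Longrightarrow> y i = (\<Sum>k\<in>I. X i k * b k) + e i"
    and noise: "\<And>k. k \<in> I \<Longrightarrow> \<bar>(\<Sum>i<n. X i k * e i) / real n\<bar> \<le> \<nu>"
    and I: "finite I" "S \<subseteq> I" and supp: "\<And>k. k \<in> I - S \<Longrightarrow> b k = 0"
    and regime: "0 < lam \<and> 2 * \<nu> \<le> lam \<or> S = I" and lam: "0 \<le> lam" "0 \<le> \<nu>" "lam + \<nu> \<le> \<mu>"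
  shows "(\<Sum>k\<in>I. \<bar>bh k - b k\<bar>) \<le> 4 * (\<Sum>k\<in>S. \<bar>bh k - b k\<bar>)"
    and "(\<Sum>i<n. (\<Sum>k\<in>I. X i k * (bh k - b k))\<^sup>2) / real n \<le> 3 * \<mu> * (\<Sum>k\<in>S. \<bar>bh k - b k\<bar>)"
proof -
  let ?l = "(\<Sum>i<n. (\<Sum>k\<in>I. X i k * (bh k - b k))\<^sup>2) / real n"
  define a where "a = (\<Sum>k\<in>S. \<bar>bh k - b k\<bar>)"
  define c where "c = (\<Sum>k\<in>I - S. \<bar>bh k - b k\<bar>)"
  have ac: "(\<Sum>k\<in>I. \<bar>bh k - b k\<bar>) = a + c"
    unfolding a_def c_def using sum.subset_diff[OF I(2,1)] by (simp add: add.commute)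
  have nn: "0 \<le> a" "0 \<le> c" "0 \<le> ?l" by (auto simp: a_def c_def sum_nonneg)
  have "(\<Sum>k\<in>I. \<bar>b k\<bar>) - (\<Sum>k\<in>I. \<bar>bh k\<bar>) = (\<Sum>k\<in>I. \<bar>b k\<bar> - \<bar>bh k\<bar>)"
    by (simp add: sum_subtractf)
  also have "\<dots> = (\<Sum>k\<in>I - S. \<bar>b k\<bar> - \<bar>bh k\<bar>) + (\<Sum>k\<in>S. \<bar>b k\<bar> - \<bar>bh k\<bar>)"
    by (rule sum.subset_diff[OF I(2,1)])
  also have "\<dots> \<le> (\<Sum>k\<in>I - S. - \<bar>bh k - b k\<bar>) + (\<Sum>k\<in>S. \<bar>bh k - b k\<bar>)"
    using supp by (intro add_mono sum_mono) auto
  also have "\<dots> = a - c" by (simp add: a_def c_def sum_negf)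
  finally have diff: "(\<Sum>k\<in>I. \<bar>b k\<bar>) - (\<Sum>k\<in>I. \<bar>bh k\<bar>) \<le> a - c" .
  have "?l \<le> 2 * \<nu> * (a + c) + 2 * lam * ((\<Sum>k\<in>I. \<bar>b k\<bar>) - (\<Sum>k\<in>I. \<bar>bh k\<bar>))"
    using lasso_basic_inequality[OF min y noise] by (simp add: ac)
  also have "\<dots> \<le> 2 * \<nu> * (a + c) + 2 * lam * (a - c)"
    using diff lam by (intro add_left_mono mult_left_mono) auto
  finally have basic: "?l \<le> 2 * \<nu> * (a + c) + 2 * lam * (a - c)" .
  have mu_a: "lam * a + \<nu> * a \<le> \<mu> * a" using lam nn by (metis distrib_right mult_right_mono)
  have nu_a: "0 \<le> \<nu> * a" "0 \<le> lam * a" "0 \<le> lam * c" "0 \<le> \<mu> * a" using lam nn by auto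
  from regime have "a + c \<le> 4 * a \<and> ?l \<le> 3 * \<mu> * a"
  proof
    assume r: "0 < lam \<and> 2 * \<nu> \<le> lam"
    then have "2 * \<nu> * (a + c) \<le> lam * (a + c)" using nn by (intro mult_right_mono) auto
    then have l: "?l \<le> 3 * (lam * a) - lam * c" using basic by (simp add: algebra_simps)
    then have "lam * c \<le> lam * (3 * a)" using nn by simp
    then have "c \<le> 3 * a" using r by simp
    then show ?thesis using l mu_a nu_a by simp
  next
    assume "S = I"
    then have "c = 0" by (simp add: c_def)
    then show ?thesis using basic mu_a nu_a nn by (simp add: algebra_simps)
  qed
  then show "(\<Sum>k\<in>I. \<bar>bh k - b k\<bar>) \<le> 4 * (\<Sum>k\<in>S. \<bar>bh k - b k\<bar>)"
    "?l \<le> 3 * \<mu> * (\<Sum>k\<in>S. \<bar>bh k - b k\<bar>)"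
    by (simp_all only: ac a_def)
qed

text \<open>The cone condition gives \<open>D\<^sup>2 \<le> 16 * m * N\<close>, so passing from
  \<open>S\<close> to the Gram matrix costs at most \<open>16 * m * s * N\<close>; the smallness
  hypothesis, with \<open>32 = 2 * 16\<close>, makes this at most half of the curvature
  \<open>N / L\<close>. The other half yields \<open>N \<le> 6 * L * \<mu> * a\<close>, hence
  \<open>a \<le> 6 * L * m * \<mu>\<close>, and the cone condition contributes a factor 4.\<close>

lemma sum_abs_le_of_restricted_eigenvalue:
  assumes q: "\<And>a. (\<Sum>k<p. (a k)\<^sup>2) / L \<le> bilin p S a a" and L: "0 < L"
    and close: "\<And>k l. k < p \<Longrightarrow> l < p \<Longrightarrow> \<bar>gram n p X $$ (k, l) - S $$ (k, l)\<bar> \<le> s" and s: "0 \<le> s"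
    and J: "J \<subseteq> {..<p}" "card J \<le> m" and small: "32 * L * real m * s \<le> 1"
    and cone: "(\<Sum>k<p. \<bar>d k\<bar>) \<le> 4 * (\<Sum>k\<in>J. \<bar>d k\<bar>)"
    and pred: "bilin p (gram n p X) d d \<le> 3 * \<mu> * (\<Sum>k\<in>J. \<bar>d k\<bar>)" and mu: "0 \<le> \<mu>"
  shows "(\<Sum>k<p. \<bar>d k\<bar>) \<le> 24 * L * real m * \<mu>"
proof -
  define a where "a = (\<Sum>k\<in>J. \<bar>d k\<bar>)"
  define D where "D = (\<Sum>k<p. \<bar>d k\<bar>)"
  define N where "N = (\<Sum>k<p. (d k)\<^sup>2)"
  have nn: "0 \<le> a" "0 \<le> D" "0 \<le> N" by (simp_all add: a_def D_def N_def sum_nonneg)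
  have fJ: "finite J" using J finite_subset by blast
  have "a\<^sup>2 \<le> real (card J) * (\<Sum>k\<in>J. \<bar>d k\<bar>\<^sup>2)"
    unfolding a_def using sum_squared_le_sum_of_squares[of "\<lambda>k. \<bar>d k\<bar>" J]
    by (simp add: mult.commute)
  also have "\<dots> \<le> real m * N"
    unfolding N_def using J by (intro mult_mono) (auto intro!: sum_mono2 sum_nonneg)
  finally have a2: "a\<^sup>2 \<le> real m * N" .
  have "D\<^sup>2 \<le> (4 * a)\<^sup>2" using cone nn by (intro power_mono) (auto simp: D_def a_def)
  also have "\<dots> = 16 * a\<^sup>2" by simp
  also have "\<dots> \<le> 16 * (real m * N)" using a2 by simp
  finally have "s * D\<^sup>2 \<le> s * (16 * (real m * N))" using s by (rule mult_left_mono)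
  also have "\<dots> = (32 * L * real m * s) * N / (2 * L)" using L by simp
  also have "\<dots> \<le> 1 * N / (2 * L)"
    using small nn L by (intro divide_right_mono mult_right_mono) auto
  finally have sD: "s * D\<^sup>2 \<le> N / (2 * L)" by simp
  have "N / L \<le> bilin p S d d" using q[of d] by (simp add: N_def)
  also have "\<dots> \<le> bilin p (gram n p X) d d + s * D\<^sup>2"
    using bilin_diff_le[of p "gram n p X" S s d d, OF close]
    by (simp add: D_def power2_eq_square abs_le_iff mult.assoc)
  also have "\<dots> \<le> 3 * \<mu> * a + N / (2 * L)" using pred sD by (simp add: a_def)
  finally have "N \<le> 6 * L * \<mu> * a" using L by (simp add: field_simps)
  then have "a\<^sup>2 \<le> real m * (6 * L * \<mu> * a)" using a2
    by (meson mult_left_mono of_nat_0_le_iff order_trans)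
  then have "a * a \<le> (6 * L * real m * \<mu>) * a" by (simp add: power2_eq_square mult_ac)
  then have "a \<le> 6 * L * real m * \<mu>"
    using nn L mu by (cases "a = 0") (auto simp: mult_le_cancel_right)
  then show ?thesis using cone by (simp add: a_def)
qed

section \<open>Optimality conditions of the Lasso by perturbation\<close>

lemma linear_coefficient_nonneg:
  fixes Q c :: real
  assumes "\<And>t. 0 < t \<Longrightarrow> t \<le> 1 \<Longrightarrow> 0 \<le> t\<^sup>2 * Q + 2 * t * c"
  shows "0 \<le> c"
proof (rule ccontr)
  assume "\<not> 0 \<le> c"
  then have c: "c < 0" by simp
  \<comment> \<open>This \<open>t\<close> makes \<open>t * Q \<le> - c\<close>, so that
    \<open>t * Q + 2 * c \<le> c < 0\<close>.\<close>
  define t where "t = min 1 (- c / (\<bar>Q\<bar> + 1))"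
  have t: "0 < t" "t \<le> 1" using c by (auto simp: t_def divide_neg_pos)
  have "t * Q \<le> t * (\<bar>Q\<bar> + 1)" using t by (intro mult_left_mono) auto
  also have "\<dots> \<le> (- c / (\<bar>Q\<bar> + 1)) * (\<bar>Q\<bar> + 1)" by (intro mult_right_mono) (auto simp: t_def)
  also have "\<dots> = - c" by simp
  finally have "t * (t * Q + 2 * c) < 0" using t c by (intro mult_pos_neg) auto
  with assms[OF t] show False by (simp add: power2_eq_square algebra_simps)
qed

text \<open>The criterion is expanded exactly along \<open>bh + t * g\<close>. Coordinate directions
  and the direction \<open>bh\<close> itself then give the two optimality conditions, without
  subdifferentials.\<close>

lemma lasso_perturbation:
  assumes min: "is_arg_min (lasso_obj n I lam X y) (\<lambda>b. b \<in> rvec I) bh"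
  defines "r \<equiv> \<lambda>i. y i - (\<Sum>k\<in>I. X i k * bh k)"
  shows "0 \<le> t\<^sup>2 * ((\<Sum>i<n. (\<Sum>k\<in>I. X i k * g k)\<^sup>2) / real n)
     - 2 * t * (\<Sum>k\<in>I. g k * ((\<Sum>i<n. X i k * r i) / real n))
     + 2 * lam * ((\<Sum>k\<in>I. \<bar>bh k + t * g k\<bar>) - (\<Sum>k\<in>I. \<bar>bh k\<bar>))"
proof -
  define z where "z i = (\<Sum>k\<in>I. X i k * g k)" for i
  have "(\<Sum>i<n. (y i - (\<Sum>k\<in>I. X i k * (bh k + t * g k)))\<^sup>2) = (\<Sum>i<n. (r i - t * z i)\<^sup>2)"
    by (simp add: r_def z_def algebra_simps sum.distrib sum_distrib_left)
  also have "\<dots> = (\<Sum>i<n. (r i)\<^sup>2) - 2 * t * (\<Sum>i<n. r i * z i) + t\<^sup>2 * (\<Sum>i<n. (z i)\<^sup>2)"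
    by (simp add: power2_diff power_mult_distrib sum.distrib sum_subtractf sum_distrib_left mult_ac)
  finally have "(\<Sum>i<n. (r i)\<^sup>2) / real n + 2 * lam * (\<Sum>k\<in>I. \<bar>bh k\<bar>)
     \<le> ((\<Sum>i<n. (r i)\<^sup>2) - 2 * t * (\<Sum>i<n. r i * z i) + t\<^sup>2 * (\<Sum>i<n. (z i)\<^sup>2)) / real n
       + 2 * lam * (\<Sum>k\<in>I. \<bar>bh k + t * g k\<bar>)"
    using lasso_argmin_le[OF min, of "\<lambda>k. bh k + t * g k"]
    by (simp add: lasso_obj_def power2_L2_set r_def)
  then have *: "0 \<le> t\<^sup>2 * ((\<Sum>i<n. (z i)\<^sup>2) / real n) - 2 * t * ((\<Sum>i<n. r i * z i) / real n)
     + 2 * lam * ((\<Sum>k\<in>I. \<bar>bh k + t * g k\<bar>) - (\<Sum>k\<in>I. \<bar>bh k\<bar>))"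
    by (simp add: diff_divide_distrib add_divide_distrib algebra_simps)
  have "(\<Sum>i<n. r i * z i) = (\<Sum>i<n. \<Sum>k\<in>I. g k * (X i k * r i))"
    by (simp add: z_def sum_distrib_left mult_ac)
  also have "\<dots> = (\<Sum>k\<in>I. g k * (\<Sum>i<n. X i k * r i))"
    by (subst sum.swap) (simp add: sum_distrib_left)
  finally have "(\<Sum>i<n. r i * z i) / real n = (\<Sum>k\<in>I. g k * ((\<Sum>i<n. X i k * r i) / real n))"
    by (simp flip: sum_divide_distrib)
  then show ?thesis using * by (simp add: z_def)
qed

lemma lasso_KKT_coordinate:
  assumes min: "is_arg_min (lasso_obj n I lam X y) (\<lambda>b. b \<in> rvec I) bh"
    and I: "finite I" "k \<in> I" and lam: "0 \<le> lam"
  shows "\<bar>(\<Sum>i<n. X i k * (y i - (\<Sum>l\<in>I. X i l * bh l))) / real n\<bar> \<le> lam"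
proof -
  define c where "c = (\<Sum>i<n. X i k * (y i - (\<Sum>l\<in>I. X i l * bh l))) / real n"
  define Q where "Q = (\<Sum>i<n. (\<Sum>l\<in>I. X i l * (if l = k then 1 else 0))\<^sup>2) / real n"
  have *: "0 \<le> t\<^sup>2 * Q - 2 * t * c + 2 * lam * \<bar>t\<bar>" for t
  proof -
    let ?g = "\<lambda>l. if l = k then 1 else 0 :: real"
    have "(\<Sum>l\<in>I. \<bar>bh l + t * ?g l\<bar>) - (\<Sum>l\<in>I. \<bar>bh l\<bar>) = (\<Sum>l\<in>I. \<bar>bh l + t * ?g l\<bar> - \<bar>bh l\<bar>)"
      by (simp add: sum_subtractf)
    also have "\<dots> \<le> (\<Sum>l\<in>I. if l = k then \<bar>t\<bar> else 0)" by (intro sum_mono) auto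
    also have "\<dots> = \<bar>t\<bar>" using I by simp
    finally have "2 * lam * ((\<Sum>l\<in>I. \<bar>bh l + t * ?g l\<bar>) - (\<Sum>l\<in>I. \<bar>bh l\<bar>)) \<le> 2 * lam * \<bar>t\<bar>"
      using lam by (intro mult_left_mono) auto
    moreover have "(\<Sum>l\<in>I. ?g l * ((\<Sum>i<n. X i l * (y i - (\<Sum>l\<in>I. X i l * bh l))) / real n)) = c"
      using I by (simp add: c_def if_distrib[of "\<lambda>x. x * _"] if_distrib[of "\<lambda>x. x / _"] cong: if_cong)
    ultimately show ?thesis
      using lasso_perturbation[OF min, of t ?g] unfolding Q_def by simp
  qed
  have "0 \<le> lam - c"
  proof (rule linear_coefficient_nonneg[of Q])
    show "0 \<le> t\<^sup>2 * Q + 2 * t * (lam - c)" if "0 < t" for t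
      using *[of t] that by (simp add: algebra_simps)
  qed
  moreover have "0 \<le> lam + c"
  proof (rule linear_coefficient_nonneg[of Q])
    show "0 \<le> t\<^sup>2 * Q + 2 * t * (lam + c)" if "0 < t" for t
      using *[of "- t"] that by (simp add: algebra_simps)
  qed
  ultimately show ?thesis by (simp add: c_def[symmetric] abs_le_iff)
qed

text \<open>Complementary slackness. Along the ray through \<open>bh\<close> the penalty is exactly
  linear for \<open>t \<ge> - 1\<close>, so perturbations of both signs are available and give an
  equality.\<close>

lemma lasso_KKT_inner:
  assumes min: "is_arg_min (lasso_obj n I lam X y) (\<lambda>b. b \<in> rvec I) bh"
  shows "(\<Sum>k\<in>I. bh k * ((\<Sum>i<n. X i k * (y i - (\<Sum>l\<in>I. X i l * bh l))) / real n))
     = lam * (\<Sum>k\<in>I. \<bar>bh k\<bar>)" (is "?c = lam * ?N")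
proof -
  define Q where "Q = (\<Sum>i<n. (\<Sum>k\<in>I. X i k * bh k)\<^sup>2) / real n"
  have *: "0 \<le> t\<^sup>2 * Q - 2 * t * ?c + 2 * lam * (t * ?N)" if "- 1 \<le> t" for t
  proof -
    have "\<bar>bh k + t * bh k\<bar> = (1 + t) * \<bar>bh k\<bar>" for k
    proof -
      have "\<bar>bh k + t * bh k\<bar> = \<bar>(1 + t) * bh k\<bar>" by (simp add: algebra_simps)
      then show ?thesis using that by (simp add: abs_mult)
    qed
    then have "(\<Sum>k\<in>I. \<bar>bh k + t * bh k\<bar>) - ?N = t * ?N"
      by (simp add: algebra_simps sum.distrib sum_distrib_left)
    then show ?thesis using lasso_perturbation[OF min, of t bh] by (simp add: Q_def)
  qed
  have "0 \<le> lam * ?N - ?c"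
  proof (rule linear_coefficient_nonneg[of Q])
    show "0 \<le> t\<^sup>2 * Q + 2 * t * (lam * ?N - ?c)" if "0 < t" for t
      using *[of t] that by (simp add: algebra_simps)
  qed
  moreover have "0 \<le> ?c - lam * ?N"
  proof (rule linear_coefficient_nonneg[of Q])
    show "0 \<le> t\<^sup>2 * Q + 2 * t * (?c - lam * ?N)" if "t \<le> 1" for t
      using *[of "- t"] that by (simp add: algebra_simps)
  qed
  ultimately show ?thesis by simp
qed

section \<open>The de-sparsified Lasso: deterministic bound\<close>

lemma sum_lessThan_remove:
  fixes f :: "nat \<Rightarrow> 'a::comm_monoid_add"
  shows "j < p \<Longrightarrow> (\<Sum>k<p. f k) = f j + (\<Sum>k\<in>{..<p} - {j}. f k)"
  by (rule sum.remove) auto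

text \<open>This is \<open>theta_hat\<close> multiplied by \<open>tau_sq\<close>; its product with a
  row of the design is the nodewise residual.\<close>

definition nodewise_vec :: "nat \<Rightarrow> (nat \<Rightarrow> real) \<Rightarrow> nat \<Rightarrow> real" where
  "nodewise_vec j g k = (if k = j then 1 else - g k)"

lemma nodewise_vec_simps [simp]: "nodewise_vec j g j = 1" "k \<noteq> j \<Longrightarrow> nodewise_vec j g k = - g k"
  by (simp_all add: nodewise_vec_def)

lemma dotp_nodewise_vec:
  assumes "j < p"
  shows "dotp p x (nodewise_vec j g) = x j - (\<Sum>k\<in>{..<p} - {j}. x k * g k)"
proof -
  have "(\<Sum>k\<in>{..<p} - {j}. x k * nodewise_vec j g k) = (\<Sum>k\<in>{..<p} - {j}. - (x k * g k))"
    by (intro sum.cong) auto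
  then show ?thesis
    unfolding dotp_def sum_lessThan_remove[OF assms] by (simp add: sum_negf)
qed

lemma dotp_commute: "dotp p u v = dotp p v u"
  by (simp add: dotp_def mult.commute)

lemma abs_dotp_le:
  assumes "\<And>k. k < p \<Longrightarrow> \<bar>v k\<bar> \<le> s"
  shows "\<bar>dotp p u v\<bar> \<le> (\<Sum>k<p. \<bar>u k\<bar>) * s"
proof -
  have "\<bar>dotp p u v\<bar> \<le> (\<Sum>k<p. \<bar>u k * v k\<bar>)" unfolding dotp_def by (rule sum_abs)
  also have "\<dots> \<le> (\<Sum>k<p. \<bar>u k\<bar> * s)"
    using assms by (intro sum_mono) (auto simp: abs_mult intro!: mult_left_mono)
  finally show ?thesis by (simp add: sum_distrib_right)
qed

text \<open>By complementary slackness the penalty part of \<open>tau_sq\<close> equals the inner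
  product of nodewise fit and residual. Adding the squared residual leaves column \<open>j\<close>
  against the residual, which is what cancels the \<open>j\<close>-th Lasso error in the expansion
  below.\<close>

lemma tau_sq_eq_gram:
  assumes min: "is_arg_min (lasso_obj n ({..<p} - {j}) lam X (\<lambda>i. X i j)) (\<lambda>g. g \<in> rvec ({..<p} - {j})) g"
    and j: "j < p"
  shows "tau_sq n p j lam X g = (\<Sum>i<n. X i j * dotp p (X i) (nodewise_vec j g)) / real n"
proof -
  define r where "r i = dotp p (X i) (nodewise_vec j g)" for i
  let ?I = "{..<p} - {j}"
  have r: "X i j - (\<Sum>k\<in>?I. X i k * g k) = r i" for i by (simp add: r_def dotp_nodewise_vec[OF j])
  have "lam * (\<Sum>k\<in>?I. \<bar>g k\<bar>) = (\<Sum>k\<in>?I. g k * ((\<Sum>i<n. X i k * r i) / real n))"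
    using lasso_KKT_inner[OF min] by (simp add: r)
  also have "\<dots> = (\<Sum>k\<in>?I. \<Sum>i<n. (X i k * g k) * r i) / real n"
    by (simp add: sum_divide_distrib sum_distrib_left mult_ac)
  also have "(\<Sum>k\<in>?I. \<Sum>i<n. (X i k * g k) * r i) = (\<Sum>i<n. (\<Sum>k\<in>?I. X i k * g k) * r i)"
    by (subst sum.swap) (simp add: sum_distrib_right)
  finally have "tau_sq n p j lam X g
     = ((\<Sum>i<n. (r i)\<^sup>2) + (\<Sum>i<n. (\<Sum>k\<in>?I. X i k * g k) * r i)) / real n"
    by (simp add: tau_sq_def power2_L2_set r add_divide_distrib)
  also have "(\<Sum>i<n. (r i)\<^sup>2) + (\<Sum>i<n. (\<Sum>k\<in>?I. X i k * g k) * r i) = (\<Sum>i<n. X i j * r i)"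
    by (simp add: r[symmetric] power2_eq_square algebra_simps flip: sum.distrib)
  finally show ?thesis by (simp add: r_def)
qed

text \<open>The vector \<open>c\<close> of inner products of the columns with the nodewise residual
  has \<open>tau_sq\<close> as its \<open>j\<close>-th entry and entries of size at most
  \<open>lam\<close> elsewhere. The correction term therefore removes the error of coordinate
  \<open>j\<close> exactly, and the other coordinates form \<open>R\<close>, bounded by
  duality.\<close>

lemma desparsified_expansion:
  assumes node: "is_arg_min (lasso_obj n ({..<p} - {j}) lam X (\<lambda>i. X i j))
      (\<lambda>g. g \<in> rvec ({..<p} - {j})) (ghat X)"
    and j: "j < p" and lam: "0 \<le> lam" and tau: "tau_sq n p j lam X (ghat X) \<noteq> 0"
    and y: "\<And>i. i < n \<Longrightarrow> y i = dotp p (X i) \<beta> + e i"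
  defines "w \<equiv> nodewise_vec j (ghat X)"
  obtains R where "desparsified_lasso n p j lam bhat ghat (X, y) - \<beta> j
      = (dotp p w (\<lambda>k. (\<Sum>i<n. X i k * e i) / real n) + R) / tau_sq n p j lam X (ghat X)"
    "\<bar>R\<bar> \<le> lam * (\<Sum>k<p. \<bar>bhat (X, y) k - \<beta> k\<bar>)"
proof -
  define t where "t = tau_sq n p j lam X (ghat X)"
  define b where "b = bhat (X, y)"
  define \<delta> where "\<delta> k = b k - \<beta> k" for k
  define r where "r i = dotp p (X i) w" for i
  define c where "c k = (\<Sum>i<n. X i k * r i) / real n" for k
  define R where "R = - (\<Sum>k\<in>{..<p} - {j}. \<delta> k * c k)"
  have tc: "t = c j" using tau_sq_eq_gram[OF node j] by (simp add: t_def c_def r_def w_def)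
  have res: "y i - dotp p (X i) b = e i - dotp p (X i) \<delta>" if "i < n" for i
    using y[OF that] by (simp add: \<delta>_def dotp_def algebra_simps sum_subtractf)
  have "dotp p w (\<lambda>k. \<Sum>i<n. X i k * (y i - dotp p (X i) b))
      = (\<Sum>k<p. \<Sum>i<n. w k * (X i k * (e i - dotp p (X i) \<delta>)))"
    unfolding dotp_def[of p w] sum_distrib_left using res by (intro sum.cong) auto
  also have "\<dots> = (\<Sum>k<p. \<Sum>i<n. w k * (X i k * e i)) - (\<Sum>k<p. \<Sum>i<n. (X i k * w k) * dotp p (X i) \<delta>)"
    by (simp add: algebra_simps sum_subtractf)
  also have "(\<Sum>k<p. \<Sum>i<n. (X i k * w k) * dotp p (X i) \<delta>) = (\<Sum>i<n. r i * dotp p (X i) \<delta>)"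
    by (subst sum.swap) (simp add: r_def dotp_def[of p _ w] sum_distrib_right)
  also have "(\<Sum>i<n. r i * dotp p (X i) \<delta>) = (\<Sum>i<n. \<Sum>k<p. \<delta> k * (X i k * r i))"
    by (simp add: dotp_def sum_distrib_left mult_ac)
  also have "\<dots> = (\<Sum>k<p. \<Sum>i<n. \<delta> k * (X i k * r i))" by (rule sum.swap)
  finally have "dotp p w (\<lambda>k. \<Sum>i<n. X i k * (y i - dotp p (X i) b)) / real n
      = dotp p w (\<lambda>k. (\<Sum>i<n. X i k * e i) / real n) - (\<Sum>k<p. \<delta> k * c k)"
    by (simp add: dotp_def[of p w] c_def diff_divide_distrib sum_divide_distrib sum_distrib_left)
  also have "(\<Sum>k<p. \<delta> k * c k) = \<delta> j * t - R"
    by (simp add: sum_lessThan_remove[OF j] R_def tc)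
  finally have main: "dotp p w (\<lambda>k. \<Sum>i<n. X i k * (y i - dotp p (X i) b)) / real n
      = dotp p w (\<lambda>k. (\<Sum>i<n. X i k * e i) / real n) - \<delta> j * t + R" by simp
  have theta: "dotp p (theta_hat n p j lam X (ghat X)) u = dotp p w u / t" for u
    unfolding dotp_def sum_divide_distrib
    by (intro sum.cong) (auto simp: theta_hat_def w_def t_def nodewise_vec_def)
  have "desparsified_lasso n p j lam bhat ghat (X, y) - \<beta> j
      = \<delta> j + dotp p w (\<lambda>k. \<Sum>i<n. X i k * (y i - dotp p (X i) b)) / real n / t"
    unfolding desparsified_lasso_def by (simp add: theta b_def \<delta>_def)
  also have "\<dots> = (dotp p w (\<lambda>k. (\<Sum>i<n. X i k * e i) / real n) + R) / t"
    using tau unfolding main t_def[symmetric] by (simp add: field_simps)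
  finally have 1: "desparsified_lasso n p j lam bhat ghat (X, y) - \<beta> j
      = (dotp p w (\<lambda>k. (\<Sum>i<n. X i k * e i) / real n) + R) / t" .
  have cle: "\<bar>c k\<bar> \<le> lam" if "k \<in> {..<p} - {j}" for k
    using lasso_KKT_coordinate[OF node _ that lam]
    by (simp add: c_def r_def w_def dotp_nodewise_vec[OF j])
  have "\<bar>R\<bar> \<le> (\<Sum>k\<in>{..<p} - {j}. \<bar>\<delta> k * c k\<bar>)" unfolding R_def by (simp add: sum_abs)
  also have "\<dots> \<le> (\<Sum>k\<in>{..<p} - {j}. lam * \<bar>\<delta> k\<bar>)"
  proof (intro sum_mono)
    fix k assume k: "k \<in> {..<p} - {j}"
    show "\<bar>\<delta> k * c k\<bar> \<le> lam * \<bar>\<delta> k\<bar>"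
      using mult_right_mono[OF cle[OF k], of "\<bar>\<delta> k\<bar>"] by (simp add: abs_mult mult.commute)
  qed
  also have "\<dots> \<le> lam * (\<Sum>k<p. \<bar>\<delta> k\<bar>)"
    unfolding sum_distrib_left[symmetric] using lam by (intro mult_left_mono sum_mono2) auto
  finally have 2: "\<bar>R\<bar> \<le> lam * (\<Sum>k<p. \<bar>\<delta> k\<bar>)" .
  show ?thesis
    by (rule that[of R]) (use 1 2 in \<open>simp_all only: t_def \<delta>_def b_def\<close>)
qed

text \<open>The conjuncts control the Gram matrix, the score of the Lasso, and the score of the
  nodewise regression, whose noise is the residual \<open>dotp p (X i) v\<close>. For the intended
  \<open>v\<close>, a multiple of column \<open>j\<close> of the inverse, the centring in the last
  conjunct vanishes off \<open>j\<close> and is the residual variance at \<open>j\<close>.\<close>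

definition good_event ::
    "nat \<Rightarrow> nat \<Rightarrow> real mat \<Rightarrow> (nat \<Rightarrow> real) \<Rightarrow> real \<Rightarrow> design \<Rightarrow> (nat \<Rightarrow> real) \<Rightarrow> bool" where
  "good_event n p S v s X e \<longleftrightarrow>
     (\<forall>k<p. \<forall>l<p. \<bar>gram n p X $$ (k, l) - S $$ (k, l)\<bar> \<le> s) \<and>
     (\<forall>k<p. \<bar>(\<Sum>i<n. X i k * e i) / real n\<bar> \<le> s) \<and>
     (\<forall>k<p. \<bar>(\<Sum>i<n. X i k * dotp p (X i) v) / real n - (\<Sum>l<p. S $$ (k, l) * v l)\<bar> \<le> s)"

text \<open>Extending the error by zero off \<open>I\<close> lets one restricted eigenvalue argument
  on \<open>{..<p}\<close> serve both the Lasso and the nodewise regression.\<close>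

lemma lasso_l1_error:
  assumes min: "is_arg_min (lasso_obj n I lam X y) (\<lambda>b. b \<in> rvec I) bh"
    and y: "\<And>i. i < n \<Longrightarrow> y i = (\<Sum>k\<in>I. X i k * b k) + e i"
    and noise: "\<And>k. k \<in> I \<Longrightarrow> \<bar>(\<Sum>i<n. X i k * e i) / real n\<bar> \<le> s"
    and I: "I \<subseteq> {..<p}"
    and q: "\<And>a. (\<Sum>k<p. (a k)\<^sup>2) / L \<le> bilin p S a a" and L: "0 < L"
    and close: "\<And>k l. k < p \<Longrightarrow> l < p \<Longrightarrow> \<bar>gram n p X $$ (k, l) - S $$ (k, l)\<bar> \<le> s"
    and s: "0 \<le> s" "0 \<le> lam" "lam + s \<le> \<mu>"
    and regime: "0 < lam \<and> 2 * s \<le> lam \<and> card {k\<in>I. b k \<noteq> 0} \<le> m \<or> p \<le> m"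
    and small: "32 * L * real m * s \<le> 1"
  shows "(\<Sum>k\<in>I. \<bar>bh k - b k\<bar>) \<le> 24 * L * real m * \<mu>"
proof -
  define J where "J = (if p \<le> m then I else {k\<in>I. b k \<noteq> 0})"
  define d where "d k = (if k \<in> I then bh k - b k else 0)" for k
  have fin: "finite I" using I finite_subset by blast
  have J: "J \<subseteq> I" by (auto simp: J_def)
  have card: "card J \<le> m"
    using regime card_mono[OF _ I] by (auto simp: J_def)
  have reg: "0 < lam \<and> 2 * s \<le> lam \<or> J = I" using regime by (auto simp: J_def)
  have supp: "b k = 0" if "k \<in> I - J" for k using that by (auto simp: J_def split: if_splits)
  note cone = lasso_cone[OF min y noise fin J supp reg s(2,1,3)]
  have dI: "(\<Sum>k<p. \<bar>d k\<bar>) = (\<Sum>k\<in>I. \<bar>bh k - b k\<bar>)"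
    unfolding d_def using I by (intro sum.mono_neutral_cong_right) auto
  have dJ: "(\<Sum>k\<in>J. \<bar>d k\<bar>) = (\<Sum>k\<in>J. \<bar>bh k - b k\<bar>)"
    unfolding d_def using J by (intro sum.cong) auto
  have dd: "dotp p (X i) d = (\<Sum>k\<in>I. X i k * (bh k - b k))" for i
    unfolding d_def dotp_def using I by (intro sum.mono_neutral_cong_right) auto
  have "(\<Sum>k<p. \<bar>d k\<bar>) \<le> 24 * L * real m * \<mu>"
  proof (rule sum_abs_le_of_restricted_eigenvalue[OF q L close s(1) _ card small])
    show "J \<subseteq> {..<p}" using J I by blast
    show "bilin p (gram n p X) d d \<le> 3 * \<mu> * (\<Sum>k\<in>J. \<bar>d k\<bar>)"
      using cone(2) by (simp add: bilin_gram dd dJ power2_eq_square)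
    show "(\<Sum>k<p. \<bar>d k\<bar>) \<le> 4 * (\<Sum>k\<in>J. \<bar>d k\<bar>)" using cone(1) by (simp add: dI dJ)
  qed (use s in auto)
  then show ?thesis by (simp add: dI)
qed

text \<open>Here \<tau> stands for the inverse of the diagonal precision entry. Replacing
  \<open>tau_sq\<close> by \<tau> costs a relative error of the linear term. The additive error
  collects two products of an \<open>l1\<close> error with a sup norm: nodewise error times Lasso
  score, and Lasso error times \<open>lamj\<close>.\<close>

lemma desparsified_close:
  assumes good: "good_event n p S v s X e" and j: "j < p"
    and q: "\<And>a. (\<Sum>k<p. (a k)\<^sup>2) / L \<le> bilin p S a a" and L: "1 \<le> L"
    and Sj: "\<And>k. k < p \<Longrightarrow> \<bar>S $$ (j, k)\<bar> \<le> L"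
    and vj: "v j = 1" and Sv: "\<And>k. k < p \<Longrightarrow> (\<Sum>l<p. S $$ (k, l) * v l) = (if k = j then \<tau> else 0)"
    and tau: "1 / L \<le> \<tau>" "\<tau> \<le> L"
    and lasso: "is_arg_min (lasso_obj n {..<p} lam X y) (\<lambda>b. b \<in> rvec {..<p}) (bhat (X, y))"
    and node: "is_arg_min (lasso_obj n ({..<p} - {j}) lamj X (\<lambda>i. X i j))
      (\<lambda>g. g \<in> rvec ({..<p} - {j})) (ghat X)"
    and y: "\<And>i. i < n \<Longrightarrow> y i = dotp p (X i) \<beta> + e i"
    and s: "0 \<le> s" "0 \<le> lam" "0 \<le> lamj" "lam + lamj + s \<le> \<mu>" and m: "1 \<le> m"
    and regime: "(0 < lam \<and> 2 * s \<le> lam \<and> 0 < lamj \<and> 2 * s \<le> lamj \<and> l0norm p \<beta> \<le> m \<and> l0norm p v \<le> m)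
       \<or> p \<le> m"
    and small: "100 * L ^ 3 * real m * \<mu> \<le> 1"
  shows "\<bar>sqrt n * (desparsified_lasso n p j lamj bhat ghat (X, y) - \<beta> j) / sqrt (1 / \<tau>)
      - (\<Sum>i<n. dotp p (X i) v / sqrt \<tau> * e i) / sqrt n\<bar>
    \<le> 100 * L ^ 3 * real m * \<mu> * \<bar>(\<Sum>i<n. dotp p (X i) v / sqrt \<tau> * e i) / sqrt n\<bar>
      + 100 * L ^ 3 * sqrt n * real m * \<mu>\<^sup>2"
proof -
  let ?I = "{..<p} - {j}"
  define g where "g = ghat X"
  define b where "b = bhat (X, y)"
  define w where "w = nodewise_vec j g"
  define N where "N k = (\<Sum>i<n. X i k * e i) / real n" for k
  define t where "t = tau_sq n p j lamj X g"
  define Q where "Q = 24 * L * real m * \<mu>"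
  define A where "A = (\<Sum>i<n. dotp p (X i) v / sqrt \<tau> * e i) / sqrt n"
  define K where "K = 100 * L ^ 3 * real m * \<mu>"
  have mu: "0 \<le> \<mu>" "s \<le> \<mu>" "lamj \<le> \<mu>" using s by auto
  have Lp: "0 < L" and taup: "0 < \<tau>" using L tau by (auto intro: less_le_trans[of 0 "1 / L"])
  have L3: "1 \<le> L ^ 3" "L \<le> L ^ 3" "L\<^sup>2 \<le> L ^ 3"
    using L power_increasing[of 1 3 L] power_increasing[of 2 3 L] by (auto simp: one_le_power)
  have m1: "1 \<le> real m" using m by simp
  have lm: "c * x \<le> c' * x" if "c \<le> c'" "0 \<le> x" for c c' x :: real using that by (rule mult_right_mono)
  have mmu: "\<mu> \<le> real m * \<mu>" "0 \<le> real m * \<mu>" using m1 mu lm[of 1 "real m" \<mu>] by auto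
  have mmuL: "real m * \<mu> \<le> L\<^sup>2 * (real m * \<mu>)"
    using lm[of 1 "L\<^sup>2", OF _ mmu(2)] L by (simp add: one_le_power)
  have KL: "100 * L ^ 3 * (real m * \<mu>) \<le> 1" using small by (simp add: mult.assoc)
  have mu1: "\<mu> \<le> 1"
    using lm[OF L3(1) mmu(2)] KL mmu by linarith
  have small32: "32 * L * real m * s \<le> 1"
  proof -
    have "L * (real m * s) \<le> L ^ 3 * (real m * \<mu>)"
      using L3 mu s m1 Lp by (intro mult_mono) auto
    with KL show ?thesis using mmu by (simp add: mult.assoc)
  qed
  have close: "\<bar>gram n p X $$ (k, l) - S $$ (k, l)\<bar> \<le> s" if "k < p" "l < p" for k l
    using good that by (simp add: good_event_def)
  have noise: "\<bar>N k\<bar> \<le> s" if "k < p" for k using good that by (simp add: good_event_def N_def)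
  have vnoise: "\<bar>(\<Sum>i<n. X i k * dotp p (X i) v) / real n - (if k = j then \<tau> else 0)\<bar> \<le> s"
    if "k < p" for k using good that Sv by (simp add: good_event_def)
  have b1: "(\<Sum>k<p. \<bar>b k - \<beta> k\<bar>) \<le> Q"
    unfolding b_def Q_def
  proof (rule lasso_l1_error[OF lasso _ _ _ q Lp close])
    show "y i = (\<Sum>k<p. X i k * \<beta> k) + e i" if "i < n" for i using y[OF that] by (simp add: dotp_def)
    show "\<bar>(\<Sum>i<n. X i k * e i) / real n\<bar> \<le> s" if "k \<in> {..<p}" for k
      using noise[of k] that by (simp add: N_def)
    show "0 < lam \<and> 2 * s \<le> lam \<and> card {k \<in> {..<p}. \<beta> k \<noteq> 0} \<le> m \<or> p \<le> m"
      using regime by (auto simp: l0norm_def)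
  qed (use s small32 in auto)
  have g1: "(\<Sum>k\<in>?I. \<bar>g k - (- v k)\<bar>) \<le> Q"
    unfolding g_def Q_def
  proof (rule lasso_l1_error[OF node _ _ _ q Lp close])
    \<comment> \<open>Since \<open>v j = 1\<close>, column \<open>j\<close> follows a linear model
      with coefficients \<open>- v\<close> and noise \<open>dotp p (X i) v\<close>.\<close>
    show "X i j = (\<Sum>k\<in>?I. X i k * - v k) + dotp p (X i) v" for i
      unfolding dotp_def sum_lessThan_remove[OF j] by (simp add: sum_negf vj)
    show "\<bar>(\<Sum>i<n. X i k * dotp p (X i) v) / real n\<bar> \<le> s" if "k \<in> ?I" for k
      using vnoise[of k] that by simp
    have "card {k \<in> ?I. - v k \<noteq> 0} \<le> l0norm p v"
      unfolding l0norm_def by (intro card_mono) auto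
    then show "0 < lamj \<and> 2 * s \<le> lamj \<and> card {k \<in> ?I. - v k \<noteq> 0} \<le> m \<or> p \<le> m"
      using regime by auto
  qed (use s small32 in auto)
  define \<Delta> where "\<Delta> k = w k - v k" for k
  have D1: "(\<Sum>k<p. \<bar>\<Delta> k\<bar>) \<le> Q"
  proof -
    have "(\<Sum>k<p. \<bar>\<Delta> k\<bar>) = (\<Sum>k\<in>?I. \<bar>g k - (- v k)\<bar>)"
      unfolding sum_lessThan_remove[OF j] by (simp add: \<Delta>_def w_def vj) (intro sum.cong, auto)
    with g1 show ?thesis by simp
  qed
  have Qn: "0 \<le> Q" using Lp mmu by (simp add: Q_def mult.assoc)
  have w: "dotp p u w = dotp p u v + dotp p u \<Delta>" for u
    by (simp add: \<Delta>_def dotp_def algebra_simps flip: sum.distrib)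
  have "t = (\<Sum>i<n. X i j * dotp p (X i) w) / real n"
    using tau_sq_eq_gram[OF node j] by (simp add: t_def w_def g_def)
  also have "\<dots> = (\<Sum>i<n. X i j * dotp p (X i) v) / real n + (\<Sum>i<n. X i j * dotp p (X i) \<Delta>) / real n"
    by (simp add: w algebra_simps sum.distrib add_divide_distrib)
  also have "(\<Sum>i<n. X i j * dotp p (X i) \<Delta>) = (\<Sum>i<n. \<Sum>k<p. \<Delta> k * (X i j * X i k))"
    by (simp add: dotp_def sum_distrib_left mult_ac)
  also have "\<dots> = (\<Sum>k<p. \<Sum>i<n. \<Delta> k * (X i j * X i k))" by (rule sum.swap)
  also have "\<dots> / real n = dotp p \<Delta> (\<lambda>k. gram n p X $$ (j, k))"
    unfolding dotp_def sum_divide_distrib using j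
    by (intro sum.cong) (auto simp: gram_index sum_distrib_left sum_divide_distrib)
  finally have t: "t = (\<Sum>i<n. X i j * dotp p (X i) v) / real n + dotp p \<Delta> (\<lambda>k. gram n p X $$ (j, k))" .
  have "\<bar>dotp p \<Delta> (\<lambda>k. gram n p X $$ (j, k))\<bar> \<le> (\<Sum>k<p. \<bar>\<Delta> k\<bar>) * (2 * L)"
  proof (rule abs_dotp_le)
    show "\<bar>gram n p X $$ (j, k)\<bar> \<le> 2 * L" if "k < p" for k
      using close[OF j that] Sj[OF that] mu mu1 L by linarith
  qed
  also have "\<dots> \<le> Q * (2 * L)" using D1 Lp by (intro mult_right_mono) auto
  finally have "\<bar>t - \<tau>\<bar> \<le> \<mu> + 2 * L * Q" using vnoise[OF j] mu unfolding t by (simp add: mult.commute)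
  also have "2 * L * Q = 48 * (L\<^sup>2 * (real m * \<mu>))" by (simp add: Q_def power2_eq_square)
  also have "\<mu> + 48 * (L\<^sup>2 * (real m * \<mu>)) \<le> 49 * (L\<^sup>2 * (real m * \<mu>))"
    using mmuL mmu(1) by linarith
  finally have "L * \<bar>t - \<tau>\<bar> \<le> L * (49 * (L\<^sup>2 * (real m * \<mu>)))" using Lp by (intro mult_left_mono) auto
  also have "\<dots> = 49 * (L ^ 3 * (real m * \<mu>))" by (simp add: power2_eq_square power3_eq_cube)
  finally have *: "L * \<bar>t - \<tau>\<bar> \<le> 49 * (L ^ 3 * (real m * \<mu>))" .
  \<comment> \<open>The bound \<open>K / 2\<close> is used twice: with \<open>K \<le> 1\<close> and
    \<open>1 \<le> L * \<tau>\<close> it keeps \<open>t\<close> above \<open>1 / (2 * L)\<close>,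
    and with \<open>1 / t \<le> 2 * L\<close> it becomes the relative error
    \<open>K\<close>.\<close>
  have t_tau: "L * \<bar>t - \<tau>\<bar> \<le> K / 2"
  proof -
    have "0 \<le> L ^ 3 * (real m * \<mu>)" using mmu(2) Lp by simp
    moreover have "K / 2 = 50 * (L ^ 3 * (real m * \<mu>))" by (simp add: K_def)
    ultimately show ?thesis using * by linarith
  qed
  have K: "0 \<le> K" "K \<le> 1" using KL mmu(2) Lp by (simp_all add: K_def mult.assoc)
  have "L * (\<tau> - t) \<le> L * \<bar>t - \<tau>\<bar>" using Lp by (intro mult_left_mono) auto
  then have "L * (\<tau> - t) \<le> 1 / 2" using t_tau K by linarith
  moreover have "1 \<le> L * \<tau>" using tau(1) Lp by (simp add: field_simps)
  ultimately have Lt: "1 \<le> 2 * L * t" by (simp add: algebra_simps)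
  then have tp: "0 < t" using mult_nonneg_nonpos[of "2 * L" t] Lp by (cases "0 < t") auto
  have inv_t: "1 / t \<le> 2 * L" using Lt tp by (simp add: field_simps)
  have t0: "tau_sq n p j lamj X (ghat X) \<noteq> 0" using tp by (simp add: t_def g_def)
  obtain R where R: "desparsified_lasso n p j lamj bhat ghat (X, y) - \<beta> j = (dotp p w N + R) / t"
    "\<bar>R\<bar> \<le> lamj * (\<Sum>k<p. \<bar>b k - \<beta> k\<bar>)"
    using desparsified_expansion[where X = X and ghat = ghat and y = y and \<beta> = \<beta> and e = e and bhat = bhat,
        OF node j s(3) t0 y]
    unfolding t_def g_def w_def N_def b_def by blast
  have vN: "dotp p v N = (\<Sum>i<n. dotp p (X i) v * e i) / real n"
  proof -
    have "dotp p v N = (\<Sum>k<p. \<Sum>i<n. X i k * v k * e i) / real n"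
      unfolding dotp_def N_def by (simp add: sum_divide_distrib sum_distrib_left mult_ac)
    also have "(\<Sum>k<p. \<Sum>i<n. X i k * v k * e i) = (\<Sum>i<n. dotp p (X i) v * e i)"
      by (subst sum.swap) (simp add: dotp_def sum_distrib_right)
    finally show ?thesis .
  qed
  \<comment> \<open>With this normalisation the linear term appears as
    \<open>\<tau> / t * A\<close>, so that its distance from \<open>A\<close> is governed by
    \<open>\<tau> - t\<close> alone.\<close>
  have A: "sqrt n * sqrt \<tau> * dotp p v N = \<tau> * A"
  proof -
    have "A = (\<Sum>i<n. dotp p (X i) v * e i) / (sqrt \<tau> * sqrt n)"
      unfolding A_def by (simp add: sum_divide_distrib)
    moreover have "(\<Sum>i<n. dotp p (X i) v * e i) = sqrt n * (sqrt n * dotp p v N)"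
      unfolding vN by (cases "n = 0") (auto simp flip: mult.assoc)
    ultimately have *: "sqrt n * dotp p v N = A * sqrt \<tau>"
      using taup by (cases "n = 0") (auto simp: field_simps)
    have "sqrt n * sqrt \<tau> * dotp p v N = sqrt \<tau> * (sqrt n * dotp p v N)" by (simp only: mult_ac)
    also have "\<dots> = (sqrt \<tau> * sqrt \<tau>) * A" unfolding * by (simp only: mult_ac)
    finally show ?thesis using taup by simp
  qed
  have "sqrt n * (desparsified_lasso n p j lamj bhat ghat (X, y) - \<beta> j) / sqrt (1 / \<tau>) - A
      = (sqrt n * sqrt \<tau> * dotp p v N) / t - A + sqrt n * sqrt \<tau> * (dotp p \<Delta> N + R) / t"
  proof -
    have "dotp p w N = dotp p v N + dotp p \<Delta> N"
      using w[of N] by (simp only: dotp_commute[of p _ N])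
    moreover have "sqrt (1 / \<tau>) = 1 / sqrt \<tau>" by (simp add: real_sqrt_divide)
    ultimately show ?thesis
      unfolding R(1) by (simp add: algebra_simps add_divide_distrib)
  qed
  also have "\<dots> = (\<tau> - t) / t * A + sqrt n * sqrt \<tau> * (dotp p \<Delta> N + R) / t"
    unfolding A using tp by (simp add: field_simps)
  finally have eq: "sqrt n * (desparsified_lasso n p j lamj bhat ghat (X, y) - \<beta> j) / sqrt (1 / \<tau>) - A
      = (\<tau> - t) / t * A + sqrt n * sqrt \<tau> * (dotp p \<Delta> N + R) / t" .
  have one: "\<bar>(\<tau> - t) / t * A\<bar> \<le> K * \<bar>A\<bar>"
  proof -
    have "\<bar>(\<tau> - t) / t\<bar> = \<bar>t - \<tau>\<bar> * (1 / t)" using tp by simp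
    also have "\<dots> \<le> \<bar>t - \<tau>\<bar> * (2 * L)" using inv_t by (intro mult_left_mono) auto
    also have "\<dots> = 2 * (L * \<bar>t - \<tau>\<bar>)" by (simp only: mult_ac)
    also have "\<dots> \<le> K" using t_tau by simp
    finally show ?thesis unfolding abs_mult by (rule mult_right_mono) simp
  qed
  have "\<bar>dotp p \<Delta> N\<bar> \<le> Q * \<mu>"
    using abs_dotp_le[of p N s \<Delta>, OF noise] mult_mono[OF D1 mu(2) Qn s(1)] by simp
  moreover have "\<bar>R\<bar> \<le> Q * \<mu>"
    using R(2) mult_mono[OF mu(3) b1 mu(1)] by (simp add: sum_nonneg mult.commute)
  ultimately have DR: "\<bar>dotp p \<Delta> N + R\<bar> \<le> 2 * (Q * \<mu>)" by linarith
  have "\<tau> \<le> L * L" using tau(2) mult_left_mono[OF L, of L] Lp by linarith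
  then have "sqrt \<tau> \<le> L" using Lp by (intro real_le_lsqrt) (auto simp: power2_eq_square)
  have "\<bar>sqrt n * sqrt \<tau> * (dotp p \<Delta> N + R) / t\<bar> \<le> sqrt n * L * (2 * (Q * \<mu>)) * (2 * L)"
  proof -
    have "\<bar>sqrt n * sqrt \<tau> * (dotp p \<Delta> N + R) / t\<bar>
        = sqrt n * sqrt \<tau> * \<bar>dotp p \<Delta> N + R\<bar> * (1 / t)"
      using tp taup by (simp add: abs_mult)
    also have "\<dots> \<le> sqrt n * L * (2 * (Q * \<mu>)) * (2 * L)"
      using DR inv_t tp taup Lp Qn mu \<open>sqrt \<tau> \<le> L\<close> by (intro mult_mono mult_nonneg_nonneg) simp_all
    finally show ?thesis .
  qed
  \<comment> \<open>The constant is \<open>24 * 2 * 2\<close>: from \<open>Q\<close>, from the two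
    terms of size \<open>Q * \<mu>\<close>, and from \<open>1 / t \<le> 2 * L\<close>.\<close>
  also have "\<dots> = 96 * (L ^ 3 * (sqrt n * real m * \<mu>\<^sup>2))"
    by (simp add: Q_def power2_eq_square power3_eq_cube)
  also have "\<dots> \<le> 100 * (L ^ 3 * (sqrt n * real m * \<mu>\<^sup>2))"
    using Lp by (intro mult_right_mono) auto
  finally have two: "\<bar>sqrt n * sqrt \<tau> * (dotp p \<Delta> N + R) / t\<bar> \<le> 100 * L ^ 3 * sqrt n * real m * \<mu>\<^sup>2"
    by (simp add: mult.assoc)
  show ?thesis
    unfolding A_def[symmetric] eq K_def[symmetric]
    using abs_triangle_ineq[of "(\<tau> - t) / t * A"] one two by (meson add_mono order_trans)
qed

section \<open>Exponential moments and concentration\<close>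

text \<open>Exponential tilting: if the density times the exponential is a multiple of another
  density, the moment is that multiple.\<close>

lemma nn_integral_density_scaled:
  fixes h :: "real \<Rightarrow> real" and c d :: real
  assumes "\<And>x. f x * h x = c * g x" "0 \<le> c" "\<And>x. 0 \<le> f x" "\<And>x. 0 \<le> g x"
    and [measurable]: "f \<in> borel_measurable borel" "g \<in> borel_measurable borel" "h \<in> borel_measurable borel"
    and "(\<integral>\<^sup>+x. ennreal (g x) \<partial>lborel) = 1"
  shows "(\<integral>\<^sup>+x. ennreal (h x) \<partial>density lborel (\<lambda>x. ennreal (f x))) = ennreal c"
proof -
  have "(\<integral>\<^sup>+x. ennreal (h x) \<partial>density lborel (\<lambda>x. ennreal (f x)))
      = (\<integral>\<^sup>+x. ennreal (f x) * ennreal (h x) \<partial>lborel)"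
    by (subst nn_integral_density) auto
  also have "\<dots> = (\<integral>\<^sup>+x. ennreal c * ennreal (g x) \<partial>lborel)"
    by (intro nn_integral_cong) (simp add: assms flip: ennreal_mult')
  also have "\<dots> = ennreal c" using assms by (subst nn_integral_cmult) auto
  finally show ?thesis .
qed

lemma nn_integral_normal_density:
  "0 < \<sigma> \<Longrightarrow> (\<integral>\<^sup>+x. ennreal (normal_density \<mu> \<sigma> x) \<partial>lborel) = 1"
  using prob_space.emeasure_space_1[OF prob_space_normal_density, of \<sigma> \<mu>]
  by (simp add: emeasure_density)

lemma nn_integral_exp_std_normal:
  "(\<integral>\<^sup>+x. ennreal (exp (t * x)) \<partial>std_normal_distribution) = ennreal (exp (t\<^sup>2 / 2))"
proof (rule nn_integral_density_scaled[where g = "normal_density t 1"])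
  show "std_normal_density x * exp (t * x) = exp (t\<^sup>2 / 2) * normal_density t 1 x" for x
    by (simp add: normal_density_def power2_eq_square field_simps flip: exp_add)
qed (auto simp: nn_integral_normal_density)

text \<open>The tilted density is normal with variance \<open>q / (1 - 2 * t * q)\<close>. The case
  \<open>q = 0\<close> is separate because \<open>centered_normal 0\<close> is a point mass.\<close>

lemma nn_integral_exp_sq_centered_normal:
  assumes "0 \<le> q" "2 * t * q < 1"
  shows "(\<integral>\<^sup>+x. ennreal (exp (t * x\<^sup>2)) \<partial>centered_normal q) = ennreal (1 / sqrt (1 - 2 * t * q))"
proof (cases "q = 0")
  case True
  then show ?thesis by (simp add: centered_normal_def nn_integral_return)
next
  case False
  define r where "r = 1 - 2 * t * q"
  have q: "0 < q" and r: "0 < r" using assms False by (auto simp: r_def)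
  have "(\<integral>\<^sup>+x. ennreal (exp (t * x\<^sup>2)) \<partial>density lborel (\<lambda>x. ennreal (normal_density 0 (sqrt q) x)))
      = ennreal (1 / sqrt r)"
  proof (rule nn_integral_density_scaled[where g = "normal_density 0 (sqrt (q / r))"])
    have "normal_density 0 (sqrt q) x * exp (t * x\<^sup>2)
        = 1 / sqrt (2 * pi * q) * exp (- (r * x\<^sup>2 / (2 * q)))" for x
      using q by (simp add: normal_density_def r_def field_simps flip: exp_add)
    moreover have "1 / sqrt r * normal_density 0 (sqrt (q / r)) x
        = 1 / sqrt (2 * pi * q) * exp (- (r * x\<^sup>2 / (2 * q)))" for x
      using q r by (simp add: normal_density_def real_sqrt_divide real_sqrt_mult field_simps)
    ultimately show "normal_density 0 (sqrt q) x * exp (t * x\<^sup>2)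
        = 1 / sqrt r * normal_density 0 (sqrt (q / r)) x" for x by simp
  qed (use q r in \<open>auto simp: nn_integral_normal_density\<close>)
  then show ?thesis using False by (simp add: centered_normal_def r_def)
qed

lemma inverse_sqrt_one_minus_le_exp:
  fixes x :: real
  assumes "\<bar>x\<bar> \<le> 1 / 2"
  shows "1 / sqrt (1 - x) \<le> exp (x / 2 + x\<^sup>2)"
proof -
  have pos: "0 < 1 - x" using assms by auto
  have "\<bar>ln (1 + - x) - - x\<bar> \<le> 2 * (- x)\<^sup>2"
    using assms by (intro abs_ln_one_plus_x_minus_x_bound) auto
  then have l: "- ln (1 - x) / 2 \<le> x / 2 + x\<^sup>2" by simp
  have "1 / sqrt (1 - x) = exp (- ln (1 - x) / 2)"
    using pos by (simp add: exp_minus field_simps flip: ln_sqrt)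
  with l show ?thesis by simp
qed

text \<open>Centring cancels the linear term of the exponent and leaves
  \<open>(2 * t * q)\<^sup>2\<close>. The range of \<open>t\<close> keeps \<open>2 * t * q\<close>
  within \<open>1 / 2\<close> for every \<open>q \<le> Q\<close>.\<close>

lemma nn_integral_exp_centered_sq_le:
  assumes q: "0 \<le> q" "q \<le> Q" and Q: "0 < Q" and t: "\<bar>t\<bar> \<le> 1 / (4 * Q)"
  shows "(\<integral>\<^sup>+x. ennreal (exp (t * (x\<^sup>2 - q))) \<partial>centered_normal q) \<le> ennreal (exp (4 * Q\<^sup>2 * t\<^sup>2))"
proof -
  have tq: "\<bar>2 * t * q\<bar> \<le> 1 / 2"
  proof -
    have "\<bar>t\<bar> * q \<le> 1 / (4 * Q) * Q" using q Q t by (intro mult_mono) auto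
    then show ?thesis using q Q by (simp add: abs_mult)
  qed
  have "(\<integral>\<^sup>+x. ennreal (exp (t * (x\<^sup>2 - q))) \<partial>centered_normal q)
      = (\<integral>\<^sup>+x. ennreal (exp (- (t * q))) * ennreal (exp (t * x\<^sup>2)) \<partial>centered_normal q)"
    by (simp add: algebra_simps flip: ennreal_mult'' exp_add)
  also have "\<dots> = ennreal (exp (- (t * q))) * (\<integral>\<^sup>+x. ennreal (exp (t * x\<^sup>2)) \<partial>centered_normal q)"
    by (rule nn_integral_cmult) (simp add: centered_normal_def)
  also have "\<dots> = ennreal (exp (- (t * q))) * ennreal (1 / sqrt (1 - 2 * t * q))"
    using q tq by (subst nn_integral_exp_sq_centered_normal) auto
  also have "\<dots> = ennreal (exp (- (t * q)) * (1 / sqrt (1 - 2 * t * q)))"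
    using tq by (subst ennreal_mult) auto
  also have "exp (- (t * q)) * (1 / sqrt (1 - 2 * t * q)) \<le> exp (- (t * q)) * exp (2 * t * q / 2 + (2 * t * q)\<^sup>2)"
    using inverse_sqrt_one_minus_le_exp[OF tq] by (intro mult_left_mono) auto
  also have "\<dots> = exp (4 * q\<^sup>2 * t\<^sup>2)" by (simp add: power_mult_distrib flip: exp_add)
  also have "\<dots> \<le> exp (4 * Q\<^sup>2 * t\<^sup>2)" using q by (auto intro!: mult_right_mono power_mono)
  finally show ?thesis by (simp add: ennreal_leI)
qed

text \<open>Design and noise come as two product measures, while Chernoff bounds and the central
  limit theorem want one product of i.i.d. pairs. The two laws agree on boxes by Tonelli.\<close>

lemma distr_PiM_pair:
  assumes "prob_space M1" "prob_space M2" and I: "finite I"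
  shows "distr (PiM I (\<lambda>_. M1) \<Otimes>\<^sub>M PiM I (\<lambda>_. M2)) (PiM I (\<lambda>_. M1 \<Otimes>\<^sub>M M2)) (\<lambda>(x, y). \<lambda>i\<in>I. (x i, y i))
    = PiM I (\<lambda>_. M1 \<Otimes>\<^sub>M M2)"
proof -
  interpret M1: prob_space M1 by fact
  interpret M2: prob_space M2 by fact
  interpret M12: pair_prob_space M1 M2 ..
  interpret P2p: prob_space "PiM I (\<lambda>_. M2)" by (simp add: prob_space_PiM assms)
  interpret P1: product_prob_space "\<lambda>_. M1" I ..
  interpret P2: product_prob_space "\<lambda>_. M2" I ..
  interpret P: product_prob_space "\<lambda>_. M1 \<Otimes>\<^sub>M M2" I ..
  let ?Q = "PiM I (\<lambda>_. M1) \<Otimes>\<^sub>M PiM I (\<lambda>_. M2)"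
  let ?z = "\<lambda>(x, y). \<lambda>i\<in>I. (x i, y i)"
  have z: "?z \<in> ?Q \<rightarrow>\<^sub>M PiM I (\<lambda>_. M1 \<Otimes>\<^sub>M M2)" by measurable
  show ?thesis
  proof (rule P.PiM_eqI[OF I])
    fix A assume A: "\<And>i. i \<in> I \<Longrightarrow> A i \<in> sets (M1 \<Otimes>\<^sub>M M2)"
    have ind: "(\<lambda>p. indicator (A i) p :: ennreal) \<in> borel_measurable (M1 \<Otimes>\<^sub>M M2)" if "i \<in> I" for i
      using A[OF that] by simp
    have box: "Pi\<^sub>E I A \<in> sets (PiM I (\<lambda>_. M1 \<Otimes>\<^sub>M M2))" using A I by (intro sets_PiM_I_finite) auto
    have meas: "(\<lambda>p. \<Prod>i\<in>I. indicator (A i) (fst p i, snd p i) :: ennreal) \<in> borel_measurable ?Q"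
    proof (rule borel_measurable_prod_ennreal)
      fix i assume i: "i \<in> I"
      have "(\<lambda>p. (fst p i, snd p i)) \<in> ?Q \<rightarrow>\<^sub>M M1 \<Otimes>\<^sub>M M2" using i by measurable
      from measurable_compose[OF this ind[OF i]]
      show "(\<lambda>p. indicator (A i) (fst p i, snd p i) :: ennreal) \<in> borel_measurable ?Q" .
    qed
    have "emeasure (distr ?Q (PiM I (\<lambda>_. M1 \<Otimes>\<^sub>M M2)) ?z) (Pi\<^sub>E I A)
        = emeasure ?Q (?z -` Pi\<^sub>E I A \<inter> space ?Q)"
      by (rule emeasure_distr[OF z box])
    also have "\<dots> = (\<integral>\<^sup>+p. indicator (?z -` Pi\<^sub>E I A \<inter> space ?Q) p \<partial>?Q)"
      by (rule nn_integral_indicator[symmetric]) (rule measurable_sets[OF z box])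
    also have "\<dots> = (\<integral>\<^sup>+p. (\<Prod>i\<in>I. indicator (A i) (fst p i, snd p i)) \<partial>?Q)"
    proof (rule nn_integral_cong)
      fix p assume p: "p \<in> space ?Q"
      show "indicator (?z -` Pi\<^sub>E I A \<inter> space ?Q) p = (\<Prod>i\<in>I. indicator (A i) (fst p i, snd p i) :: ennreal)"
      proof (cases "\<forall>i\<in>I. (fst p i, snd p i) \<in> A i")
        case True
        then show ?thesis using p by (auto simp: indicator_def split: prod.splits)
      next
        case False
        then show ?thesis using p I
          by (auto simp: indicator_def PiE_iff split: prod.splits intro!: prod_zero[symmetric])
      qed
    qed
    also have "\<dots> = (\<integral>\<^sup>+x. \<integral>\<^sup>+y. (\<Prod>i\<in>I. indicator (A i) (x i, y i)) \<partial>PiM I (\<lambda>_. M2) \<partial>PiM I (\<lambda>_. M1))"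
      using P2p.nn_integral_fst[OF meas] by simp
    also have "\<dots> = (\<integral>\<^sup>+x. (\<Prod>i\<in>I. \<integral>\<^sup>+y. indicator (A i) (x i, y) \<partial>M2) \<partial>PiM I (\<lambda>_. M1))"
    proof (rule nn_integral_cong, rule P2.product_nn_integral_prod[OF I])
      fix x i assume "x \<in> space (PiM I (\<lambda>_. M1))" "i \<in> I"
      then have "x i \<in> space M1" by (auto simp: space_PiM)
      then have "(\<lambda>y. (x i, y)) \<in> M2 \<rightarrow>\<^sub>M M1 \<Otimes>\<^sub>M M2" by measurable
      from measurable_compose[OF this ind[OF \<open>i \<in> I\<close>]]
      show "(\<lambda>y. indicator (A i) (x i, y) :: ennreal) \<in> borel_measurable M2" .
    qed
    also have "\<dots> = (\<Prod>i\<in>I. \<integral>\<^sup>+x. \<integral>\<^sup>+y. indicator (A i) (x, y) \<partial>M2 \<partial>M1)"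
      by (rule P1.product_nn_integral_prod[OF I]) (rule M2.borel_measurable_nn_integral_fst[OF ind])
    also have "\<dots> = (\<Prod>i\<in>I. emeasure (M1 \<Otimes>\<^sub>M M2) (A i))"
      using A by (intro prod.cong refl) (simp add: M2.emeasure_pair_measure)
    finally show "emeasure (distr ?Q (PiM I (\<lambda>_. M1 \<Otimes>\<^sub>M M2)) ?z) (Pi\<^sub>E I A)
      = (\<Prod>i\<in>I. emeasure (M1 \<Otimes>\<^sub>M M2) (A i))" .
  qed simp
qed

section \<open>Chernoff bounds for sums of independent terms\<close>

lemma PiM_Chernoff_upper:
  assumes "prob_space M" and f[measurable]: "f \<in> borel_measurable M"
    and mgf: "(\<integral>\<^sup>+x. ennreal (exp (t * f x)) \<partial>M) \<le> ennreal (exp (c * t\<^sup>2))"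
  shows "measure (PiM {..<n} (\<lambda>_. M)) {\<omega> \<in> space (PiM {..<n} (\<lambda>_. M)). real n * (t * s) \<le> t * (\<Sum>i<n. f (\<omega> i))}
    \<le> exp (real n * (c * t\<^sup>2 - t * s))"
proof -
  interpret M: prob_space M by fact
  interpret PP: prob_space "PiM {..<n} (\<lambda>_::nat. M)" by (simp add: prob_space_PiM assms)
  interpret P: product_prob_space "\<lambda>_::nat. M" "{..<n}" ..
  let ?P = "PiM {..<n} (\<lambda>_::nat. M)"
  let ?u = "\<lambda>\<omega>. \<Prod>i<n. ennreal (exp (t * f (\<omega> i)))"
  have u: "?u \<omega> = ennreal (exp (t * (\<Sum>i<n. f (\<omega> i))))" for \<omega>
    by (simp add: prod_ennreal exp_sum sum_distrib_left)
  have [measurable]: "?u \<in> borel_measurable ?P" by measurable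
  have "emeasure ?P {\<omega> \<in> space ?P. real n * (t * s) \<le> t * (\<Sum>i<n. f (\<omega> i))}
      \<le> emeasure ?P ({\<omega> \<in> space ?P. 1 \<le> ennreal (exp (- (real n * (t * s)))) * ?u \<omega>})"
  proof (rule emeasure_mono)
    show "{\<omega> \<in> space ?P. real n * (t * s) \<le> t * (\<Sum>i<n. f (\<omega> i))}
        \<subseteq> {\<omega> \<in> space ?P. 1 \<le> ennreal (exp (- (real n * (t * s)))) * ?u \<omega>}"
      unfolding u by (auto simp flip: ennreal_mult'' exp_add)
  qed measurable
  also have "\<dots> \<le> ennreal (exp (- (real n * (t * s)))) * (\<integral>\<^sup>+\<omega>. ?u \<omega> \<partial>?P)"
    using nn_integral_Markov_inequality[of ?u "space ?P" ?P "ennreal (exp (- (real n * (t * s))))"]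
    by (simp add: nn_integral_set_ennreal cong: nn_integral_cong)
  also have "(\<integral>\<^sup>+\<omega>. ?u \<omega> \<partial>?P) = (\<Prod>i<n. \<integral>\<^sup>+x. ennreal (exp (t * f x)) \<partial>M)"
    by (rule P.product_nn_integral_prod) auto
  also have "\<dots> \<le> (\<Prod>i<n. ennreal (exp (c * t\<^sup>2)))"
    by (intro prod_mono_ennreal) (use mgf in auto)
  also have "\<dots> = ennreal (exp (real n * (c * t\<^sup>2)))"
    by (simp add: exp_of_nat_mult prod_ennreal ennreal_power)
  finally have "emeasure ?P {\<omega> \<in> space ?P. real n * (t * s) \<le> t * (\<Sum>i<n. f (\<omega> i))}
      \<le> ennreal (exp (- (real n * (t * s)))) * ennreal (exp (real n * (c * t\<^sup>2)))"
    by (simp add: mult_left_mono)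
  also have "\<dots> = ennreal (exp (real n * (c * t\<^sup>2 - t * s)))"
    by (simp add: algebra_simps flip: ennreal_mult'' exp_add)
  finally show ?thesis by (simp add: PP.emeasure_eq_measure)
qed

lemma PiM_Chernoff:
  assumes M: "prob_space M" and f[measurable]: "f \<in> borel_measurable M" and c: "0 < c"
    and mgf: "\<And>t. \<bar>t\<bar> \<le> t0 \<Longrightarrow> (\<integral>\<^sup>+x. ennreal (exp (t * f x)) \<partial>M) \<le> ennreal (exp (c * t\<^sup>2))"
    and s: "0 < s" "s \<le> 2 * c * t0"
  shows "measure (PiM {..<n} (\<lambda>_. M)) {\<omega> \<in> space (PiM {..<n} (\<lambda>_. M)). real n * s < \<bar>\<Sum>i<n. f (\<omega> i)\<bar>}
    \<le> 2 * exp (- (real n * s\<^sup>2 / (4 * c)))"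
proof -
  interpret PP: prob_space "PiM {..<n} (\<lambda>_::nat. M)" by (simp add: prob_space_PiM assms)
  let ?P = "PiM {..<n} (\<lambda>_::nat. M)"
  \<comment> \<open>The minimiser of \<open>c * t\<^sup>2 - t * s\<close>; the upper bound on
    \<open>s\<close> keeps it in the range of the moment bound.\<close>
  define t where "t = s / (2 * c)"
  have t: "0 < t" "t \<le> t0" using c s by (auto simp: t_def field_simps)
  have e: "c * t\<^sup>2 - t * s = - (s\<^sup>2 / (4 * c))"
    using c by (simp add: t_def power2_eq_square field_simps)
  let ?A = "{\<omega> \<in> space ?P. real n * (t * s) \<le> t * (\<Sum>i<n. f (\<omega> i))}"
  let ?B = "{\<omega> \<in> space ?P. real n * (- t * - s) \<le> - t * (\<Sum>i<n. f (\<omega> i))}"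
  have A: "measure ?P ?A \<le> exp (real n * (c * t\<^sup>2 - t * s))"
    by (rule PiM_Chernoff_upper[OF M f mgf]) (use t in auto)
  \<comment> \<open>The lower tail is the one-sided bound at \<open>- t\<close> and
    \<open>- s\<close>; this is why that bound is phrased with the product \<open>t * s\<close> and
    leaves the sign of \<open>t\<close> open.\<close>
  have B: "measure ?P ?B \<le> exp (real n * (c * (- t)\<^sup>2 - (- t) * (- s)))"
    by (rule PiM_Chernoff_upper[OF M f mgf]) (use t in auto)
  have "measure ?P {\<omega> \<in> space ?P. real n * s < \<bar>\<Sum>i<n. f (\<omega> i)\<bar>} \<le> measure ?P (?A \<union> ?B)"
  proof (rule PP.finite_measure_mono)
    show "{\<omega> \<in> space ?P. real n * s < \<bar>\<Sum>i<n. f (\<omega> i)\<bar>} \<subseteq> ?A \<union> ?B"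
    proof
      fix \<omega> assume w: "\<omega> \<in> {\<omega> \<in> space ?P. real n * s < \<bar>\<Sum>i<n. f (\<omega> i)\<bar>}"
      then have "real n * s \<le> (\<Sum>i<n. f (\<omega> i)) \<or> real n * s \<le> - (\<Sum>i<n. f (\<omega> i))" by auto
      then have "t * (real n * s) \<le> t * (\<Sum>i<n. f (\<omega> i)) \<or> t * (real n * s) \<le> t * - (\<Sum>i<n. f (\<omega> i))"
        using t by (meson mult_left_mono less_imp_le)
      then show "\<omega> \<in> ?A \<union> ?B" using w by (auto simp: mult_ac)
    qed
  qed measurable
  also have "\<dots> \<le> measure ?P ?A + measure ?P ?B"
    by (rule measure_Un_le) measurable
  also have "\<dots> \<le> 2 * exp (- (real n * s\<^sup>2 / (4 * c)))"
    using A B by (simp add: e)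
  finally show ?thesis .
qed

section \<open>The design and the noise\<close>

lemma prob_space_std_normal: "prob_space std_normal_distribution"
  using real_dist_normal_dist by (simp add: real_distribution_def)

text \<open>The joint law of design and noise does not involve the regression vector. All
  probability bounds are proved here and carried to \<open>data_law\<close> by an image map, so a
  regression vector varying with \<open>n\<close> causes no difficulty.\<close>

abbreviation base_law :: "nat \<Rightarrow> 'a measure \<Rightarrow> ((nat \<Rightarrow> 'a) \<times> (nat \<Rightarrow> real)) measure" where
  "base_law n G \<equiv> PiM {..<n} (\<lambda>_. G) \<Otimes>\<^sub>M PiM {..<n} (\<lambda>_. std_normal_distribution)"

lemma prob_space_pair:
  assumes "prob_space M1" "prob_space M2"
  shows "prob_space (M1 \<Otimes>\<^sub>M M2)"
proof -
  interpret M1: prob_space M1 by fact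
  interpret M2: prob_space M2 by fact
  interpret pair_prob_space M1 M2 ..
  show ?thesis by unfold_locales
qed

lemma prob_space_base_law: "prob_space G \<Longrightarrow> prob_space (base_law n G)"
  by (intro prob_space_pair prob_space_PiM prob_space_std_normal)

lemma distr_base_law:
  assumes "prob_space G"
  shows "distr (base_law n G) (PiM {..<n} (\<lambda>_. G \<Otimes>\<^sub>M std_normal_distribution))
      (\<lambda>(X, e). \<lambda>i\<in>{..<n}. (X i, e i)) = PiM {..<n} (\<lambda>_. G \<Otimes>\<^sub>M std_normal_distribution)"
  by (rule distr_PiM_pair) (auto intro: assms prob_space_std_normal)

lemma measurable_zip [measurable]:
  "(\<lambda>(X, e). \<lambda>i\<in>{..<n}. (X i, e i))
     \<in> base_law n G \<rightarrow>\<^sub>M PiM {..<n} (\<lambda>_. G \<Otimes>\<^sub>M std_normal_distribution)"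
  by measurable

lemma base_law_Chernoff:
  assumes G: "prob_space G" and F[measurable]: "F \<in> borel_measurable (G \<Otimes>\<^sub>M std_normal_distribution)"
    and c: "0 < c"
    and mgf: "\<And>t. \<bar>t\<bar> \<le> r \<Longrightarrow>
      (\<integral>\<^sup>+x. ennreal (exp (t * F x)) \<partial>(G \<Otimes>\<^sub>M std_normal_distribution)) \<le> ennreal (exp (c * t\<^sup>2))"
    and s: "0 < s" "s \<le> 2 * c * r"
  shows "measure (base_law n G) {\<omega> \<in> space (base_law n G). real n * s < \<bar>\<Sum>i<n. F (fst \<omega> i, snd \<omega> i)\<bar>}
    \<le> 2 * exp (- (real n * s\<^sup>2 / (4 * c)))"
proof -
  let ?H = "G \<Otimes>\<^sub>M std_normal_distribution"
  let ?z = "\<lambda>(X, e). \<lambda>i\<in>{..<n}. (X i, e i)"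
  have "measure (PiM {..<n} (\<lambda>_. ?H)) {\<omega> \<in> space (PiM {..<n} (\<lambda>_. ?H)). real n * s < \<bar>\<Sum>i<n. F (\<omega> i)\<bar>}
      = measure (distr (base_law n G) (PiM {..<n} (\<lambda>_. ?H)) ?z)
          {\<omega> \<in> space (PiM {..<n} (\<lambda>_. ?H)). real n * s < \<bar>\<Sum>i<n. F (\<omega> i)\<bar>}"
    by (simp add: distr_base_law[OF G])
  also have "\<dots> = measure (base_law n G) (?z -` {\<omega> \<in> space (PiM {..<n} (\<lambda>_. ?H)). real n * s < \<bar>\<Sum>i<n. F (\<omega> i)\<bar>} \<inter> space (base_law n G))"
    by (rule measure_distr[OF measurable_zip]) measurable
  also have "?z -` {\<omega> \<in> space (PiM {..<n} (\<lambda>_. ?H)). real n * s < \<bar>\<Sum>i<n. F (\<omega> i)\<bar>} \<inter> space (base_law n G)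
      = {\<omega> \<in> space (base_law n G). real n * s < \<bar>\<Sum>i<n. F (fst \<omega> i, snd \<omega> i)\<bar>}"
    using measurable_space[OF measurable_zip, of _ n G] by (auto split: prod.splits)
  finally show ?thesis
    using PiM_Chernoff[OF prob_space_pair[OF G prob_space_std_normal] F c mgf s, of n] by simp
qed

section \<open>Concentration of Gram entries and scores\<close>

lemma mv_normalD:
  assumes "mv_normal p S G"
  shows "S \<in> carrier_mat p p" "transpose_mat S = S" "\<And>a. 0 \<le> quad_form p S a" "prob_space G"
    "sets G = sets (rvec_borel {..<p})" "\<And>a. distr G borel (dotp p a) = centered_normal (quad_form p S a)"
  using assms by (auto simp: mv_normal_def)

lemma measurable_dotp_rvec: "dotp p a \<in> borel_measurable (rvec_borel {..<p})"
  unfolding dotp_def[abs_def] by measurable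

lemma measurable_dotp_mv_normal:
  assumes "mv_normal p S G"
  shows "dotp p a \<in> borel_measurable G"
  using measurable_dotp_rvec[of p a] measurable_cong_sets[OF mv_normalD(5)[OF assms] refl] by blast

lemma base_law_quad_deviation:
  assumes mv: "mv_normal p S G" and q: "quad_form p S a \<le> Q" and s: "0 < s" "s \<le> 2 * Q"
  shows "measure (base_law n G) {\<omega> \<in> space (base_law n G).
      real n * s < \<bar>(\<Sum>i<n. (dotp p a (fst \<omega> i))\<^sup>2 - quad_form p S a)\<bar>}
    \<le> 2 * exp (- (real n * s\<^sup>2 / (16 * Q\<^sup>2)))"
proof -
  interpret G: prob_space G by (rule mv_normalD(4)[OF mv])
  interpret N: prob_space std_normal_distribution by (rule prob_space_std_normal)
  let ?F = "\<lambda>p'::(nat \<Rightarrow> real) \<times> real. (dotp p a (fst p'))\<^sup>2 - quad_form p S a"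
  have Q: "0 < Q" using s by simp
  note [measurable] = measurable_dotp_mv_normal[OF mv]
  have "measure (base_law n G) {\<omega> \<in> space (base_law n G). real n * s < \<bar>\<Sum>i<n. ?F (fst \<omega> i, snd \<omega> i)\<bar>}
    \<le> 2 * exp (- (real n * s\<^sup>2 / (4 * (4 * Q\<^sup>2))))"
  \<comment> \<open>The admissible range of \<open>s\<close> is
    \<open>2 * (4 * Q\<^sup>2) * (1 / (4 * Q)) = 2 * Q\<close>.\<close>
  proof (rule base_law_Chernoff[where r = "1 / (4 * Q)"])
    fix t :: real assume t: "\<bar>t\<bar> \<le> 1 / (4 * Q)"
    have "(\<integral>\<^sup>+x. ennreal (exp (t * ?F x)) \<partial>(G \<Otimes>\<^sub>M std_normal_distribution))
        = (\<integral>\<^sup>+x. ennreal (exp (t * ((dotp p a x)\<^sup>2 - quad_form p S a))) \<partial>G)"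
      by (subst N.nn_integral_fst[symmetric]) (auto simp: N.emeasure_space_1[simplified])
    also have "\<dots> = (\<integral>\<^sup>+x. ennreal (exp (t * (x\<^sup>2 - quad_form p S a))) \<partial>distr G borel (dotp p a))"
      by (subst nn_integral_distr) auto
    also have "\<dots> \<le> ennreal (exp (4 * Q\<^sup>2 * t\<^sup>2))"
      unfolding mv_normalD(6)[OF mv]
      by (rule nn_integral_exp_centered_sq_le[OF mv_normalD(3)[OF mv] q Q t])
    finally show "(\<integral>\<^sup>+x. ennreal (exp (t * ?F x)) \<partial>(G \<Otimes>\<^sub>M std_normal_distribution)) \<le> ennreal (exp (4 * Q\<^sup>2 * t\<^sup>2))" .
  qed (use Q s in \<open>auto simp: power2_eq_square field_simps intro: mv_normalD(4)[OF mv]\<close>)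
  then show ?thesis by simp
qed

text \<open>Integrating the noise first leaves the exponential moment of a Gaussian square at
  parameter \<open>t\<^sup>2 / 2\<close>. As \<open>x = t\<^sup>2 * ?q\<close> is at most
  \<open>1 / 2\<close>, the exponent \<open>x / 2 + x\<^sup>2\<close> is at most \<open>x\<close>,
  hence at most \<open>Q * t\<^sup>2\<close>.\<close>

lemma base_law_noise_deviation:
  assumes mv: "mv_normal p S G" and q: "quad_form p S a \<le> Q" and Q: "1 \<le> Q" and s: "0 < s" "s \<le> 1"
  shows "measure (base_law n G) {\<omega> \<in> space (base_law n G).
      real n * s < \<bar>(\<Sum>i<n. dotp p a (fst \<omega> i) * snd \<omega> i)\<bar>}
    \<le> 2 * exp (- (real n * s\<^sup>2 / (4 * Q)))"
proof -
  interpret G: prob_space G by (rule mv_normalD(4)[OF mv])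
  interpret N: prob_space std_normal_distribution by (rule prob_space_std_normal)
  let ?F = "\<lambda>p'::(nat \<Rightarrow> real) \<times> real. dotp p a (fst p') * snd p'"
  let ?q = "quad_form p S a"
  note [measurable] = measurable_dotp_mv_normal[OF mv]
  have "measure (base_law n G) {\<omega> \<in> space (base_law n G). real n * s < \<bar>\<Sum>i<n. ?F (fst \<omega> i, snd \<omega> i)\<bar>}
    \<le> 2 * exp (- (real n * s\<^sup>2 / (4 * Q)))"
  proof (rule base_law_Chernoff[where r = "1 / (2 * Q)"])
    fix t :: real assume t: "\<bar>t\<bar> \<le> 1 / (2 * Q)"
    define x where "x = 2 * (t\<^sup>2 / 2) * ?q"
    have q0: "0 \<le> ?q" by (rule mv_normalD(3)[OF mv])
    have "t\<^sup>2 \<le> (1 / (2 * Q))\<^sup>2" using t by (metis abs_ge_zero power2_abs power_mono)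
    then have "t\<^sup>2 * Q \<le> (1 / (2 * Q))\<^sup>2 * Q" using Q by (intro mult_right_mono) auto
    also have "\<dots> = 1 / (4 * Q)" using Q by (simp add: power2_eq_square)
    also have "\<dots> \<le> 1 / 2" using Q by (simp add: field_simps)
    finally have tQ: "t\<^sup>2 * Q \<le> 1 / 2" .
    have xQ: "x \<le> t\<^sup>2 * Q" using q by (simp add: x_def mult_left_mono)
    have x: "0 \<le> x" "x \<le> 1 / 2" using tQ xQ q0 by (auto simp: x_def)
    have "(\<integral>\<^sup>+x. ennreal (exp (t * ?F x)) \<partial>(G \<Otimes>\<^sub>M std_normal_distribution))
        = (\<integral>\<^sup>+x. \<integral>\<^sup>+y. ennreal (exp ((t * dotp p a x) * y)) \<partial>std_normal_distribution \<partial>G)"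
      by (subst N.nn_integral_fst[symmetric]) (auto simp: mult_ac)
    also have "\<dots> = (\<integral>\<^sup>+x. ennreal (exp (t\<^sup>2 / 2 * (dotp p a x)\<^sup>2)) \<partial>G)"
      by (simp add: nn_integral_exp_std_normal power_mult_distrib)
    also have "\<dots> = (\<integral>\<^sup>+x. ennreal (exp (t\<^sup>2 / 2 * x\<^sup>2)) \<partial>distr G borel (dotp p a))"
      by (subst nn_integral_distr) auto
    also have "\<dots> = ennreal (1 / sqrt (1 - x))"
      unfolding mv_normalD(6)[OF mv] x_def
      by (rule nn_integral_exp_sq_centered_normal) (use q0 x in \<open>auto simp: x_def\<close>)
    also have "\<dots> \<le> ennreal (exp (x / 2 + x\<^sup>2))"
      using x by (intro ennreal_leI inverse_sqrt_one_minus_le_exp) auto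
    also have "\<dots> \<le> ennreal (exp (Q * t\<^sup>2))"
    proof -
      have "x\<^sup>2 \<le> x * (1 / 2)" unfolding power2_eq_square using x by (intro mult_left_mono) auto
      then show ?thesis using xQ by (intro ennreal_leI) (simp add: mult.commute)
    qed
    finally show "(\<integral>\<^sup>+x. ennreal (exp (t * ?F x)) \<partial>(G \<Otimes>\<^sub>M std_normal_distribution)) \<le> ennreal (exp (Q * t\<^sup>2))" .
  qed (use Q s in \<open>auto intro: mv_normalD(4)[OF mv]\<close>)
  then show ?thesis by simp
qed

lemma measurable_row_dotp:
  assumes "mv_normal p S G" "i < n"
  shows "(\<lambda>\<omega>. dotp p a (fst \<omega> i)) \<in> borel_measurable (base_law n G)"
proof -
  have "i \<in> {..<n}" using assms by simp
  then have "(\<lambda>\<omega>. fst \<omega> i) \<in> base_law n G \<rightarrow>\<^sub>M G" by measurable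
  from measurable_compose[OF this measurable_dotp_mv_normal[OF assms(1)]] show ?thesis .
qed

text \<open>Polarisation reduces the product to the squares of \<open>u + v\<close> and
  \<open>u - v\<close>. Their quadratic forms are at most \<open>4 * L\<close> by the parallelogram
  identity, and one of the two sums must deviate by \<open>2 * n * s\<close>; so the exponent is
  \<open>n * (2 * s)\<^sup>2 / (16 * (4 * L)\<^sup>2)\<close>.\<close>

lemma base_law_bilin_deviation:
  assumes mv: "mv_normal p S G" and q: "quad_form p S u \<le> L" "quad_form p S v \<le> L"
    and L: "1 \<le> L" and s: "0 < s" "s \<le> 1" and n: "0 < n"
  shows "measure (base_law n G) {\<omega> \<in> space (base_law n G).
      s < \<bar>(\<Sum>i<n. dotp p (fst \<omega> i) u * dotp p (fst \<omega> i) v) / real n - bilin p S u v\<bar>}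
    \<le> 4 * exp (- (real n * s\<^sup>2 / (64 * L\<^sup>2)))"
proof -
  interpret B: prob_space "base_law n G" by (rule prob_space_base_law[OF mv_normalD(4)[OF mv]])
  define a where "a k = u k + v k" for k
  define b where "b k = u k - v k" for k
  note S = mv_normalD(1,2,3)[OF mv]
  note [measurable] = measurable_row_dotp[OF mv]
  have cs: "quad_form p S u + quad_form p S v \<le> 2 * L" using q by simp
  have par: "quad_form p S a + quad_form p S b = 2 * quad_form p S u + 2 * quad_form p S v"
    "quad_form p S a - quad_form p S b = 4 * bilin p S u v"
    unfolding a_def b_def quad_form_bilin
    using bilin_commute[OF S(1,2), of u v]
    by (simp_all add: bilin_add_left bilin_add_right bilin_diff_left bilin_diff_right)
  then have qab: "quad_form p S a \<le> 4 * L" "quad_form p S b \<le> 4 * L"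
    using cs S(3)[of a] S(3)[of b] by linarith+
  have dev: "measure (base_law n G) {\<omega> \<in> space (base_law n G).
      real n * (2 * s) < \<bar>(\<Sum>i<n. (dotp p a (fst \<omega> i))\<^sup>2 - quad_form p S a)\<bar>}
    \<le> 2 * exp (- (real n * s\<^sup>2 / (64 * L\<^sup>2)))" if "quad_form p S a \<le> 4 * L" for a
    using base_law_quad_deviation[OF mv that, of "2 * s" n] s L
    by (simp add: power_mult_distrib)
  let ?E = "\<lambda>a. {\<omega> \<in> space (base_law n G).
      real n * (2 * s) < \<bar>(\<Sum>i<n. (dotp p a (fst \<omega> i))\<^sup>2 - quad_form p S a)\<bar>}"
  have "measure (base_law n G) {\<omega> \<in> space (base_law n G).
      s < \<bar>(\<Sum>i<n. dotp p (fst \<omega> i) u * dotp p (fst \<omega> i) v) / real n - bilin p S u v\<bar>}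
    \<le> measure (base_law n G) (?E a \<union> ?E b)"
  proof (rule B.finite_measure_mono)
    show "{\<omega> \<in> space (base_law n G).
      s < \<bar>(\<Sum>i<n. dotp p (fst \<omega> i) u * dotp p (fst \<omega> i) v) / real n - bilin p S u v\<bar>} \<subseteq> ?E a \<union> ?E b"
    proof
      fix \<omega> assume w: "\<omega> \<in> {\<omega> \<in> space (base_law n G).
        s < \<bar>(\<Sum>i<n. dotp p (fst \<omega> i) u * dotp p (fst \<omega> i) v) / real n - bilin p S u v\<bar>}"
      define A where "A = (\<Sum>i<n. (dotp p a (fst \<omega> i))\<^sup>2 - quad_form p S a)"
      define B where "B = (\<Sum>i<n. (dotp p b (fst \<omega> i))\<^sup>2 - quad_form p S b)"
      define Z where "Z = (\<Sum>i<n. dotp p (fst \<omega> i) u * dotp p (fst \<omega> i) v)"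
      have lin: "dotp p a x = dotp p x u + dotp p x v" "dotp p b x = dotp p x u - dotp p x v" for x
        by (simp_all add: a_def b_def dotp_def algebra_simps sum.distrib sum_subtractf)
      have "A - B = (\<Sum>i<n. 4 * (dotp p (fst \<omega> i) u * dotp p (fst \<omega> i) v)
          - (quad_form p S a - quad_form p S b))"
        unfolding A_def B_def sum_subtractf[symmetric]
        by (intro sum.cong) (auto simp: lin power2_eq_square algebra_simps)
      also have "\<dots> = 4 * Z - real n * (4 * bilin p S u v)"
        by (simp add: par(2) sum_subtractf Z_def sum_distrib_left)
      finally have AB: "A - B = 4 * real n * (Z / real n - bilin p S u v)"
        using n by (simp add: right_diff_distrib)
      have "\<bar>A - B\<bar> = 4 * real n * \<bar>Z / real n - bilin p S u v\<bar>"
        unfolding AB by (simp only: abs_mult abs_of_nat abs_numeral)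
      moreover have "4 * real n * s < 4 * real n * \<bar>Z / real n - bilin p S u v\<bar>"
        using w n by (intro mult_strict_left_mono) (auto simp: Z_def)
      ultimately have "4 * real n * s < \<bar>A - B\<bar>" by simp
      also have "\<dots> \<le> \<bar>A\<bar> + \<bar>B\<bar>" by (rule abs_triangle_ineq4)
      finally have "real n * (2 * s) < \<bar>A\<bar> \<or> real n * (2 * s) < \<bar>B\<bar>" by linarith
      then show "\<omega> \<in> ?E a \<union> ?E b" using w by (auto simp: A_def B_def)
    qed
  qed measurable
  also have "\<dots> \<le> measure (base_law n G) (?E a) + measure (base_law n G) (?E b)"
    by (rule measure_Un_le) measurable
  also have "\<dots> \<le> 4 * exp (- (real n * s\<^sup>2 / (64 * L\<^sup>2)))"
    using dev[OF qab(1)] dev[OF qab(2)] by simp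
  finally show ?thesis .
qed

lemma dotp_basis: "k < p \<Longrightarrow> dotp p x (\<lambda>i. if i = k then 1 else 0) = x k"
  by (simp add: dotp_def if_distrib[of "\<lambda>y. _ * y"] cong: if_cong)

lemma bilin_basis: "k < p \<Longrightarrow> bilin p S (\<lambda>i. if i = k then 1 else 0) v = (\<Sum>l<p. S $$ (k, l) * v l)"
  by (simp add: bilin_eq_row if_distrib[of "\<lambda>y. y * _"] cong: if_cong)

lemma row_dotp_measurable_right:
  assumes "mv_normal p S G" "i < n"
  shows "(\<lambda>\<omega>. dotp p (fst \<omega> i) a) \<in> borel_measurable (base_law n G)"
  using measurable_row_dotp[OF assms, of a] by (simp add: dotp_commute)

text \<open>Matrix entries are bilinear forms at basis vectors. The union bound has total weight
  \<open>4 * p\<^sup>2 + 2 * p + 4 * p\<close>, which is at most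
  \<open>10 * p\<^sup>2\<close>.\<close>

lemma not_good_event_prob:
  assumes mv: "mv_normal p S G" and q: "\<And>k. k < p \<Longrightarrow> S $$ (k, k) \<le> L" "quad_form p S v \<le> L"
    and L: "1 \<le> L" and s: "0 < s" "s \<le> 1" and n: "0 < n"
  shows "{\<omega> \<in> space (base_law n G). \<not> good_event n p S v s (fst \<omega>) (snd \<omega>)} \<in> sets (base_law n G)"
    and "measure (base_law n G) {\<omega> \<in> space (base_law n G). \<not> good_event n p S v s (fst \<omega>) (snd \<omega>)}
      \<le> 10 * (real p)\<^sup>2 * exp (- (real n * s\<^sup>2 / (64 * L\<^sup>2)))"
proof -
  let ?B = "base_law n G"
  interpret B: prob_space ?B by (rule prob_space_base_law[OF mv_normalD(4)[OF mv]])
  define basis where "basis k = (\<lambda>i::nat. if i = k then 1 else 0 :: real)" for k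
  define E where "E u w = {\<omega> \<in> space ?B.
      s < \<bar>(\<Sum>i<n. dotp p (fst \<omega> i) u * dotp p (fst \<omega> i) w) / real n - bilin p S u w\<bar>}" for u w
  define F where "F k = {\<omega> \<in> space ?B. real n * s < \<bar>(\<Sum>i<n. dotp p (basis k) (fst \<omega> i) * snd \<omega> i)\<bar>}" for k
  note [measurable] = measurable_row_dotp[OF mv] row_dotp_measurable_right[OF mv]
  have mE[measurable]: "E u w \<in> sets ?B" for u w unfolding E_def by measurable
  have mF[measurable]: "F k \<in> sets ?B" for k unfolding F_def by measurable
  have qe: "quad_form p S (basis k) \<le> L" if "k < p" for k
    using q(1)[OF that] that
    by (simp add: quad_form_bilin basis_def bilin_basis if_distrib[of "\<lambda>y. _ * y"] cong: if_cong)
  define \<rho> where "\<rho> = exp (- (real n * s\<^sup>2 / (64 * L\<^sup>2)))"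
  have E1: "measure ?B (E u w) \<le> 4 * \<rho>" if "quad_form p S u \<le> L" "quad_form p S w \<le> L" for u w
    unfolding E_def \<rho>_def by (rule base_law_bilin_deviation[OF mv that L s n])
  have F1: "measure ?B (F k) \<le> 2 * \<rho>" if "k < p" for k
  proof -
    have "measure ?B (F k) \<le> 2 * exp (- (real n * s\<^sup>2 / (4 * L)))"
      unfolding F_def by (rule base_law_noise_deviation[OF mv qe[OF that] L s])
    also have "\<dots> \<le> 2 * \<rho>"
    proof -
      have "4 * L \<le> 64 * L\<^sup>2" using L mult_left_mono[of 1 L L] unfolding power2_eq_square by linarith
      then have "real n * s\<^sup>2 / (64 * L\<^sup>2) \<le> real n * s\<^sup>2 / (4 * L)"
        using L by (intro divide_left_mono) auto
      then show ?thesis by (simp add: \<rho>_def)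
    qed
    finally show ?thesis .
  qed
  let ?bad = "{\<omega> \<in> space ?B. \<not> good_event n p S v s (fst \<omega>) (snd \<omega>)}"
  have eq: "?bad = (\<Union>k<p. \<Union>l<p. E (basis k) (basis l)) \<union> (\<Union>k<p. F k) \<union> (\<Union>k<p. E (basis k) v)"
  proof -
    have 1: "\<omega> \<in> E (basis k) (basis l) \<longleftrightarrow> \<omega> \<in> space ?B \<and> \<not> \<bar>gram n p (fst \<omega>) $$ (k, l) - S $$ (k, l)\<bar> \<le> s"
      if "k < p" "l < p" for \<omega> k l
      using that by (auto simp: E_def basis_def dotp_basis bilin_basis gram_index
          if_distrib[of "\<lambda>y. _ * y"] cong: if_cong)
    have 2: "\<omega> \<in> F k \<longleftrightarrow> \<omega> \<in> space ?B \<and> \<not> \<bar>(\<Sum>i<n. fst \<omega> i k * snd \<omega> i) / real n\<bar> \<le> s"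
      if "k < p" for \<omega> k
      using that n by (auto simp: F_def basis_def dotp_basis dotp_commute[of p "\<lambda>i. if i = k then 1 else 0"] field_simps)
    have 3: "\<omega> \<in> E (basis k) v \<longleftrightarrow> \<omega> \<in> space ?B \<and>
        \<not> \<bar>(\<Sum>i<n. fst \<omega> i k * dotp p (fst \<omega> i) v) / real n - (\<Sum>l<p. S $$ (k, l) * v l)\<bar> \<le> s"
      if "k < p" for \<omega> k
      using that by (auto simp: E_def basis_def dotp_basis bilin_basis)
    show ?thesis unfolding good_event_def using 1 2 3 by (auto 0 4)
  qed
  show "?bad \<in> sets ?B" unfolding eq by measurable
  have U: "measure ?B (\<Union>k<p. H k) \<le> real p * c" if "\<And>k. k < p \<Longrightarrow> measure ?B (H k) \<le> c"
    and "\<And>k. H k \<in> sets ?B" for H c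
  proof -
    have "measure ?B (\<Union>k<p. H k) \<le> (\<Sum>k<p. measure ?B (H k))"
      by (rule B.finite_measure_subadditive_finite) (use that in auto)
    also have "\<dots> \<le> (\<Sum>k<p. c)" by (intro sum_mono) (use that in auto)
    finally show ?thesis by simp
  qed
  have a: "measure ?B (\<Union>k<p. \<Union>l<p. E (basis k) (basis l)) \<le> real p * (real p * (4 * \<rho>))"
    by (intro U E1 qe) auto
  have b: "measure ?B (\<Union>k<p. F k) \<le> real p * (2 * \<rho>)" by (intro U F1) auto
  have c: "measure ?B (\<Union>k<p. E (basis k) v) \<le> real p * (4 * \<rho>)" by (intro U E1 qe q) auto
  have "measure ?B ?bad \<le> measure ?B (\<Union>k<p. \<Union>l<p. E (basis k) (basis l)) + measure ?B (\<Union>k<p. F k)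
      + measure ?B (\<Union>k<p. E (basis k) v)"
    unfolding eq by (intro order_trans[OF measure_Un_le] add_mono) auto
  also have "\<dots> \<le> real p * (real p * (4 * \<rho>)) + real p * (2 * \<rho>) + real p * (4 * \<rho>)"
    using a b c by linarith
  also have "\<dots> \<le> 10 * ((real p)\<^sup>2 * \<rho>)"
  proof -
    have "real p \<le> (real p)\<^sup>2" by (simp add: power2_eq_square flip: of_nat_mult)
    then have "real p * \<rho> \<le> (real p)\<^sup>2 * \<rho>" by (rule mult_right_mono) (simp add: \<rho>_def)
    then show ?thesis by (simp add: power2_eq_square algebra_simps)
  qed
  finally show "measure ?B ?bad \<le> 10 * (real p)\<^sup>2 * exp (- (real n * s\<^sup>2 / (64 * L\<^sup>2)))"
    by (simp add: \<rho>_def mult.assoc)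
qed

section \<open>Weak convergence\<close>

lemma isCont_cdf_std_normal: "isCont (cdf std_normal_distribution) x"
proof -
  interpret N: real_distribution std_normal_distribution by (rule real_dist_normal_dist)
  have "absolutely_continuous lborel std_normal_distribution"
    by (rule absolutely_continuousI_density) auto
  moreover have "{x} \<in> null_sets lborel" by (simp add: null_sets_def)
  ultimately have "{x} \<in> null_sets std_normal_distribution"
    unfolding absolutely_continuous_def by blast
  then have "measure std_normal_distribution {x} = 0" by (simp add: null_sets_def measure_def)
  then show ?thesis by (simp add: N.isCont_cdf)
qed

lemma cdf_distr:
  assumes "f \<in> borel_measurable M"
  shows "cdf (distr M borel f) x = measure M {\<omega> \<in> space M. f \<omega> \<le> x}"
proof -
  have "f -` {..x} \<inter> space M = {\<omega> \<in> space M. f \<omega> \<le> x}" by auto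
  then show ?thesis using assms by (simp add: cdf_def measure_distr)
qed

text \<open>Slutsky's lemma through distribution functions: the one of \<open>B n\<close> at
  \<open>x\<close> is squeezed between those of \<open>A n\<close> at \<open>x - \<eta>\<close> and
  \<open>x + \<eta>\<close>, where convergence holds because the limit is continuous
  everywhere.\<close>

lemma weak_conv_m_of_close:
  fixes A B :: "nat \<Rightarrow> 'a \<Rightarrow> real"
  assumes M: "\<And>n. prob_space (M n)" and A: "\<And>n. A n \<in> borel_measurable (M n)"
    and B: "\<forall>\<^sub>F n in sequentially. B n \<in> borel_measurable (M n)"
    and conv: "weak_conv_m (\<lambda>n. distr (M n) borel (A n)) N" and cont: "\<And>x. isCont (cdf N) x"
    and close: "\<And>\<eta>. 0 < \<eta> \<Longrightarrow> (\<lambda>n. measure (M n) {\<omega> \<in> space (M n). \<eta> < \<bar>B n \<omega> - A n \<omega>\<bar>}) \<longlonglongrightarrow> 0"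
  shows "weak_conv_m (\<lambda>n. distr (M n) borel (B n)) N"
  unfolding weak_conv_m_def weak_conv_def
proof (intro allI impI tendstoI)
  fix x \<epsilon> :: real assume "0 < \<epsilon>"
  have e3: "0 < \<epsilon> / 3" using \<open>0 < \<epsilon>\<close> by simp
  from cont[of x, unfolded continuous_at_eps_delta dist_real_def, rule_format, OF e3]
  obtain \<eta>' where \<eta>': "0 < \<eta>'" "\<forall>y. \<bar>y - x\<bar> < \<eta>' \<longrightarrow> \<bar>cdf N y - cdf N x\<bar> < \<epsilon> / 3"
    by (elim exE conjE)
  define \<eta> where "\<eta> = \<eta>' / 2"
  have \<eta>: "0 < \<eta>" "\<bar>cdf N (x + \<eta>) - cdf N x\<bar> < \<epsilon> / 3" "\<bar>cdf N (x - \<eta>) - cdf N x\<bar> < \<epsilon> / 3"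
    using \<eta>'(1) \<eta>'(2)[rule_format, of "x + \<eta>"] \<eta>'(2)[rule_format, of "x - \<eta>"] by (auto simp: \<eta>_def)
  have convA: "\<forall>\<^sub>F n in sequentially. \<bar>cdf (distr (M n) borel (A n)) y - cdf N y\<bar> < \<epsilon> / 3" for y
  proof -
    have "(\<lambda>n. cdf (distr (M n) borel (A n)) y) \<longlonglongrightarrow> cdf N y"
      using conv cont[of y] unfolding weak_conv_m_def weak_conv_def by simp
    from tendstoD[OF this e3] show ?thesis by (simp only: dist_real_def)
  qed
  have P: "\<forall>\<^sub>F n in sequentially. measure (M n) {\<omega> \<in> space (M n). \<eta> < \<bar>B n \<omega> - A n \<omega>\<bar>} < \<epsilon> / 3"
    by (rule order_tendstoD(2)[OF close[OF \<eta>(1)] e3])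
  show "\<forall>\<^sub>F n in sequentially. dist (cdf (distr (M n) borel (B n)) x) (cdf N x) < \<epsilon>"
    using B convA[of "x + \<eta>"] convA[of "x - \<eta>"] P
  proof eventually_elim
    case (elim n)
    interpret M: prob_space "M n" by (rule M)
    note [measurable] = elim(1) A[of n]
    let ?E = "{\<omega> \<in> space (M n). \<eta> < \<bar>B n \<omega> - A n \<omega>\<bar>}"
    have "measure (M n) {\<omega> \<in> space (M n). B n \<omega> \<le> x}
        \<le> measure (M n) ({\<omega> \<in> space (M n). A n \<omega> \<le> x + \<eta>} \<union> ?E)"
      by (rule M.finite_measure_mono) auto
    also have "\<dots> \<le> measure (M n) {\<omega> \<in> space (M n). A n \<omega> \<le> x + \<eta>} + measure (M n) ?E"
      by (rule measure_Un_le) auto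
    finally have up: "cdf (distr (M n) borel (B n)) x \<le> cdf (distr (M n) borel (A n)) (x + \<eta>) + measure (M n) ?E"
      by (simp add: cdf_distr)
    have "measure (M n) {\<omega> \<in> space (M n). A n \<omega> \<le> x - \<eta>}
        \<le> measure (M n) ({\<omega> \<in> space (M n). B n \<omega> \<le> x} \<union> ?E)"
      by (rule M.finite_measure_mono) auto
    also have "\<dots> \<le> measure (M n) {\<omega> \<in> space (M n). B n \<omega> \<le> x} + measure (M n) ?E"
      by (rule measure_Un_le) auto
    finally have lo: "cdf (distr (M n) borel (A n)) (x - \<eta>) \<le> cdf (distr (M n) borel (B n)) x + measure (M n) ?E"
      by (simp add: cdf_distr)
    show ?case using up lo elim(2-4) \<eta>(2,3) unfolding dist_real_def by linarith
  qed
qed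

text \<open>The rows live on different spaces, but only the law of the normalised sum matters. As
  the summands have law \<open>D\<close> for every \<open>n\<close>, this is the law of the sum of
  the first \<open>n\<close> coordinates of one infinite product of \<open>D\<close>.\<close>

lemma iid_row_CLT:
  fixes H :: "nat \<Rightarrow> 'a measure" and f :: "nat \<Rightarrow> 'a \<Rightarrow> real"
  assumes H: "\<And>n. prob_space (H n)" and f: "\<And>n. f n \<in> borel_measurable (H n)"
    and law: "\<And>n. distr (H n) borel (f n) = D"
    and D: "integrable D (\<lambda>x. x\<^sup>2)" "(\<integral>x. x \<partial>D) = 0" "(\<integral>x. x\<^sup>2 \<partial>D) = 1"
  shows "weak_conv_m (\<lambda>n. distr (PiM {..<n} (\<lambda>_. H n)) borel (\<lambda>\<omega>. (\<Sum>i<n. f n (\<omega> i)) / sqrt n))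
    std_normal_distribution"
proof -
  interpret D: prob_space D unfolding law[of 0, symmetric] by (rule prob_space.prob_space_distr[OF H f])
  have sD[measurable_cong]: "sets D = sets borel" using law[of 0] by (metis sets_distr)
  interpret PP: prob_space "PiM UNIV (\<lambda>_::nat. D)" by (intro prob_space_PiM D.prob_space_axioms)
  interpret P: product_prob_space "\<lambda>_::nat. D" UNIV ..
  let ?P = "PiM UNIV (\<lambda>_::nat. D)"
  have comp: "distr ?P borel (\<lambda>\<omega>. \<omega> i) = D" for i
  proof -
    have "distr ?P borel (\<lambda>\<omega>. \<omega> i) = distr ?P D (\<lambda>\<omega>. \<omega> i)"
      by (rule distr_cong) (auto simp: sD)
    then show ?thesis by (simp add: P.PiM_component)
  qed
  have m[measurable]: "(\<lambda>\<omega>. \<omega> i) \<in> borel_measurable ?P" for i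
    using measurable_component_singleton[of i UNIV "\<lambda>_. D"] measurable_cong_sets[OF refl sD] by blast
  have trans: "integral\<^sup>L ?P (\<lambda>\<omega>. g (\<omega> i)) = integral\<^sup>L D g" "integrable ?P (\<lambda>\<omega>. g (\<omega> i)) \<longleftrightarrow> integrable D g"
    if "g \<in> borel_measurable borel" for g :: "real \<Rightarrow> real" and i
    using integral_distr[OF m that, of i] integrable_distr_eq[OF m that, of i] by (simp_all add: comp)
  have "weak_conv_m (\<lambda>n. distr ?P borel (\<lambda>\<omega>. (\<Sum>i<n. \<omega> i) / sqrt (real n * 1\<^sup>2))) std_normal_distribution"
  proof (rule PP.central_limit_theorem_zero_mean)
    show "PP.indep_vars (\<lambda>i. borel) (\<lambda>i \<omega>. \<omega> i) UNIV"
    proof (subst PP.indep_vars_iff_distr_eq_PiM')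
      have "distr ?P (PiM UNIV (\<lambda>_. borel)) (\<lambda>x. \<lambda>i\<in>UNIV. x i) = distr ?P ?P (\<lambda>x. x)"
        by (rule distr_cong) (auto simp: sD intro!: sets_PiM_cong)
      then show "distr ?P (PiM UNIV (\<lambda>_. borel)) (\<lambda>x. \<lambda>i\<in>UNIV. x i) = PiM UNIV (\<lambda>i. distr ?P borel (\<lambda>\<omega>. \<omega> i))"
        by (simp add: comp distr_id)
    qed (auto intro: m)
    show e0: "PP.expectation (\<lambda>\<omega>. \<omega> n) = 0" for n using trans(1)[of "\<lambda>x. x" n] D by simp
    show "integrable ?P (\<lambda>\<omega>. (\<omega> n)\<^sup>2)" for n using trans(2)[of "\<lambda>x. x\<^sup>2" n] D by simp
    show "PP.variance (\<lambda>\<omega>. \<omega> n) = 1\<^sup>2" for n using trans(1)[of "\<lambda>x. x\<^sup>2" n] D by (simp add: e0)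
  qed (auto simp: comp)
  moreover have "distr ?P borel (\<lambda>\<omega>. (\<Sum>i<n. \<omega> i) / sqrt (real n * 1\<^sup>2))
     = distr (PiM {..<n} (\<lambda>_. H n)) borel (\<lambda>\<omega>. (\<Sum>i<n. f n (\<omega> i)) / sqrt n)" for n
  proof -
    let ?S = "\<lambda>\<omega>. (\<Sum>i<n. \<omega> i) / sqrt (real n)"
    have S[measurable]: "?S \<in> borel_measurable (PiM {..<n} (\<lambda>_. D))"
    proof -
      have "?S \<in> borel_measurable (PiM {..<n} (\<lambda>_. borel))" by measurable
      moreover have "sets (PiM {..<n} (\<lambda>_. D)) = sets (PiM {..<n} (\<lambda>_. borel))" by (intro sets_PiM_cong) (auto simp: sD)
      ultimately show ?thesis using measurable_cong_sets by blast
    qed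
    have fD: "f n \<in> H n \<rightarrow>\<^sub>M D" using f[of n] measurable_cong_sets[OF refl sD] by blast
    have lawD: "distr (H n) D (f n) = D"
      using law[of n] by (subst distr_cong[OF refl sD refl]) auto
    have "distr ?P borel (\<lambda>\<omega>. (\<Sum>i<n. \<omega> i) / sqrt (real n * 1\<^sup>2))
        = distr ?P borel (?S \<circ> (\<lambda>\<omega>. restrict \<omega> {..<n}))"
      by (intro distr_cong) auto
    also have "\<dots> = distr (distr ?P (PiM {..<n} (\<lambda>_. D)) (\<lambda>\<omega>. restrict \<omega> {..<n})) borel ?S"
      by (rule distr_distr[symmetric, OF S]) (rule measurable_restrict_subset, simp)
    also have "\<dots> = distr (PiM {..<n} (\<lambda>_. D)) borel ?S"
      by (simp add: P.distr_PiM_restrict_finite)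
    also have "PiM {..<n} (\<lambda>_. D) = PiM {..<n} (\<lambda>_. distr (H n) D (f n))" by (simp add: lawD)
    also have "\<dots> = distr (PiM {..<n} (\<lambda>_. H n)) (PiM {..<n} (\<lambda>_. D)) (compose {..<n} (f n))"
      using fD by (intro distr_PiM_finite_prob_space'[symmetric]) (auto intro: H D.prob_space_axioms)
    also have "distr \<dots> borel ?S = distr (PiM {..<n} (\<lambda>_. H n)) borel (?S \<circ> compose {..<n} (f n))"
    proof (rule distr_distr[OF S])
      show "compose {..<n} (f n) \<in> PiM {..<n} (\<lambda>_. H n) \<rightarrow>\<^sub>M PiM {..<n} (\<lambda>_. D)"
        unfolding compose_def using fD by measurable
    qed
    also have "\<dots> = distr (PiM {..<n} (\<lambda>_. H n)) borel (\<lambda>\<omega>. (\<Sum>i<n. f n (\<omega> i)) / sqrt n)"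
      by (intro distr_cong) (auto simp: compose_def)
    finally show ?thesis .
  qed
  ultimately show ?thesis by simp
qed

definition product_normal :: "real measure" where
  "product_normal = distr (std_normal_distribution \<Otimes>\<^sub>M std_normal_distribution) borel (\<lambda>(u, z). u * z)"

lemma product_normal_moments:
  "integrable product_normal (\<lambda>x. x\<^sup>2)" "(\<integral>x. x \<partial>product_normal) = 0" "(\<integral>x. x\<^sup>2 \<partial>product_normal) = 1"
proof -
  let ?N = std_normal_distribution
  interpret N: prob_space ?N using real_dist_normal_dist by (simp add: real_distribution_def)
  interpret NN: pair_prob_space ?N ?N ..
  have sq: "integrable ?N (\<lambda>x. x\<^sup>2)" "(\<integral>x. x\<^sup>2 \<partial>?N) = 1"
    using std_normal_distribution_even_moments[of 1] by auto
  have one: "integrable ?N (\<lambda>x. x)" "(\<integral>x. x \<partial>?N) = 0"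
    using integrable_std_normal_distribution_moment[of 1] integral_std_normal_distribution_moment_odd[of 1] by auto
  let ?f = "\<lambda>(u, z). u * z :: real"
  have f[measurable]: "?f \<in> borel_measurable (?N \<Otimes>\<^sub>M ?N)" by measurable
  have i2: "integrable (?N \<Otimes>\<^sub>M ?N) (\<lambda>p. (?f p)\<^sup>2)"
  proof (rule NN.Fubini_integrable)
    show "integrable ?N (\<lambda>x. \<integral>y. norm ((?f (x, y))\<^sup>2) \<partial>?N)"
      using sq by (simp add: power_mult_distrib)
    show "AE x in ?N. integrable ?N (\<lambda>y. (?f (x, y))\<^sup>2)"
      using sq by (simp add: power_mult_distrib)
  qed measurable
  have i1: "integrable (?N \<Otimes>\<^sub>M ?N) ?f"
  proof (rule NN.Fubini_integrable)
    have "integrable ?N (\<lambda>x. \<bar>x\<bar>)" using one by simp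
    then show "integrable ?N (\<lambda>x. \<integral>y. norm (?f (x, y)) \<partial>?N)" by (simp add: abs_mult)
    show "AE x in ?N. integrable ?N (\<lambda>y. ?f (x, y))" using one by simp
  qed measurable
  show "integrable product_normal (\<lambda>x. x\<^sup>2)"
    unfolding product_normal_def using i2 by (subst integrable_distr_eq) auto
  have "(\<integral>x. x \<partial>product_normal) = (\<integral>p. ?f p \<partial>(?N \<Otimes>\<^sub>M ?N))"
    unfolding product_normal_def by (subst integral_distr) auto
  also have "\<dots> = (\<integral>x. \<integral>y. ?f (x, y) \<partial>?N \<partial>?N)" by (rule NN.integral_fst'[symmetric, OF i1])
  finally show "(\<integral>x. x \<partial>product_normal) = 0" using one by simp
  have "(\<integral>x. x\<^sup>2 \<partial>product_normal) = (\<integral>p. (?f p)\<^sup>2 \<partial>(?N \<Otimes>\<^sub>M ?N))"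
    unfolding product_normal_def by (subst integral_distr) auto
  also have "\<dots> = (\<integral>x. \<integral>y. (?f (x, y))\<^sup>2 \<partial>?N \<partial>?N)" by (rule NN.integral_fst'[symmetric, OF i2])
  finally show "(\<integral>x. x\<^sup>2 \<partial>product_normal) = 1" using sq by (simp add: power_mult_distrib)
qed

section \<open>Law of the data\<close>

definition design_to_obs :: "nat \<Rightarrow> nat \<Rightarrow> (nat \<Rightarrow> real) \<Rightarrow> design \<times> (nat \<Rightarrow> real) \<Rightarrow> obs" where
  "design_to_obs n p \<beta> = (\<lambda>(X, e). (X, \<lambda>i\<in>{..<n}. dotp p (X i) \<beta> + e i))"

lemma data_law_eq: "data_law n p G \<beta> = distr (base_law n G) (obs_space n p) (design_to_obs n p \<beta>)"
  by (simp add: data_law_def design_to_obs_def)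

lemma obs_space_row [measurable]: "i < n \<Longrightarrow> (\<lambda>D. fst D i) \<in> obs_space n p \<rightarrow>\<^sub>M rvec_borel {..<p}"
  unfolding obs_space_def design_space_def
  by (rule measurable_compose[OF measurable_fst measurable_component_singleton]) simp

lemma obs_space_response [measurable]: "i < n \<Longrightarrow> (\<lambda>D. snd D i) \<in> borel_measurable (obs_space n p)"
  unfolding obs_space_def
  by (rule measurable_compose[OF measurable_snd measurable_component_singleton]) simp

lemma obs_space_entry: "i < n \<Longrightarrow> k < p \<Longrightarrow> (\<lambda>D. fst D i k) \<in> borel_measurable (obs_space n p)"
  by (rule measurable_compose[OF obs_space_row measurable_component_singleton]) auto

lemma measurable_dotp_fun:
  assumes "\<And>k. k < p \<Longrightarrow> (\<lambda>x. f x k) \<in> borel_measurable M" "\<And>k. k < p \<Longrightarrow> (\<lambda>x. g x k) \<in> borel_measurable M"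
  shows "(\<lambda>x. dotp p (f x) (g x)) \<in> borel_measurable M"
  unfolding dotp_def using assms by (intro borel_measurable_sum borel_measurable_times) auto

lemma measurable_design_to_obs:
  assumes mv: "mv_normal p S G"
  shows "design_to_obs n p \<beta> \<in> base_law n G \<rightarrow>\<^sub>M obs_space n p"
proof -
  have sG: "sets G = sets (rvec_borel {..<p})" by (rule mv_normalD(5)[OF mv])
  have X: "fst \<in> base_law n G \<rightarrow>\<^sub>M design_space n p"
  proof -
    have "sets (PiM {..<n} (\<lambda>_. G)) = sets (design_space n p)"
      unfolding design_space_def by (rule sets_PiM_cong) (auto simp: sG)
    then show ?thesis using measurable_cong_sets[OF refl] measurable_fst by blast
  qed
  have Y: "(\<lambda>\<omega>. \<lambda>i\<in>{..<n}. dotp p (fst \<omega> i) \<beta> + snd \<omega> i) \<in> base_law n G \<rightarrow>\<^sub>M rvec_borel {..<n}"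
  proof (rule measurable_restrict)
    fix i assume i: "i \<in> {..<n}"
    have "(\<lambda>\<omega>. snd \<omega> i) \<in> borel_measurable (base_law n G)" using i by measurable
    moreover have "(\<lambda>\<omega>. dotp p (fst \<omega> i) \<beta>) \<in> borel_measurable (base_law n G)"
      using row_dotp_measurable_right[OF mv] i by simp
    ultimately show "(\<lambda>\<omega>. dotp p (fst \<omega> i) \<beta> + snd \<omega> i) \<in> borel_measurable (base_law n G)"
      by (rule borel_measurable_add[rotated])
  qed
  show ?thesis
    unfolding design_to_obs_def obs_space_def case_prod_beta' by (rule measurable_Pair[OF X Y])
qed

lemma measurable_desparsified_lasso:
  assumes lasso: "lasso_estimator n p lam bhat" and node: "nodewise_estimator n p j lamj ghat" and j: "j < p"
  shows "desparsified_lasso n p j lamj bhat ghat \<in> borel_measurable (obs_space n p)"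
proof -
  let ?O = "obs_space n p"
  have b: "(\<lambda>D. bhat D k) \<in> borel_measurable ?O" if "k < p" for k
    using lasso that unfolding lasso_estimator_def
    by (intro measurable_compose[OF _ measurable_component_singleton, of bhat]) auto
  have "(\<lambda>D. ghat (fst D)) \<in> ?O \<rightarrow>\<^sub>M rvec_borel ({..<p} - {j})"
    unfolding obs_space_def using node unfolding nodewise_estimator_def
    by (intro measurable_compose[OF measurable_fst]) auto
  then have g: "(\<lambda>D. ghat (fst D) k) \<in> borel_measurable ?O" if "k \<in> {..<p} - {j}" for k
    by (rule measurable_compose[OF _ measurable_component_singleton]) (rule that)
  have x: "(\<lambda>D. fst D i k) \<in> borel_measurable ?O" if "i < n" "k < p" for i k
    by (rule obs_space_entry[OF that])
  have tau: "(\<lambda>D. tau_sq n p j lamj (fst D) (ghat (fst D))) \<in> borel_measurable ?O"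
    unfolding tau_sq_def power2_L2_set using g x j
    by (intro borel_measurable_add borel_measurable_divide borel_measurable_sum borel_measurable_power
        borel_measurable_diff borel_measurable_times borel_measurable_abs borel_measurable_const) auto
  have th: "(\<lambda>D. theta_hat n p j lamj (fst D) (ghat (fst D)) k) \<in> borel_measurable ?O" if "k < p" for k
    unfolding theta_hat_def using g[of k] that
    by (cases "k = j") (auto intro!: borel_measurable_divide tau)
  have res: "(\<lambda>D. snd D i - dotp p (fst D i) (bhat D)) \<in> borel_measurable ?O" if "i < n" for i
    by (intro borel_measurable_diff obs_space_response measurable_dotp_fun b x) (use that in auto)
  have "(\<lambda>D. bhat D j + dotp p (theta_hat n p j lamj (fst D) (ghat (fst D)))
      (\<lambda>k. \<Sum>i<n. fst D i k * (snd D i - dotp p (fst D i) (bhat D))) / real n) \<in> borel_measurable ?O"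
    by (intro borel_measurable_add borel_measurable_divide measurable_dotp_fun borel_measurable_sum
        borel_measurable_times borel_measurable_const b th x res) (use j in auto)
  then show ?thesis unfolding desparsified_lasso_def case_prod_beta' by simp
qed

lemma weak_conv_m_eventually_cong:
  assumes "\<forall>\<^sub>F n in sequentially. M n = M' n"
  shows "weak_conv_m M N \<longleftrightarrow> weak_conv_m M' N"
  unfolding weak_conv_m_def weak_conv_def
proof (intro iff_allI imp_cong refl tendsto_cong)
  fix x show "\<forall>\<^sub>F n in sequentially. cdf (M n) x = cdf (M' n) x"
    using assms by eventually_elim simp
qed

text \<open>Cauchy-Schwarz between the \<open>j\<close>-th unit vector and column \<open>j\<close>
  of the inverse, whose \<open>S\<close>-inner product is 1. It yields positivity and the upper
  bound on the residual variance.\<close>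

lemma precision_diag:
  assumes mv: "mv_normal p S G" and T: "T \<in> carrier_mat p p" "inverts_mat S T" and j: "j < p"
  shows "0 < T $$ (j, j)" "1 / T $$ (j, j) \<le> S $$ (j, j)"
    "quad_form p S (\<lambda>k. T $$ (k, j)) = T $$ (j, j)"
proof -
  note S = mv_normalD(1,2,3)[OF mv]
  let ?e = "\<lambda>i. if i = j then 1 else 0 :: real"
  show q: "quad_form p S (\<lambda>k. T $$ (k, j)) = T $$ (j, j)"
    by (simp add: quad_form_bilin bilin_inverse_column[OF S(1) T j])
  have "(bilin p S ?e (\<lambda>k. T $$ (k, j)))\<^sup>2 \<le> bilin p S ?e ?e * bilin p S (\<lambda>k. T $$ (k, j)) (\<lambda>k. T $$ (k, j))"
    using S(3) by (intro bilin_Cauchy_Schwarz S(1,2)) (simp add: quad_form_bilin)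
  moreover have "bilin p S ?e ?e = S $$ (j, j)"
    using j by (simp add: bilin_basis if_distrib[of "\<lambda>y. _ * y"] cong: if_cong)
  ultimately have 1: "1 \<le> S $$ (j, j) * T $$ (j, j)"
    by (simp add: bilin_inverse_column[OF S(1) T j])
  have "0 \<le> T $$ (j, j)" using S(3)[of "\<lambda>k. T $$ (k, j)"] q by simp
  then show "0 < T $$ (j, j)" using 1 by (cases "T $$ (j, j) = 0") auto
  then show "1 / T $$ (j, j) \<le> S $$ (j, j)" using 1 by (simp add: field_simps)
qed

lemma product_normal_law:
  assumes mv: "mv_normal p S G" and q: "quad_form p S a = 1"
  shows "distr (G \<Otimes>\<^sub>M std_normal_distribution) borel (\<lambda>(x, z). dotp p a x * z) = product_normal"
proof -
  note [measurable] = measurable_dotp_mv_normal[OF mv]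
  have N: "distr std_normal_distribution borel (\<lambda>z. z) = std_normal_distribution"
    by (rule measure_eqI) (auto simp: emeasure_distr)
  have "std_normal_distribution \<Otimes>\<^sub>M std_normal_distribution
      = distr G borel (dotp p a) \<Otimes>\<^sub>M distr std_normal_distribution borel (\<lambda>z. z)"
    by (simp add: mv_normalD(6)[OF mv] q N centered_normal_def)
  also have "\<dots> = distr (G \<Otimes>\<^sub>M std_normal_distribution) (borel \<Otimes>\<^sub>M borel) (\<lambda>(x, z). (dotp p a x, z))"
    by (rule pair_measure_distr)
      (auto simp: N intro: prob_space_imp_sigma_finite prob_space_std_normal)
  finally have "product_normal = distr (distr (G \<Otimes>\<^sub>M std_normal_distribution) (borel \<Otimes>\<^sub>M borel)
      (\<lambda>(x, z). (dotp p a x, z))) borel (\<lambda>(u, z). u * z)"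
    by (simp add: product_normal_def)
  also have "\<dots> = distr (G \<Otimes>\<^sub>M std_normal_distribution) borel ((\<lambda>(u, z). u * z) \<circ> (\<lambda>(x, z). (dotp p a x, z)))"
    by (rule distr_distr) measurable
  also have "(\<lambda>(u, z). u * z) \<circ> (\<lambda>(x, z). (dotp p a x, z)) = (\<lambda>(x, z). dotp p a x * z)"
    by auto
  finally show ?thesis ..
qed

lemma base_law_compose:
  assumes G: "prob_space G"
    and F: "F \<in> PiM {..<n} (\<lambda>_. G \<Otimes>\<^sub>M std_normal_distribution) \<rightarrow>\<^sub>M N"
  shows "distr (base_law n G) N (\<lambda>\<omega>. F (\<lambda>i\<in>{..<n}. (fst \<omega> i, snd \<omega> i)))
     = distr (PiM {..<n} (\<lambda>_. G \<Otimes>\<^sub>M std_normal_distribution)) N F"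
proof -
  have "distr (PiM {..<n} (\<lambda>_. G \<Otimes>\<^sub>M std_normal_distribution)) N F
      = distr (distr (base_law n G) (PiM {..<n} (\<lambda>_. G \<Otimes>\<^sub>M std_normal_distribution))
          (\<lambda>(X, e). \<lambda>i\<in>{..<n}. (X i, e i))) N F"
    by (simp add: distr_base_law[OF G])
  also have "\<dots> = distr (base_law n G) N (F \<circ> (\<lambda>(X, e). \<lambda>i\<in>{..<n}. (X i, e i)))"
    by (rule distr_distr[OF F measurable_zip])
  finally show ?thesis by (simp add: comp_def case_prod_beta')
qed

lemma base_law_entry_law:
  assumes mv: "mv_normal p S G" and q: "quad_form p S a = 1" and i: "i < n"
  shows "distr (base_law n G) borel (\<lambda>\<omega>. dotp p a (fst \<omega> i) * snd \<omega> i) = product_normal"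
proof -
  let ?H = "G \<Otimes>\<^sub>M std_normal_distribution"
  let ?f = "\<lambda>(x, z). dotp p a x * z"
  note [measurable] = measurable_dotp_mv_normal[OF mv]
  note G = mv_normalD(4)[OF mv]
  have f: "?f \<in> borel_measurable ?H" by measurable
  have c: "(\<lambda>\<omega>. \<omega> i) \<in> PiM {..<n} (\<lambda>_. ?H) \<rightarrow>\<^sub>M ?H" using i by (intro measurable_component_singleton) auto
  have "product_normal = distr (distr (PiM {..<n} (\<lambda>_. ?H)) ?H (\<lambda>\<omega>. \<omega> i)) borel ?f"
    using i by (subst distr_PiM_component)
      (auto intro: prob_space_pair G prob_space_std_normal simp: product_normal_law[OF mv q])
  also have "\<dots> = distr (PiM {..<n} (\<lambda>_. ?H)) borel (?f \<circ> (\<lambda>\<omega>. \<omega> i))" by (rule distr_distr[OF f c])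
  also have "\<dots> = distr (base_law n G) borel (\<lambda>\<omega>. (?f \<circ> (\<lambda>\<omega>. \<omega> i)) (\<lambda>i\<in>{..<n}. (fst \<omega> i, snd \<omega> i)))"
    by (rule base_law_compose[symmetric, OF G measurable_comp[OF c f]])
  also have "\<dots> = distr (base_law n G) borel (\<lambda>\<omega>. dotp p a (fst \<omega> i) * snd \<omega> i)"
    using i by (intro distr_cong) auto
  finally show ?thesis ..
qed

section \<open>The sequence of models\<close>

lemma exp_minus_le_inverse:
  fixes y :: real
  assumes "0 < y"
  shows "exp (- y) \<le> 1 / y"
proof -
  have "y \<le> exp y" using exp_ge_add_one_self[of y] by linarith
  then show ?thesis using assms by (simp add: exp_minus field_simps)
qed

text \<open>From \<open>2 \<le> p\<close> follows \<open>ln p \<ge> 2 / 3\<close>, hence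
  \<open>sqrt (ln p) \<le> 2 * ln p\<close>. So the first-order rate
  \<open>d * sqrt (ln p / n)\<close> is also controlled by the sparsity condition.\<close>

lemma high_dim_rates:
  fixes n p d :: nat and C \<mu> :: real
  assumes p: "2 \<le> p" and n: "0 < n" and mu: "0 \<le> \<mu>" "\<mu> \<le> C * sqrt (ln p / n)" and C: "0 \<le> C"
  shows "real d * \<mu> \<le> 2 * C * (real d * ln p / sqrt n)"
    "sqrt n * real d * \<mu>\<^sup>2 \<le> C\<^sup>2 * (real d * ln p / sqrt n)"
proof -
  have "ln 2 \<le> ln (real p)" using p by simp
  then have lp: "2 / 3 \<le> ln (real p)" using ln2_ge_two_thirds by linarith
  have "sqrt (ln p) \<le> 2 * ln p"
    using lp by (intro real_le_lsqrt) (auto simp: power2_eq_square mult_left_mono)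
  then have "sqrt (ln p / n) \<le> 2 * ln p / sqrt n"
    using n by (simp add: real_sqrt_divide divide_right_mono)
  then have "\<mu> \<le> C * (2 * ln p / sqrt n)"
    using mu C by (meson mult_left_mono order_trans)
  then have "real d * \<mu> \<le> real d * (C * (2 * ln p / sqrt n))" by (rule mult_left_mono) simp
  then show "real d * \<mu> \<le> 2 * C * (real d * ln p / sqrt n)" by (simp add: mult_ac)
  have "\<mu>\<^sup>2 \<le> (C * sqrt (ln p / n))\<^sup>2" using mu by (intro power_mono) auto
  also have "\<dots> = C\<^sup>2 * (ln p / n)" using lp by (simp add: power_mult_distrib)
  finally have "sqrt n * real d * \<mu>\<^sup>2 \<le> sqrt n * real d * (C\<^sup>2 * (ln p / n))"
    by (intro mult_left_mono) auto
  also have "\<dots> = C\<^sup>2 * (real d * ln p * (sqrt n / n))" by (simp add: mult_ac)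
  also have "sqrt n / n = 1 / sqrt n" using n by (simp add: field_simps)
  finally show "sqrt n * real d * \<mu>\<^sup>2 \<le> C\<^sup>2 * (real d * ln p / sqrt n)" by simp
qed

lemma low_dim_rates:
  fixes n m A :: nat and C \<mu> :: real
  assumes m: "m \<le> A" and n: "0 < n" and mu: "0 \<le> \<mu>" "\<mu> \<le> C / sqrt n" and C: "0 \<le> C"
  shows "real m * \<mu> \<le> A * C / sqrt n" "sqrt n * real m * \<mu>\<^sup>2 \<le> A * C\<^sup>2 / sqrt n"
proof -
  have "real m * \<mu> \<le> real A * (C / sqrt n)" using m mu by (intro mult_mono) auto
  then show "real m * \<mu> \<le> A * C / sqrt n" by simp
  have "\<mu>\<^sup>2 \<le> (C / sqrt n)\<^sup>2" using mu by (intro power_mono) auto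
  also have "\<dots> = C\<^sup>2 / n" by (simp add: power_divide)
  finally have "sqrt n * real m * \<mu>\<^sup>2 \<le> sqrt n * real A * (C\<^sup>2 / n)"
    using m by (intro mult_mono) auto
  also have "\<dots> = A * C\<^sup>2 * (sqrt n / n)" by simp
  also have "sqrt n / n = 1 / sqrt n" using n by (simp add: field_simps)
  finally show "sqrt n * real m * \<mu>\<^sup>2 \<le> A * C\<^sup>2 / sqrt n" by simp
qed

context gaussian_design_model
begin

abbreviation (input) \<theta> :: "nat \<Rightarrow> real" where "\<theta> n \<equiv> \<Theta>0 n $$ (j n, j n)"

lemma theta_pos: "0 < \<theta> n"
  by (rule precision_diag(1)[OF row_law precision(1,2) j_less])

definition unit_row :: "nat \<Rightarrow> nat \<Rightarrow> real" where
  "unit_row n k = (1 / sqrt (\<theta> n)) * \<Theta>0 n $$ (k, j n)"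

lemma quad_unit_row: "quad_form (p n) (\<Sigma>0 n) (unit_row n) = 1"
proof -
  have "quad_form (p n) (\<Sigma>0 n) (unit_row n)
      = 1 / sqrt (\<theta> n) * (1 / sqrt (\<theta> n) * quad_form (p n) (\<Sigma>0 n) (\<lambda>k. \<Theta>0 n $$ (k, j n)))"
    unfolding quad_form_bilin unit_row_def[abs_def] by (simp only: bilin_scale_left bilin_scale_right)
  also have "\<dots> = \<theta> n / (sqrt (\<theta> n) * sqrt (\<theta> n))"
    by (simp add: precision_diag(3)[OF row_law precision(1,2) j_less])
  also have "\<dots> = 1" using theta_pos[of n] by simp
  finally show ?thesis .
qed

section \<open>Lower bound for the variance of the influence function\<close>

lemma variance_lower_bound:
  assumes al: "asymptotically_linear p G j \<beta>0 T l V" and ub: "unbiased_directions p G j \<beta>0 l"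
  shows "\<exists>r. r \<longlonglongrightarrow> 0 \<and> (\<forall>\<^sub>F n in sequentially. V n \<ge> \<theta> n + r n)"
proof -
  \<comment> \<open>Admissible directions are extensional vectors, hence the restriction.\<close>
  define h where "h n = restrict (\<lambda>k. \<Theta>0 n $$ (k, j n)) {..<p n}" for n
  define P where "P n = data_law n (p n) (G n) (\<beta>0 n)" for n
  define f where "f n = (\<lambda>(X, y). l n (X (0::nat), y (0::nat)))" for n
  \<comment> \<open>The efficient influence function
    \<open>\<epsilon> * \<Theta>\<^sub>j\<^sup>T X\<close> at observation 0, with the noise written
    as response minus regression.\<close>
  define g where "g n = (\<lambda>(X, y). (y (0::nat) - dotp (p n) (X 0) (\<beta>0 n)) * dotp (p n) (h n) (X (0::nat)))" for n
  define r where "r n = (\<integral>D. f n D * g n D \<partial>P n) - \<theta> n" for n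
  have h: "h n \<in> rvec {..<p n}" for n by (simp add: h_def)
  have fg: "(\<integral>D. f n D * g n D \<partial>P n)
      = (\<integral>(X, y). l n (X 0, y 0) * (y 0 - dotp (p n) (X 0) (\<beta>0 n)) * dotp (p n) (h n) (X 0) \<partial>P n)" for n
    by (intro Bochner_Integration.integral_cong) (auto simp: f_def g_def)
  have "r \<longlonglongrightarrow> 0"
  proof -
    have "(\<lambda>n. (\<integral>(X, y). l n (X 0, y 0) * (y 0 - dotp (p n) (X 0) (\<beta>0 n)) * dotp (p n) (h n) (X 0) \<partial>P n)
        - h n (j n)) \<longlonglongrightarrow> 0"
      using ub[unfolded unbiased_directions_def, rule_format, of h "\<lambda>_. 0"] h unfolding P_def by simp
    then show ?thesis by (simp add: r_def[abs_def] fg h_def j_less)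
  qed
  moreover have "\<theta> n + 2 * r n \<le> V n" if n: "0 < n" for n
  proof -
    note mv = row_law[of n]
    interpret Base: prob_space "base_law n (G n)" by (rule prob_space_base_law[OF mv_normalD(4)[OF mv]])
    have \<Phi>: "design_to_obs n (p n) (\<beta>0 n) \<in> base_law n (G n) \<rightarrow>\<^sub>M obs_space n (p n)"
      by (rule measurable_design_to_obs[OF mv])
    have x: "(\<lambda>D. fst D 0 k) \<in> borel_measurable (obs_space n (p n))" if "k < p n" for k
      by (rule obs_space_entry[OF n that])
    have g_m: "g n \<in> borel_measurable (obs_space n (p n))"
      unfolding g_def case_prod_beta'
      by (intro borel_measurable_times borel_measurable_diff obs_space_response measurable_dotp_fun x n
          borel_measurable_const)
    have f_m: "f n \<in> borel_measurable (obs_space n (p n))"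
    proof -
      have l: "l n \<in> borel_measurable (rvec_borel {..<p n} \<Otimes>\<^sub>M borel)"
        using al by (simp add: asymptotically_linear_def)
      show ?thesis unfolding f_def case_prod_beta'
        by (rule measurable_compose[OF measurable_Pair[OF obs_space_row[OF n] obs_space_response[OF n]] l])
    qed
    have sP: "sets (P n) = sets (obs_space n (p n))" by (simp add: P_def data_law_eq)
    have fP: "f n \<in> borel_measurable (P n)" and gP: "g n \<in> borel_measurable (P n)"
      using f_m g_m measurable_cong_sets[OF sP refl] by blast+
    have f2: "integrable (P n) (\<lambda>D. (f n D)\<^sup>2)" "(\<integral>D. (f n D)\<^sup>2 \<partial>P n) = V n"
    proof -
      have e: "(\<lambda>D. (f n D)\<^sup>2) = (\<lambda>(X, y). (l n (X 0, y 0))\<^sup>2)" by (auto simp: f_def)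
      show "integrable (P n) (\<lambda>D. (f n D)\<^sup>2)" "(\<integral>D. (f n D)\<^sup>2 \<partial>P n) = V n"
        unfolding e P_def using al n by (auto simp: asymptotically_linear_def)
    qed
    \<comment> \<open>On the base law the noise is recovered exactly, and \<open>g\<close> becomes
      \<open>sqrt (\<theta> n)\<close> times a product of two independent standard normals.\<close>
    have gcomp: "g n (design_to_obs n (p n) (\<beta>0 n) \<omega>)
        = sqrt (\<theta> n) * (dotp (p n) (unit_row n) (fst \<omega> 0) * snd \<omega> 0)" for \<omega>
    proof -
      have "dotp (p n) (h n) x = sqrt (\<theta> n) * dotp (p n) (unit_row n) x" for x
        using theta_pos[of n]
        by (simp add: dotp_def sum_distrib_left h_def unit_row_def)
      then show ?thesis using n by (simp add: g_def design_to_obs_def split: prod.splits)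
    qed
    let ?w = "\<lambda>\<omega>. dotp (p n) (unit_row n) (fst \<omega> 0) * snd \<omega> 0"
    have w_m: "?w \<in> borel_measurable (base_law n (G n))"
    proof (intro borel_measurable_times measurable_row_dotp[OF mv n])
      have "0 \<in> {..<n}" using n by simp
      then show "(\<lambda>\<omega>. snd \<omega> 0) \<in> borel_measurable (base_law n (G n))" by measurable
    qed
    note law = base_law_entry_law[OF mv quad_unit_row n]
    have w2: "integrable (base_law n (G n)) (\<lambda>\<omega>. (?w \<omega>)\<^sup>2)" "(\<integral>\<omega>. (?w \<omega>)\<^sup>2 \<partial>base_law n (G n)) = 1"
      using integrable_distr_eq[OF w_m, of "\<lambda>x. x\<^sup>2"] integral_distr[OF w_m, of "\<lambda>x. x\<^sup>2"]
        product_normal_moments(1,3) unfolding law by simp_all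
    have g2: "integrable (P n) (\<lambda>D. (g n D)\<^sup>2)" "(\<integral>D. (g n D)\<^sup>2 \<partial>P n) = \<theta> n"
      using w2 theta_pos[of n] g_m
      unfolding P_def data_law_eq
      by (simp_all add: integrable_distr_eq[OF \<Phi>] integral_distr[OF \<Phi>] gcomp power_mult_distrib)
    have fgi: "integrable (P n) (\<lambda>D. f n D * g n D)"
    proof (rule Bochner_Integration.integrable_bound[OF Bochner_Integration.integrable_add[OF f2(1) g2(1)]])
      show "(\<lambda>D. f n D * g n D) \<in> borel_measurable (P n)" using fP gP by measurable
      show "AE D in P n. norm (f n D * g n D) \<le> norm ((f n D)\<^sup>2 + (g n D)\<^sup>2)"
      proof (rule AE_I2)
        fix D
        have "2 * (\<bar>f n D\<bar> * \<bar>g n D\<bar>) \<le> (f n D)\<^sup>2 + (g n D)\<^sup>2"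
          using sum_squares_bound[of "\<bar>f n D\<bar>" "\<bar>g n D\<bar>"] by (simp add: mult.assoc)
        moreover have "0 \<le> \<bar>f n D\<bar> * \<bar>g n D\<bar>" by simp
        ultimately have "\<bar>f n D\<bar> * \<bar>g n D\<bar> \<le> (f n D)\<^sup>2 + (g n D)\<^sup>2" by linarith
        then show "norm (f n D * g n D) \<le> norm ((f n D)\<^sup>2 + (g n D)\<^sup>2)"
          by (simp add: abs_mult)
      qed
    qed
    have "0 \<le> (\<integral>D. (f n D - g n D)\<^sup>2 \<partial>P n)" by (rule integral_nonneg_AE) simp
    also have "\<dots> = (\<integral>D. (f n D)\<^sup>2 + (g n D)\<^sup>2 - 2 * (f n D * g n D) \<partial>P n)"
      by (intro Bochner_Integration.integral_cong) (auto simp: power2_diff)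
    also have "\<dots> = V n + \<theta> n - 2 * (\<integral>D. f n D * g n D \<partial>P n)"
      using f2 g2 fgi by (simp add: Bochner_Integration.integral_diff Bochner_Integration.integral_add)
    finally show ?thesis by (simp add: r_def)
  qed
  \<comment> \<open>The expanded square reads
    \<open>0 \<le> V n + \<theta> n - 2 * (\<theta> n + r n)\<close>, so the error term of the
    conclusion is \<open>2 * r n\<close>.\<close>
  moreover have "(\<lambda>n. 2 * r n) \<longlonglongrightarrow> 2 * 0" using \<open>r \<longlonglongrightarrow> 0\<close> by (rule tendsto_mult_left)
  ultimately show ?thesis
    by (intro exI[of _ "\<lambda>n. 2 * r n"] conjI) (auto intro: eventually_sequentiallyI[of 1])
qed

section \<open>Constants uniform in \<open>n\<close> and the nodewise target\<close>

definition L1 :: real where "L1 = \<bar>L\<bar> + 1"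

lemma L1_ge_one: "1 \<le> L1" by (simp add: L1_def)

text \<open>\<open>L1\<close> dominates both \<open>L\<close> and 1, so one constant serves for the
  curvature and the entries while its powers remain increasing.\<close>

lemma eventually_eigenvalue_bounds:
  "\<forall>\<^sub>F n in sequentially. (\<forall>a. (\<Sum>k<p n. (a k)\<^sup>2) / L1 \<le> bilin (p n) (\<Sigma>0 n) a a) \<and>
     (\<forall>i<p n. \<forall>k<p n. \<bar>\<Sigma>0 n $$ (i, k)\<bar> \<le> L1)"
  using lambda_min_bound entry_bound
proof eventually_elim
  case (elim n)
  note S = mv_normalD(1,2,3)[OF row_law[of n]]
  have p: "0 < p n" using j_less[of n] by simp
  note q = quad_form_ge_of_lambda_min[OF S p precision(1,3)[of n] elim(1)]
  have "(\<Sum>k<p n. (a k)\<^sup>2) / L1 \<le> bilin (p n) (\<Sigma>0 n) a a" for a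
  proof -
    have "(\<Sum>k<p n. (a k)\<^sup>2) / L1 \<le> (\<Sum>k<p n. (a k)\<^sup>2) / L"
      using q(1) by (intro divide_left_mono) (auto simp: L1_def sum_nonneg)
    also have "\<dots> \<le> bilin (p n) (\<Sigma>0 n) a a" using q(2) by (simp add: quad_form_bilin)
    finally show ?thesis .
  qed
  moreover have "\<bar>\<Sigma>0 n $$ (i, k)\<bar> \<le> L1" if "i < p n" "k < p n" for i k
    using max_abs_entry_ge[OF S(1) that] elim(2) by (simp add: L1_def)
  ultimately show ?case by blast
qed

definition nodewise_target :: "nat \<Rightarrow> nat \<Rightarrow> real" where
  "nodewise_target n k = (1 / \<theta> n) * \<Theta>0 n $$ (k, j n)"

lemma quad_nodewise_target: "quad_form (p n) (\<Sigma>0 n) (nodewise_target n) = 1 / \<theta> n"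
proof -
  have "quad_form (p n) (\<Sigma>0 n) (nodewise_target n)
      = 1 / \<theta> n * (1 / \<theta> n * quad_form (p n) (\<Sigma>0 n) (\<lambda>k. \<Theta>0 n $$ (k, j n)))"
    unfolding quad_form_bilin nodewise_target_def[abs_def] by (simp only: bilin_scale_left bilin_scale_right)
  also have "\<dots> = 1 / \<theta> n"
    using theta_pos[of n] by (simp add: precision_diag(3)[OF row_law precision(1,2) j_less])
  finally show ?thesis .
qed

lemma row_nodewise_target:
  assumes "k < p n"
  shows "(\<Sum>l<p n. \<Sigma>0 n $$ (k, l) * nodewise_target n l) = (if k = j n then 1 / \<theta> n else 0)"
proof -
  have "(\<Sum>l<p n. \<Sigma>0 n $$ (k, l) * nodewise_target n l)
      = bilin (p n) (\<Sigma>0 n) (\<lambda>i. if i = k then 1 else 0) (nodewise_target n)"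
    using assms by (simp add: bilin_basis)
  also have "\<dots> = 1 / \<theta> n * (if j n = k then 1 else 0)"
    unfolding nodewise_target_def[abs_def] bilin_scale_right
    by (simp add: bilin_inverse_column[OF mv_normalD(1)[OF row_law] precision(1,2) j_less])
  finally show ?thesis by auto
qed

lemma dotp_nodewise_target:
  "dotp (p n) x (nodewise_target n) / sqrt (1 / \<theta> n) = dotp (p n) (unit_row n) x"
proof -
  have "1 / \<theta> n / sqrt (1 / \<theta> n) = 1 / sqrt (\<theta> n)"
    using theta_pos[of n] by (simp add: real_sqrt_divide field_simps)
  then show ?thesis
    by (simp add: dotp_def nodewise_target_def unit_row_def sum_divide_distrib mult_ac)
qed

lemma l0norm_nodewise_target: "l0norm (p n) (nodewise_target n) \<le> d n"
  using theta_sparse[of n] theta_pos[of n] by (simp add: l0norm_def nodewise_target_def)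

lemma d_pos: "1 \<le> d n"
proof -
  have "j n \<in> {k. k < p n \<and> \<Theta>0 n $$ (k, j n) \<noteq> 0}" using j_less[of n] theta_pos[of n] by simp
  then have "0 < l0norm (p n) (\<lambda>k. \<Theta>0 n $$ (k, j n))"
    unfolding l0norm_def by (subst card_gt_0_iff) auto
  then show ?thesis using theta_sparse[of n] by simp
qed

text \<open>Testing the curvature bound on column \<open>j\<close> of the precision matrix, whose
  quadratic form is its own diagonal entry, gives
  \<open>(\<theta> n)\<^sup>2 / L1 \<le> \<theta> n\<close>. This bounds the residual variance from
  below.\<close>

lemma theta_le:
  assumes "\<And>a. (\<Sum>k<p n. (a k)\<^sup>2) / L1 \<le> bilin (p n) (\<Sigma>0 n) a a"
  shows "\<theta> n \<le> L1"
proof -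
  have "(\<theta> n)\<^sup>2 \<le> (\<Sum>k<p n. (\<Theta>0 n $$ (k, j n))\<^sup>2)"
    using j_less[of n] by (intro member_le_sum[of "j n" _ "\<lambda>k. (\<Theta>0 n $$ (k, j n))\<^sup>2"]) auto
  then have "(\<theta> n)\<^sup>2 / L1 \<le> (\<Sum>k<p n. (\<Theta>0 n $$ (k, j n))\<^sup>2) / L1"
    using L1_ge_one by (intro divide_right_mono) auto
  also have "\<dots> \<le> \<theta> n"
    using assms[of "\<lambda>k. \<Theta>0 n $$ (k, j n)"] precision_diag(3)[OF row_law precision(1,2) j_less, of n]
    by (simp add: quad_form_bilin)
  finally show ?thesis using theta_pos[of n] L1_ge_one by (simp add: power2_eq_square field_simps)
qed

section \<open>The linear term: limit law and tail\<close>

definition linear_part :: "nat \<Rightarrow> design \<times> (nat \<Rightarrow> real) \<Rightarrow> real" where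
  "linear_part n \<omega> = (\<Sum>i<n. dotp (p n) (unit_row n) (fst \<omega> i) * snd \<omega> i) / sqrt n"

lemma measurable_linear_part: "linear_part n \<in> borel_measurable (base_law n (G n))"
proof -
  have "(\<lambda>\<omega>. dotp (p n) (unit_row n) (fst \<omega> i) * snd \<omega> i) \<in> borel_measurable (base_law n (G n))"
    if "i \<in> {..<n}" for i
  proof (rule borel_measurable_times)
    show "(\<lambda>\<omega>. dotp (p n) (unit_row n) (fst \<omega> i)) \<in> borel_measurable (base_law n (G n))"
      using measurable_row_dotp[OF row_law] that by simp
    show "(\<lambda>\<omega>. snd \<omega> i) \<in> borel_measurable (base_law n (G n))" using that by measurable
  qed
  then show ?thesis
    unfolding linear_part_def[abs_def] by (intro borel_measurable_divide borel_measurable_sum) auto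
qed

lemma linear_part_weak_conv:
  "weak_conv_m (\<lambda>n. distr (base_law n (G n)) borel (linear_part n)) std_normal_distribution"
proof -
  let ?H = "\<lambda>n. G n \<Otimes>\<^sub>M std_normal_distribution"
  define f where "f n = (\<lambda>(x, z). dotp (p n) (unit_row n) x * z)" for n
  have f: "f n \<in> borel_measurable (?H n)" for n
    unfolding f_def using measurable_dotp_mv_normal[OF row_law] by measurable
  have "weak_conv_m (\<lambda>n. distr (PiM {..<n} (\<lambda>_. ?H n)) borel (\<lambda>\<omega>. (\<Sum>i<n. f n (\<omega> i)) / sqrt n))
      std_normal_distribution"
  proof (rule iid_row_CLT[OF _ f _ product_normal_moments])
    show "prob_space (?H n)" for n by (intro prob_space_pair mv_normalD(4)[OF row_law] prob_space_std_normal)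
    show "distr (?H n) borel (f n) = product_normal" for n
      unfolding f_def by (rule product_normal_law[OF row_law quad_unit_row])
  qed
  moreover have "distr (base_law n (G n)) borel (linear_part n)
      = distr (PiM {..<n} (\<lambda>_. ?H n)) borel (\<lambda>\<omega>. (\<Sum>i<n. f n (\<omega> i)) / sqrt n)" for n
  proof -
    have "(\<lambda>\<omega>. (\<Sum>i<n. f n (\<omega> i)) / sqrt n) \<in> borel_measurable (PiM {..<n} (\<lambda>_. ?H n))"
    proof (intro borel_measurable_divide borel_measurable_sum borel_measurable_const)
      show "(\<lambda>\<omega>. f n (\<omega> i)) \<in> borel_measurable (PiM {..<n} (\<lambda>_. ?H n))" if "i \<in> {..<n}" for i
        by (rule measurable_compose[of "\<lambda>\<omega>. \<omega> i" _ "?H n" "f n"])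
          (use f that in \<open>auto intro: measurable_component_singleton\<close>)
    qed
    from base_law_compose[OF mv_normalD(4)[OF row_law] this, symmetric]
    show ?thesis by (simp add: linear_part_def[abs_def] f_def)
  qed
  ultimately show ?thesis by simp
qed

text \<open>Tightness is needed because the relative error in \<open>desparsified_close\<close>
  multiplies the linear term. The condition \<open>M \<le> sqrt n\<close> is the range
  \<open>s \<le> 1\<close> at \<open>s = M / sqrt n\<close>.\<close>

lemma linear_part_tail:
  assumes n: "0 < n" and M: "0 < M" "M \<le> sqrt n"
  shows "measure (base_law n (G n)) {\<omega> \<in> space (base_law n (G n)). M < \<bar>linear_part n \<omega>\<bar>} \<le> 2 * exp (- (M\<^sup>2 / 4))"
proof -
  have "measure (base_law n (G n)) {\<omega> \<in> space (base_law n (G n)).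
      real n * (M / sqrt n) < \<bar>(\<Sum>i<n. dotp (p n) (unit_row n) (fst \<omega> i) * snd \<omega> i)\<bar>}
    \<le> 2 * exp (- (real n * (M / sqrt n)\<^sup>2 / (4 * 1)))"
    using n M by (intro base_law_noise_deviation[OF row_law]) (auto simp: quad_unit_row)
  moreover have "real n * (M / sqrt n) < \<bar>(\<Sum>i<n. dotp (p n) (unit_row n) (fst \<omega> i) * snd \<omega> i)\<bar>
      \<longleftrightarrow> M < \<bar>linear_part n \<omega>\<bar>" for \<omega>
  proof -
    have 1: "real n * (M / sqrt n) = sqrt n * M" using n by (simp add: field_simps)
    have 2: "\<bar>linear_part n \<omega>\<bar> = \<bar>\<Sum>i<n. dotp (p n) (unit_row n) (fst \<omega> i) * snd \<omega> i\<bar> / sqrt n"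
      by (simp add: linear_part_def)
    show ?thesis unfolding 1 2 using n by (simp add: pos_less_divide_eq mult.commute)
  qed
  moreover have "real n * (M / sqrt n)\<^sup>2 / (4 * 1) = M\<^sup>2 / 4" using n by (simp add: power_divide)
  ultimately show ?thesis by simp
qed


text \<open>In high dimension (\<open>p \<ge> A\<close>) the noise level is of the order of the tuning parameters and the
  target is \<open>d\<close>-sparse; in low dimension it exceeds the tuning parameters, and sparsity is not used.\<close>

definition noise_level :: "nat \<Rightarrow> real \<Rightarrow> nat \<Rightarrow> real" where
  "noise_level A M n = (if A \<le> p n then 14 * L1 * sqrt (ln (p n) / n) else M / sqrt n)"

definition support_bound :: "nat \<Rightarrow> nat \<Rightarrow> nat" where
  "support_bound A n = (if A \<le> p n then d n else p n)"

lemma support_bound_pos: "1 \<le> support_bound A n"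
  using d_pos[of n] j_less[of n] by (simp add: support_bound_def)

text \<open>Since \<open>p\<close> may alternate between the regimes, the two bounds are added: the
  sum tends to zero and dominates whichever regime holds at \<open>n\<close>.\<close>

lemma rates:
  assumes tun: "tuning (28 * L1) p lam" "tuning (28 * L1) p lamj" and A: "2 \<le> A" and M: "0 < M"
  defines "\<mu> n \<equiv> lam n + lamj n + noise_level A M n"
  shows "(\<lambda>n. real (support_bound A n) * \<mu> n) \<longlonglongrightarrow> 0"
    "(\<lambda>n. sqrt n * real (support_bound A n) * (\<mu> n)\<^sup>2) \<longlonglongrightarrow> 0"
proof -
  define r where "r n = sqrt (ln (p n) / n)" for n
  have p1: "1 \<le> real (p n)" for n using j_less[of n] by simp
  have r0: "0 \<le> r n" for n using p1[of n] by (simp add: r_def)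
  have "\<exists>c>0. \<forall>\<^sub>F n in sequentially. 0 \<le> f n \<and> f n \<le> c * r n" if "tuning (28 * L1) p f" for f
  proof -
    have "f \<in> O(r)" using that by (auto simp: tuning_def r_def[abs_def])
    then obtain c where c: "0 < c" "\<forall>\<^sub>F n in sequentially. norm (f n) \<le> c * norm (r n)"
      unfolding bigo_def by blast
    have "\<forall>\<^sub>F n in sequentially. 28 * L1 * r n \<le> f n"
      using that by (simp add: tuning_def r_def)
    with c(2) have "\<forall>\<^sub>F n in sequentially. 0 \<le> f n \<and> f n \<le> c * r n"
    proof eventually_elim
      case (elim n)
      have "0 \<le> 28 * L1 * r n" using L1_ge_one r0 by simp
      then show ?case using elim r0[of n] by simp
    qed
    with c(1) show ?thesis by blast
  qed
  from this[OF tun(1)] this[OF tun(2)]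
  obtain c1 c2 where c: "0 < c1" "0 < c2"
    and lam: "\<forall>\<^sub>F n in sequentially. 0 \<le> lam n \<and> lam n \<le> c1 * r n"
    and lamj: "\<forall>\<^sub>F n in sequentially. 0 \<le> lamj n \<and> lamj n \<le> c2 * r n" by blast
  \<comment> \<open>\<open>C0\<close> bounds \<open>\<mu> n\<close> relative to
    \<open>sqrt (ln p / n)\<close> above the threshold, \<open>C1\<close> relative to
    \<open>1 / sqrt n\<close> below it, where \<open>ln p \<le> ln A\<close>.\<close>
  define C0 where "C0 = c1 + c2 + 14 * L1"
  define C1 where "C1 = (c1 + c2) * sqrt (ln A) + M"
  have C: "0 \<le> C0" "0 \<le> C1" using c M L1_ge_one A by (auto simp: C0_def C1_def)
  define \<rho> where "\<rho> n = real (d n) * ln (p n) / sqrt n" for n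
  have rho: "\<rho> \<longlonglongrightarrow> 0" unfolding \<rho>_def[abs_def] by (rule smalloD_tendsto[OF sparsity])
  have rho0: "0 \<le> \<rho> n" for n using p1[of n] by (simp add: \<rho>_def)
  have inv: "(\<lambda>n. c / sqrt (real n)) \<longlonglongrightarrow> 0" for c by real_asymp
  have ev: "\<forall>\<^sub>F n in sequentially. 0 \<le> real (support_bound A n) * \<mu> n \<and>
      real (support_bound A n) * \<mu> n \<le> 2 * C0 * \<rho> n + A * C1 / sqrt n \<and>
      sqrt n * real (support_bound A n) * (\<mu> n)\<^sup>2 \<le> C0\<^sup>2 * \<rho> n + A * C1\<^sup>2 / sqrt n"
    using lam lamj eventually_gt_at_top[of 0]
  proof eventually_elim
    case (elim n)
    have s0: "0 \<le> noise_level A M n"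
      using M L1_ge_one p1[of n] by (simp add: noise_level_def)
    then have mu0: "0 \<le> \<mu> n" using elim by (simp add: \<mu>_def)
    have mm: "0 \<le> real (support_bound A n) * \<mu> n" using mu0 by simp
    have low0: "0 \<le> A * C1 / sqrt n" "0 \<le> A * C1\<^sup>2 / sqrt n" using C by auto
    have high0: "0 \<le> 2 * C0 * \<rho> n" "0 \<le> C0\<^sup>2 * \<rho> n" using C rho0 by auto
    show ?case
    proof (cases "A \<le> p n")
      case True
      have "\<mu> n \<le> C0 * sqrt (ln (p n) / n)"
        using elim True by (simp add: \<mu>_def C0_def noise_level_def r_def algebra_simps)
      note high = high_dim_rates[OF order_trans[OF A True] elim(3) mu0 this C(1), of "d n", folded \<rho>_def]
      have sb: "support_bound A n = d n" using True by (simp add: support_bound_def)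
      show ?thesis using mm high low0 unfolding sb by (intro conjI; linarith)
    next
      case False
      have "r n \<le> sqrt (ln A) / sqrt n"
      proof -
        have "ln (real (p n)) \<le> ln (real A)" using False p1[of n] by simp
        then have "r n \<le> sqrt (ln A / n)" unfolding r_def by (intro real_sqrt_le_mono divide_right_mono) auto
        then show ?thesis by (simp add: real_sqrt_divide)
      qed
      then have "(c1 + c2) * r n \<le> (c1 + c2) * (sqrt (ln A) / sqrt n)"
        using c by (intro mult_left_mono) auto
      moreover have "\<mu> n \<le> (c1 + c2) * r n + M / sqrt n"
        using elim False by (simp add: \<mu>_def noise_level_def algebra_simps)
      ultimately have "\<mu> n \<le> C1 / sqrt n" by (simp add: C1_def add_divide_distrib)
      note low = low_dim_rates[OF _ elim(3) mu0 this C(2), of "p n" A]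
      have sb: "support_bound A n = p n" "p n \<le> A" using False by (simp_all add: support_bound_def)
      show ?thesis using mm low[OF sb(2)] high0 unfolding sb(1) by (intro conjI; linarith)
    qed
  qed
  have "(\<lambda>n. 2 * C0 * \<rho> n + A * C1 / sqrt n) \<longlonglongrightarrow> 2 * C0 * 0 + 0"
    by (intro tendsto_intros rho inv)
  then have lim1: "(\<lambda>n. 2 * C0 * \<rho> n + A * C1 / sqrt n) \<longlonglongrightarrow> 0" by simp
  have "(\<lambda>n. C0\<^sup>2 * \<rho> n + A * C1\<^sup>2 / sqrt n) \<longlonglongrightarrow> C0\<^sup>2 * 0 + 0"
    by (intro tendsto_intros rho inv)
  then have lim2: "(\<lambda>n. C0\<^sup>2 * \<rho> n + A * C1\<^sup>2 / sqrt n) \<longlonglongrightarrow> 0" by simp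
  show "(\<lambda>n. real (support_bound A n) * \<mu> n) \<longlonglongrightarrow> 0"
    by (rule tendsto_sandwich[OF _ _ tendsto_const lim1]) (use ev in \<open>auto elim: eventually_mono\<close>)
  show "(\<lambda>n. sqrt n * real (support_bound A n) * (\<mu> n)\<^sup>2) \<longlonglongrightarrow> 0"
    by (rule tendsto_sandwich[OF _ _ tendsto_const lim2]) (use ev in \<open>auto elim: eventually_mono\<close>)
qed

lemma noise_level_prob:
  assumes n: "0 < n" and A: "2 \<le> A" "10 / A \<le> \<epsilon>" and M: "0 < M" "10 * (real A)\<^sup>2 * exp (- (M\<^sup>2 / (64 * L1\<^sup>2))) \<le> \<epsilon>"
  shows "10 * (real (p n))\<^sup>2 * exp (- (real n * (noise_level A M n)\<^sup>2 / (64 * L1\<^sup>2))) \<le> \<epsilon>"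
proof (cases "A \<le> p n")
  case True
  have p: "0 < real (p n)" "0 \<le> ln (real (p n))" using True A by auto
  \<comment> \<open>The factor \<open>196 / 64\<close> exceeds 3, so the exponential beats
    \<open>p\<^sup>2\<close> by a full power of \<open>p\<close>.\<close>
  have e: "real n * (noise_level A M n)\<^sup>2 / (64 * L1\<^sup>2) = (196 / 64) * ln (p n)"
    using n p L1_ge_one True by (simp add: noise_level_def power_mult_distrib)
  have "exp (- (real n * (noise_level A M n)\<^sup>2 / (64 * L1\<^sup>2))) \<le> exp (- (3 * ln (p n)))"
    unfolding e using p by simp
  also have "\<dots> = 1 / (real (p n)) ^ 3"
    using p by (simp add: exp_minus exp_of_nat_mult[of 3, simplified] inverse_eq_divide)
  finally have "10 * (real (p n))\<^sup>2 * exp (- (real n * (noise_level A M n)\<^sup>2 / (64 * L1\<^sup>2)))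
      \<le> 10 * (real (p n))\<^sup>2 * (1 / (real (p n)) ^ 3)"
    by (intro mult_left_mono) auto
  also have "\<dots> = 10 / p n" using p by (simp add: power2_eq_square power3_eq_cube)
  also have "\<dots> \<le> 10 / A" using True A by (intro divide_left_mono) auto
  finally show ?thesis using A by simp
next
  case False
  have "real n * (noise_level A M n)\<^sup>2 = M\<^sup>2" using n False by (simp add: noise_level_def power_divide)
  moreover have "(real (p n))\<^sup>2 \<le> (real A)\<^sup>2" using False by (intro power_mono) auto
  ultimately have "10 * (real (p n))\<^sup>2 * exp (- (real n * (noise_level A M n)\<^sup>2 / (64 * L1\<^sup>2)))
      \<le> 10 * (real A)\<^sup>2 * exp (- (M\<^sup>2 / (64 * L1\<^sup>2)))"
    by (simp add: mult_right_mono)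
  then show ?thesis using M by simp
qed

section \<open>The remainder and the limit law\<close>

lemma desparsified_remainder:
  fixes \<beta> :: "nat \<Rightarrow> nat \<Rightarrow> real"
  assumes tun: "tuning (28 * L1) p lam" "tuning (28 * L1) p lamj"
    and lasso: "\<forall>\<^sub>F n in sequentially. lasso_estimator n (p n) (lam n) (bhat n)"
    and node: "\<forall>\<^sub>F n in sequentially. nodewise_estimator n (p n) (j n) (lamj n) (ghat n)"
    and \<beta>: "\<And>n. l0norm (p n) (\<beta> n) \<le> d n"
  defines "T \<equiv> \<lambda>n \<omega>. sqrt (real n) * (desparsified_lasso n (p n) (j n) (lamj n) (bhat n) (ghat n)
      (design_to_obs n (p n) (\<beta> n) \<omega>) - \<beta> n (j n)) / sqrt (\<theta> n)"
  assumes \<eta>: "0 < \<eta>"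
  shows "(\<lambda>n. measure (base_law n (G n)) {\<omega> \<in> space (base_law n (G n)). \<eta> < \<bar>T n \<omega> - linear_part n \<omega>\<bar>}) \<longlonglongrightarrow> 0"
proof (rule tendstoI)
  fix \<epsilon>' :: real assume "0 < \<epsilon>'"
  \<comment> \<open>The bad event and the tail of the linear part cost \<epsilon> each, and
    \<open>2 * \<epsilon> < \<epsilon>'\<close>.\<close>
  define \<epsilon> where "\<epsilon> = \<epsilon>' / 3"
  have \<epsilon>: "0 < \<epsilon>" using \<open>0 < \<epsilon>'\<close> by (simp add: \<epsilon>_def)
  obtain A0 :: nat where A0: "10 / \<epsilon> < A0" using reals_Archimedean2 by blast
  define A where "A = A0 + 2"
  have A: "2 \<le> A" "10 / A \<le> \<epsilon>"
    using A0 \<epsilon> by (auto simp: A_def field_simps)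
  \<comment> \<open>The exponent becomes \<open>y = 10 * A\<^sup>2 / \<epsilon>\<close>, and
    \<open>exp (- y) \<le> 1 / y\<close> cancels the factor \<open>10 * A\<^sup>2\<close>. The
    choice of \<open>M'\<close> below follows the same pattern.\<close>
  define M where "M = sqrt (64 * L1\<^sup>2 * (10 * (real A)\<^sup>2 / \<epsilon>))"
  have M: "0 < M" using \<epsilon> L1_ge_one A by (simp add: M_def)
  have M2: "M\<^sup>2 / (64 * L1\<^sup>2) = 10 * (real A)\<^sup>2 / \<epsilon>"
    using \<epsilon> L1_ge_one by (simp add: M_def)
  have "exp (- (10 * (real A)\<^sup>2 / \<epsilon>)) \<le> 1 / (10 * (real A)\<^sup>2 / \<epsilon>)"
    using \<epsilon> A by (intro exp_minus_le_inverse) auto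
  then have Mexp: "10 * (real A)\<^sup>2 * exp (- (M\<^sup>2 / (64 * L1\<^sup>2))) \<le> \<epsilon>"
    unfolding M2 using A by (simp add: field_simps)
  define M' where "M' = sqrt (8 / \<epsilon>)"
  have M': "0 < M'" using \<epsilon> by (simp add: M'_def)
  have "exp (- (2 / \<epsilon>)) \<le> 1 / (2 / \<epsilon>)" using \<epsilon> by (intro exp_minus_le_inverse) auto
  moreover have "M'\<^sup>2 / 4 = 2 / \<epsilon>" using \<epsilon> by (simp add: M'_def)
  ultimately have M'exp: "2 * exp (- (M'\<^sup>2 / 4)) \<le> \<epsilon>" by simp
  define s where "s = noise_level A M"
  define m where "m = support_bound A"
  define \<mu> where "\<mu> n = lam n + lamj n + s n" for n
  have lim: "(\<lambda>n. real (m n) * \<mu> n) \<longlonglongrightarrow> 0" "(\<lambda>n. sqrt n * real (m n) * (\<mu> n)\<^sup>2) \<longlonglongrightarrow> 0"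
    using rates[OF tun A(1) M] unfolding \<mu>_def m_def s_def by auto
  define a where "a n = 100 * L1 ^ 3 * real (m n) * \<mu> n" for n
  define b where "b n = 100 * L1 ^ 3 * sqrt n * real (m n) * (\<mu> n)\<^sup>2" for n
  have a: "a \<longlonglongrightarrow> 0" using tendsto_mult_left[OF lim(1), of "100 * L1 ^ 3"] by (simp add: a_def[abs_def] mult.assoc)
  have b: "b \<longlonglongrightarrow> 0" using tendsto_mult_left[OF lim(2), of "100 * L1 ^ 3"] by (simp add: b_def[abs_def] mult.assoc)
  \<comment> \<open>The bound 1 is the smallness hypothesis of \<open>desparsified_close\<close>;
    the other two split \<eta> into halves once the linear part is at most
    \<open>M'\<close>.\<close>
  have small: "\<forall>\<^sub>F n in sequentially. a n < min 1 (\<eta> / (2 * M'))" "\<forall>\<^sub>F n in sequentially. b n < \<eta> / 2"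
    using order_tendstoD(2)[OF a, of "min 1 (\<eta> / (2 * M'))"] order_tendstoD(2)[OF b, of "\<eta> / 2"] \<eta> M' by auto
  have big: "\<forall>\<^sub>F n in sequentially. M' \<le> sqrt (real n)" by real_asymp
  have tun': "\<forall>\<^sub>F n in sequentially. 28 * L1 * sqrt (ln (p n) / n) \<le> f n" if "tuning (28 * L1) p f" for f
    using that by (simp add: tuning_def)
  have "\<forall>\<^sub>F n in sequentially. measure (base_law n (G n))
      {\<omega> \<in> space (base_law n (G n)). \<eta> < \<bar>T n \<omega> - linear_part n \<omega>\<bar>} \<le> 2 * \<epsilon>"
    using eventually_eigenvalue_bounds lasso node small big tun'[OF tun(1)] tun'[OF tun(2)] eventually_gt_at_top[of 0]
  proof eventually_elim
    case (elim n)
    note n = elim(9)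
    let ?B = "base_law n (G n)"
    let ?r = "sqrt (ln (p n) / n)"
    interpret B: prob_space ?B by (rule prob_space_base_law[OF mv_normalD(4)[OF row_law]])
    have p1: "1 \<le> real (p n)" using j_less[of n] by simp
    have r0: "0 \<le> ?r" using p1 by simp
    have lam0: "0 \<le> lam n" "0 \<le> lamj n"
      using elim(7,8) r0 L1_ge_one mult_nonneg_nonneg[of "28 * L1" ?r] by linarith+
    have s0: "0 < s n"
      using M n A L1_ge_one by (auto simp: s_def noise_level_def intro!: divide_pos_pos)
    have m1: "1 \<le> m n" unfolding m_def by (rule support_bound_pos)
    have mu0: "0 \<le> \<mu> n" "s n \<le> \<mu> n" using lam0 s0 by (auto simp: \<mu>_def)
    have "1 \<le> 100 * L1 ^ 3" using one_le_power[OF L1_ge_one, of 3] by linarith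
    moreover have "\<mu> n \<le> real (m n) * \<mu> n" using m1 mu0 by (simp add: mult_le_cancel_right1)
    ultimately have "\<mu> n \<le> a n"
      using mult_mono[of 1 "100 * L1 ^ 3" "\<mu> n" "real (m n) * \<mu> n"] mu0(1) L1_ge_one
      by (simp add: a_def mult.assoc)
    \<comment> \<open>The deviation bounds are stated for \<open>s \<le> 1\<close> only.\<close>
    then have s1: "s n \<le> 1" using mu0 elim(4) by simp
    have a0: "0 \<le> a n" using mu0 L1_ge_one by (simp add: a_def)
    have q: "\<And>a. (\<Sum>k<p n. (a k)\<^sup>2) / L1 \<le> bilin (p n) (\<Sigma>0 n) a a"
      and ent: "\<And>i k. i < p n \<Longrightarrow> k < p n \<Longrightarrow> \<bar>\<Sigma>0 n $$ (i, k)\<bar> \<le> L1"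
      using elim(1) by auto
    have th: "1 / L1 \<le> 1 / \<theta> n" "1 / \<theta> n \<le> L1"
    proof -
      show "1 / L1 \<le> 1 / \<theta> n" using theta_le[OF q] theta_pos[of n] L1_ge_one by (intro divide_left_mono) auto
      have "1 / \<theta> n \<le> \<Sigma>0 n $$ (j n, j n)" by (rule precision_diag(2)[OF row_law precision(1,2) j_less])
      also have "\<dots> \<le> L1" using ent[OF j_less j_less] by (simp add: abs_le_iff)
      finally show "1 / \<theta> n \<le> L1" .
    qed
    let ?bad = "{\<omega> \<in> space ?B. \<not> good_event n (p n) (\<Sigma>0 n) (nodewise_target n) (s n) (fst \<omega>) (snd \<omega>)}"
    let ?tail = "{\<omega> \<in> space ?B. M' < \<bar>linear_part n \<omega>\<bar>}"
    have bad: "?bad \<in> sets ?B" "measure ?B ?bad \<le> \<epsilon>"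
    proof -
      have diag: "\<Sigma>0 n $$ (k, k) \<le> L1" if "k < p n" for k using ent[OF that that] by (simp add: abs_le_iff)
      have qv: "quad_form (p n) (\<Sigma>0 n) (nodewise_target n) \<le> L1" using th by (simp add: quad_nodewise_target)
      show "?bad \<in> sets ?B" by (rule not_good_event_prob(1)[OF row_law diag qv L1_ge_one s0 s1 n])
      show "measure ?B ?bad \<le> \<epsilon>"
        using not_good_event_prob(2)[OF row_law diag qv L1_ge_one s0 s1 n]
          noise_level_prob[OF n A M Mexp] unfolding s_def by linarith
    qed
    have lm[measurable]: "linear_part n \<in> borel_measurable ?B" by (rule measurable_linear_part)
    have tail: "?tail \<in> sets ?B" "measure ?B ?tail \<le> \<epsilon>"
      using linear_part_tail[OF n M' elim(6)] M'exp by (measurable, linarith)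
    have sub: "{\<omega> \<in> space ?B. \<eta> < \<bar>T n \<omega> - linear_part n \<omega>\<bar>} \<subseteq> ?bad \<union> ?tail"
    proof
      fix \<omega> assume w: "\<omega> \<in> {\<omega> \<in> space ?B. \<eta> < \<bar>T n \<omega> - linear_part n \<omega>\<bar>}"
      show "\<omega> \<in> ?bad \<union> ?tail"
      proof (rule ccontr)
        assume "\<omega> \<notin> ?bad \<union> ?tail"
        then have good: "good_event n (p n) (\<Sigma>0 n) (nodewise_target n) (s n) (fst \<omega>) (snd \<omega>)"
          and lin: "\<bar>linear_part n \<omega>\<bar> \<le> M'" using w by auto
        define X where "X = fst \<omega>"
        define e where "e = snd \<omega>"
        define y where "y = (\<lambda>i\<in>{..<n}. dotp (p n) (X i) (\<beta> n) + e i)"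
        have Phi: "design_to_obs n (p n) (\<beta> n) \<omega> = (X, y)"
          by (simp add: design_to_obs_def X_def e_def y_def split: prod.splits)
        have sp: "(X, y) \<in> space (obs_space n (p n))"
          using measurable_space[OF measurable_design_to_obs[OF row_law], of \<omega> n n "\<beta> n"] w Phi by simp
        then have spX: "X \<in> space (design_space n (p n))"
          by (simp add: obs_space_def space_pair_measure)
        have regime: "(0 < lam n \<and> 2 * s n \<le> lam n \<and> 0 < lamj n \<and> 2 * s n \<le> lamj n \<and>
            l0norm (p n) (\<beta> n) \<le> m n \<and> l0norm (p n) (nodewise_target n) \<le> m n) \<or> p n \<le> m n"
        proof (cases "A \<le> p n")
          case True
          have "2 * s n = 28 * L1 * ?r" using True by (simp add: s_def noise_level_def)
          then show ?thesis using elim(7,8) s0 \<beta>[of n] l0norm_nodewise_target[of n] True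
            by (simp add: m_def support_bound_def)
        qed (simp add: m_def support_bound_def)
        \<comment> \<open>The deterministic bound is used at \<open>\<tau> = 1 / \<theta> n\<close>,
          hence the double reciprocal.\<close>
        have close: "\<bar>sqrt n * (desparsified_lasso n (p n) (j n) (lamj n) (bhat n) (ghat n) (X, y) - \<beta> n (j n)) / sqrt (1 / (1 / \<theta> n))
            - (\<Sum>i<n. dotp (p n) (X i) (nodewise_target n) / sqrt (1 / \<theta> n) * e i) / sqrt n\<bar>
          \<le> 100 * L1 ^ 3 * real (m n) * \<mu> n * \<bar>(\<Sum>i<n. dotp (p n) (X i) (nodewise_target n) / sqrt (1 / \<theta> n) * e i) / sqrt n\<bar>
            + 100 * L1 ^ 3 * sqrt n * real (m n) * (\<mu> n)\<^sup>2"
        proof (rule desparsified_close[where e = e and y = y and \<beta> = "\<beta> n" and s = "s n"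
              and lam = "lam n" and S = "\<Sigma>0 n" and v = "nodewise_target n"])
          show "good_event n (p n) (\<Sigma>0 n) (nodewise_target n) (s n) X e" using good by (simp add: X_def e_def)
          show "j n < p n" by (rule j_less)
          show "(\<Sum>k<p n. (a k)\<^sup>2) / L1 \<le> bilin (p n) (\<Sigma>0 n) a a" for a by (rule q)
          show "1 \<le> L1" by (rule L1_ge_one)
          show "\<bar>\<Sigma>0 n $$ (j n, k)\<bar> \<le> L1" if "k < p n" for k by (rule ent[OF j_less that])
          show "nodewise_target n (j n) = 1" using theta_pos[of n] by (simp add: nodewise_target_def)
          show "(\<Sum>l<p n. \<Sigma>0 n $$ (k, l) * nodewise_target n l) = (if k = j n then 1 / \<theta> n else 0)"
            if "k < p n" for k by (rule row_nodewise_target[OF that])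
          show "is_arg_min (lasso_obj n {..<p n} (lam n) X y) (\<lambda>b. b \<in> rvec {..<p n}) (bhat n (X, y))"
            using elim(2) sp unfolding lasso_estimator_def by blast
          show "is_arg_min (lasso_obj n ({..<p n} - {j n}) (lamj n) X (\<lambda>i. X i (j n)))
              (\<lambda>g. g \<in> rvec ({..<p n} - {j n})) (ghat n X)"
            using elim(3) spX unfolding nodewise_estimator_def by blast
          show "y i = dotp (p n) (X i) (\<beta> n) + e i" if "i < n" for i using that by (simp add: y_def)
          show "lam n + lamj n + s n \<le> \<mu> n" by (simp add: \<mu>_def)
          show "100 * L1 ^ 3 * real (m n) * \<mu> n \<le> 1" using elim(4) by (simp add: a_def)
        qed (use th s0 lam0 m1 regime in auto)
        moreover have "(\<Sum>i<n. dotp (p n) (X i) (nodewise_target n) / sqrt (1 / \<theta> n) * e i) / sqrt n = linear_part n \<omega>"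
          unfolding dotp_nodewise_target by (simp add: linear_part_def X_def e_def)
        moreover have "T n \<omega> = sqrt n * (desparsified_lasso n (p n) (j n) (lamj n) (bhat n) (ghat n) (X, y) - \<beta> n (j n)) / sqrt (1 / (1 / \<theta> n))"
          by (simp add: T_def Phi)
        ultimately have "\<bar>T n \<omega> - linear_part n \<omega>\<bar> \<le> a n * \<bar>linear_part n \<omega>\<bar> + b n"
          by (simp only: a_def b_def)
        also have "\<dots> \<le> \<eta> / (2 * M') * M' + \<eta> / 2"
          using elim(4,5) a0 lin M' \<eta> by (intro add_mono mult_mono) auto
        also have "\<dots> = \<eta>" using M' by simp
        finally show False using w by simp
      qed
    qed
    have "measure ?B {\<omega> \<in> space ?B. \<eta> < \<bar>T n \<omega> - linear_part n \<omega>\<bar>} \<le> measure ?B (?bad \<union> ?tail)"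
      using sub bad tail by (intro B.finite_measure_mono) auto
    also have "\<dots> \<le> measure ?B ?bad + measure ?B ?tail"
      using bad tail by (intro measure_Un_le) auto
    finally show ?case using bad tail by simp
  qed
  then show "\<forall>\<^sub>F n in sequentially. dist (measure (base_law n (G n))
      {\<omega> \<in> space (base_law n (G n)). \<eta> < \<bar>T n \<omega> - linear_part n \<omega>\<bar>}) 0 < \<epsilon>'"
    by eventually_elim (use \<open>0 < \<epsilon>'\<close> in \<open>simp add: \<epsilon>_def\<close>)
qed

text \<open>The estimators are measurable minimisers only for large \<open>n\<close>, so the image
  laws on data and base space are identified only eventually.\<close>

lemma asymptotic_normality:
  assumes tun: "tuning (28 * L1) p lam" "tuning (28 * L1) p lamj"
    and lasso: "\<forall>\<^sub>F n in sequentially. lasso_estimator n (p n) (lam n) (bhat n)"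
    and node: "\<forall>\<^sub>F n in sequentially. nodewise_estimator n (p n) (j n) (lamj n) (ghat n)"
    and \<beta>: "\<And>n. l0norm (p n) (\<beta> n) \<le> d n"
  shows "weak_conv_m
     (\<lambda>n. distr (data_law n (p n) (G n) (\<beta> n)) borel
        (\<lambda>D. sqrt (real n) *
           (desparsified_lasso n (p n) (j n) (lamj n) (bhat n) (ghat n) D - \<beta> n (j n)) / sqrt (\<theta> n)))
     std_normal_distribution"
proof -
  define F where "F n D = sqrt (real n) *
     (desparsified_lasso n (p n) (j n) (lamj n) (bhat n) (ghat n) D - \<beta> n (j n)) / sqrt (\<theta> n)" for n D
  define \<Phi> where "\<Phi> n = design_to_obs n (p n) (\<beta> n)" for n
  have \<Phi>: "\<Phi> n \<in> base_law n (G n) \<rightarrow>\<^sub>M obs_space n (p n)" for n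
    unfolding \<Phi>_def by (rule measurable_design_to_obs[OF row_law])
  have F: "\<forall>\<^sub>F n in sequentially. F n \<in> borel_measurable (obs_space n (p n))"
    using lasso node
  proof eventually_elim
    case (elim n)
    from measurable_desparsified_lasso[OF elim j_less] show ?case
      unfolding F_def by measurable
  qed
  have "\<forall>\<^sub>F n in sequentially. distr (data_law n (p n) (G n) (\<beta> n)) borel (F n)
      = distr (base_law n (G n)) borel (\<lambda>\<omega>. F n (\<Phi> n \<omega>))"
    using F
  proof eventually_elim
    case (elim n)
    from distr_distr[OF elim \<Phi>] show ?case by (simp add: data_law_eq \<Phi>_def comp_def)
  qed
  moreover have "weak_conv_m (\<lambda>n. distr (base_law n (G n)) borel (\<lambda>\<omega>. F n (\<Phi> n \<omega>))) std_normal_distribution"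
  proof (rule weak_conv_m_of_close[OF _ measurable_linear_part _ linear_part_weak_conv isCont_cdf_std_normal])
    show "prob_space (base_law n (G n))" for n by (rule prob_space_base_law[OF mv_normalD(4)[OF row_law]])
    show "\<forall>\<^sub>F n in sequentially. (\<lambda>\<omega>. F n (\<Phi> n \<omega>)) \<in> borel_measurable (base_law n (G n))"
      using F by eventually_elim (rule measurable_compose[OF \<Phi>])
    show "(\<lambda>n. measure (base_law n (G n)) {\<omega> \<in> space (base_law n (G n)). \<eta> < \<bar>F n (\<Phi> n \<omega>) - linear_part n \<omega>\<bar>}) \<longlonglongrightarrow> 0"
      if "0 < \<eta>" for \<eta>
      using desparsified_remainder[OF tun lasso node \<beta> that] unfolding F_def \<Phi>_def .
  qed
  ultimately have "weak_conv_m (\<lambda>n. distr (data_law n (p n) (G n) (\<beta> n)) borel (F n)) std_normal_distribution"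
    by (subst weak_conv_m_eventually_cong)
  then show ?thesis unfolding F_def .
qed

end

theorem theorem6:
  fixes C c L :: real
  assumes "C > 0" and "c > 0"
  shows "\<exists>K>0. \<forall>p \<Sigma>0 \<Theta>0 G j d B \<beta>0.
    gaussian_design_model C L p \<Sigma>0 \<Theta>0 G j d B \<beta>0 \<longrightarrow>
      (\<forall>lam lamj bhat ghat \<beta>t.
         tuning K p lam \<longrightarrow> tuning K p lamj \<longrightarrow>
         (\<forall>\<^sub>F n in sequentially. lasso_estimator n (p n) (lam n) (bhat n)) \<longrightarrow>
         (\<forall>\<^sub>F n in sequentially. nodewise_estimator n (p n) (j n) (lamj n) (ghat n)) \<longrightarrow>
         (\<forall>n. \<beta>t n \<in> sparse_ball (B n) C (p n) (d n) (\<beta>0 n) (c / sqrt (real n))) \<longrightarrow>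
         weak_conv_m
           (\<lambda>n. distr (data_law n (p n) (G n) (\<beta>t n)) borel
              (\<lambda>D. sqrt (real n) *
                 (desparsified_lasso n (p n) (j n) (lamj n) (bhat n) (ghat n) D - \<beta>t n (j n))
                 / sqrt (\<Theta>0 n $$ (j n, j n))))
           std_normal_distribution) \<and>
      (\<forall>T l V.
         asymptotically_linear p G j \<beta>0 T l V \<longrightarrow>
         unbiased_directions p G j \<beta>0 l \<longrightarrow>
         (\<exists>r. r \<longlonglongrightarrow> 0 \<and> (\<forall>\<^sub>F n in sequentially. V n \<ge> \<Theta>0 n $$ (j n, j n) + r n)))"
proof (intro exI[of _ "28 * (\<bar>L\<bar> + 1)"] conjI allI impI)
  show "0 < 28 * (\<bar>L\<bar> + 1)" by simp
next
  fix p \<Sigma>0 \<Theta>0 G j d B \<beta>0 lam lamj bhat ghat \<beta>t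
  assume "gaussian_design_model C L p \<Sigma>0 \<Theta>0 G j d B \<beta>0"
  then interpret gaussian_design_model C L p \<Sigma>0 \<Theta>0 G j d B \<beta>0 .
  assume "tuning (28 * (\<bar>L\<bar> + 1)) p lam" "tuning (28 * (\<bar>L\<bar> + 1)) p lamj"
    and est: "\<forall>\<^sub>F n in sequentially. lasso_estimator n (p n) (lam n) (bhat n)"
      "\<forall>\<^sub>F n in sequentially. nodewise_estimator n (p n) (j n) (lamj n) (ghat n)"
    and \<beta>t: "\<forall>n. \<beta>t n \<in> sparse_ball (B n) C (p n) (d n) (\<beta>0 n) (c / sqrt (real n))"
  then have tun: "tuning (28 * L1) p lam" "tuning (28 * L1) p lamj" by (simp_all add: L1_def)
  have "l0norm (p n) (\<beta>t n) \<le> d n" for n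
    using \<beta>t by (simp add: sparse_ball_def sparse_params_def)
  from asymptotic_normality[OF tun est this]
  show "weak_conv_m
     (\<lambda>n. distr (data_law n (p n) (G n) (\<beta>t n)) borel
        (\<lambda>D. sqrt (real n) *
           (desparsified_lasso n (p n) (j n) (lamj n) (bhat n) (ghat n) D - \<beta>t n (j n))
           / sqrt (\<Theta>0 n $$ (j n, j n))))
     std_normal_distribution" .
next
  fix p \<Sigma>0 \<Theta>0 G j d B \<beta>0 T l V
  assume "gaussian_design_model C L p \<Sigma>0 \<Theta>0 G j d B \<beta>0"
  then interpret gaussian_design_model C L p \<Sigma>0 \<Theta>0 G j d B \<beta>0 .
  assume "asymptotically_linear p G j \<beta>0 T l V" "unbiased_directions p G j \<beta>0 l"
  then show "\<exists>r. r \<longlonglongrightarrow> 0 \<and> (\<forall>\<^sub>F n in sequentially. V n \<ge> \<Theta>0 n $$ (j n, j n) + r n)"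
    by (rule variance_lower_bound)
qed

end
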